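(* Let $K$ be a compact generic nondegenerate $\mathcal{C}^5$ piecewise-smooth submanifold in $\mathbb{C}^n$. Then there exists a constant $C>0$ such that for every complex polynomial $p$ on $\mathbb{C}^n$ we have $$\|\nabla p\|_{L^\infty(K)}\le C(\deg p)^2\|p\|_{L^\infty(K)}.$$ If additionally $K$ has no singularity, then (for some constant $C>0$ independent of $p$) $$\|\nabla p\|_{L^\infty(K)}\le C\deg p\,\|p\|_{L^\infty(K)}.$$
   Context: A (convex) polyhedron in $\mathbb{R}^N$ is the intersection of a finite number of closed half-spaces. A subset $K$ of a real $N$-dimensional smooth manifold $Y$ is called a nondegenerate $\mathcal{C}^5$ piecewise-smooth submanifold of dimension $m$ if for every $p\in K$ there is a local chart $(W_p,\Psi)$ of $Y$ around $p$ such that $\Psi$ is a $\mathcal{C}^5$-diffeomorphism from $W_p$ to the unit ball of $\mathbb{R}^N$ and $\Psi(K\cap W_p)$ is the intersection with the unit ball of a finite union of convex polyhedra of the same dimension $m$. A point $p\in K$ is regular if the chart can be chosen such that $\Psi(K\cap W_p)$ is the intersection of the unit ball with an $m$-dimensional vector subspace of $\mathbb{R}^N$; the singular part of $K$ is the set of non-regular points, and $K$ has no singularity if all its points are regular (i.e. $K$ is a $\mathcal{C}^5$ submanifold without boundary). Here $\mathbb{C}^n$ is regarded as a real $2n$-dimensional manifold with complex structure $J$ on its tangent spaces. $K\subset\mathbb{C}^n$ is (Cauchy-Riemann) generic if for every $p\in K$ and every sequence of regular points $(p_m)_m\subset K$ converging to $p$, any limit $E$ of the tangent spaces $T_{p_m}K$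 satisfies $E+JE=T_p\mathbb{C}^n$. $\nabla p=(\partial_{z_1}p,\dots,\partial_{z_n}p)$ is the full (holomorphic) gradient on $\mathbb{C}^n$. *)

theory Defs
  imports "HOL-Analysis.Analysis" "HOL-Library.Poly_Mapping"
begin

section \<open>Piecewise-smooth submanifolds of a Euclidean space\<close>

text \<open>Only meant for open \<open>S\<close>. The recursion is the usual one: a map is of class
  \<open>C\<close> to the \<open>k + 1\<close> iff it is differentiable and all its directional derivatives are of class
  \<open>C\<close> to the \<open>k\<close>.\<close>

primrec Ck_on ::
  "nat \<Rightarrow> ('a::real_normed_vector \<Rightarrow> 'b::real_normed_vector) \<Rightarrow> 'a set \<Rightarrow> bool" where
  "Ck_on 0 f S \<longleftrightarrow> continuous_on S f"
| "Ck_on (Suc k) f S \<longleftrightarrow>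
     (\<forall>x\<in>S. f differentiable (at x)) \<and>
     (\<forall>v. Ck_on k (\<lambda>x. frechet_derivative f (at x) v) S)"

definition Ck_diffeomorphism ::
  "nat \<Rightarrow> ('a::real_normed_vector \<Rightarrow> 'b::real_normed_vector) \<Rightarrow> 'a set \<Rightarrow> 'b set \<Rightarrow> bool" where
  "Ck_diffeomorphism k \<Psi> W V \<longleftrightarrow>
     open W \<and> open V \<and> bij_betw \<Psi> W V \<and> Ck_on k \<Psi> W \<and> Ck_on k (inv_into W \<Psi>) V"

text \<open>The ambient manifold is the Euclidean space \<open>'a\<close> itself, of real dimension
  \<open>N = DIM('a)\<close>; \<open>'a\<close> also serves as the model space for charts.\<close>

definition chart_around ::
  "nat \<Rightarrow> 'a::euclidean_space \<Rightarrow> 'a set \<Rightarrow> ('a \<Rightarrow> 'a) \<Rightarrow> bool" where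
  "chart_around k p W \<Psi> \<longleftrightarrow> p \<in> W \<and> Ck_diffeomorphism k \<Psi> W (ball 0 1)"

definition piecewise_smooth_submanifold ::
  "nat \<Rightarrow> nat \<Rightarrow> 'a::euclidean_space set \<Rightarrow> bool" where
  "piecewise_smooth_submanifold k m K \<longleftrightarrow>
     (\<forall>p\<in>K. \<exists>W \<Psi>. chart_around k p W \<Psi> \<and>
        (\<exists>\<P>. finite \<P> \<and> (\<forall>P\<in>\<P>. polyhedron P \<and> aff_dim P = int m) \<and>
             \<Psi> ` (K \<inter> W) = ball 0 1 \<inter> \<Union>\<P>))"

definition regular_point ::
  "nat \<Rightarrow> nat \<Rightarrow> 'a::euclidean_space set \<Rightarrow> 'a \<Rightarrow> bool" where
  "regular_point k m K p \<longleftrightarrow>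
     p \<in> K \<and>
     (\<exists>W \<Psi>. chart_around k p W \<Psi> \<and>
        (\<exists>L. subspace L \<and> dim L = m \<and> \<Psi> ` (K \<inter> W) = ball 0 1 \<inter> L))"

definition singular_part ::
  "nat \<Rightarrow> nat \<Rightarrow> 'a::euclidean_space set \<Rightarrow> 'a set" where
  "singular_part k m K = {p \<in> K. \<not> regular_point k m K p}"


section \<open>Tangent spaces and generic sets\<close>

text \<open>Velocities at \<open>p\<close> of \<open>C\<close>-one curves in \<open>K\<close> through \<open>p\<close>. This is the tangent space only when
  \<open>p\<close> is a regular point of \<open>K\<close>, which is the only case where it is used.\<close>

definition tangent_space_at :: "'a::euclidean_space set \<Rightarrow> 'a \<Rightarrow> 'a set" where
  "tangent_space_at K p =
     {v. \<exists>\<gamma> e. e > 0 \<and> Ck_on 1 \<gamma> {-e<..<e::real} \<and> \<gamma> ` {-e<..<e} \<subseteq> K \<and> \<gamma> 0 = p \<and>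
          (\<gamma> has_vector_derivative v) (at 0)}"

text \<open>The usual metric on the Grassmannian: the operator norm of the difference of the orthogonal
  projections. For a linear subspace \<open>E\<close>, \<open>closest_point E\<close> is the orthogonal projection.\<close>

definition gap_dist :: "'a::euclidean_space set \<Rightarrow> 'a set \<Rightarrow> real" where
  "gap_dist E F = onorm (\<lambda>v. closest_point E v - closest_point F v)"

definition CR_generic :: "nat \<Rightarrow> nat \<Rightarrow> (complex ^ 'n) set \<Rightarrow> bool" where
  "CR_generic k m K \<longleftrightarrow>
     (\<forall>p\<in>K. \<forall>q :: nat \<Rightarrow> complex ^ 'n. \<forall>E.
        (\<forall>j. regular_point k m K (q j)) \<longrightarrow> q \<longlonglongrightarrow> p \<longrightarrow>
        subspace E \<longrightarrow> dim E = m \<longrightarrow>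
        (\<lambda>j. gap_dist (tangent_space_at K (q j)) E) \<longlonglongrightarrow> 0 \<longrightarrow>
        {u + \<i> *s v | u v. u \<in> E \<and> v \<in> E} = UNIV)"


section \<open>Polynomials in several complex variables\<close>

text \<open>A polynomial is the finitely supported map from monomials (exponent vectors) to
  coefficients; the variables are indexed by \<open>'n\<close>.\<close>

type_synonym 'n cpoly = "('n \<Rightarrow>\<^sub>0 nat) \<Rightarrow>\<^sub>0 complex"

definition eval_cpoly :: "'n::finite cpoly \<Rightarrow> complex ^ 'n \<Rightarrow> complex" where
  "eval_cpoly p z =
     (\<Sum>\<alpha>\<in>Poly_Mapping.keys p.
        Poly_Mapping.lookup p \<alpha> * (\<Prod>i\<in>UNIV. (z $ i) ^ Poly_Mapping.lookup \<alpha> i))"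

text \<open>Total degree; the zero polynomial gets degree 0.\<close>

definition total_degree :: "'n::finite cpoly \<Rightarrow> nat" where
  "total_degree p =
     Max (insert 0 ((\<lambda>\<alpha>. \<Sum>i\<in>UNIV. Poly_Mapping.lookup \<alpha> i) ` Poly_Mapping.keys p))"

definition holo_gradient :: "(complex ^ 'n \<Rightarrow> complex) \<Rightarrow> complex ^ 'n \<Rightarrow> complex ^ 'n" where
  "holo_gradient f z = (\<chi> i. deriv (\<lambda>w. f (\<chi> j. if j = i then w else z $ j)) (z $ i))"

text \<open>The case split only fixes the value for the empty set, where \<open>Sup\<close> on the reals is
  unspecified.\<close>

definition sup_norm_on :: "'a set \<Rightarrow> ('a \<Rightarrow> 'b::real_normed_vector) \<Rightarrow> real" where
  "sup_norm_on K f = (if K = {} then 0 else (SUP z\<in>K. norm (f z)))"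

end

theory Submission
  imports Defs "HOL-Complex_Analysis.Conformal_Mappings"
begin

text \<open>
  Write \<open>d\<close> for the degree of the polynomial \<open>f\<close> and let \<open>|f| \<le> M\<close> on \<open>K\<close>. By Cauchy's inequality it is
  enough to bound \<open>|f|\<close> by a constant times \<open>M\<close> at distance \<open>1 / d\<^sup>k\<close> from each \<open>p \<in> K\<close>, where \<open>k = 1\<close> at a
  regular point and \<open>k = 2\<close> in general. In terms of \<open>u = ln (|f| / M) / d\<close> this is the estimate
  \<open>u z \<le> const * root k (dist z p)\<close>: Lipschitz continuity of the extremal function of \<open>K\<close> at a regular
  point, and Hoelder continuity with exponent \<open>1/2\<close> at a singular one.

  The two cases are treated together. Near \<open>p\<close> the set \<open>K\<close> contains the image of a map
  \<open>g t = \<Phi> (q + (\<Sum>b. (t \<bullet> b) ^ k *\<^sub>R v b))\<close> defined for all small real vectors \<open>t\<close>; here \<open>\<Phi>\<close> is an inverse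
  chart and the \<open>v b\<close> span the flat piece through \<open>q\<close>. For \<open>k = 1\<close> this parametrises a linear subspace. For
  \<open>k = 2\<close> the squares fold the whole parameter space into the convex cone of a polyhedron at its
  possibly singular point \<open>q\<close>, so that boundary points of the piece become interior points of the
  parameter domain, at the price of a square root when one solves for \<open>t\<close>. The second-order Taylor
  polynomial in an imaginary direction extends \<open>g\<close> to a map \<open>Q t s\<close>, thought of as \<open>g (t + \<i> s)\<close>. It is not
  holomorphic, but on every complex line \<open>t + \<zeta> s\<close> with real \<open>t\<close> and \<open>s\<close> it differs from a quadratic
  polynomial disc by \<open>O(|s|\<^sup>3)\<close> only, and genericity of the tangent space means that it reaches every
  point near \<open>p\<close>. These properties are collected in \<open>disc_system\<close> below, without any reference to
  charts.

  The analytic heart is \<open>disc_system_weight_bound\<close>. One compares \<open>u\<close> with \<open>N\<close> times the weight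
  \<open>a * (|s| - \<kappa> * |s| powr (3/2)) + a * |t|\<^sup>2 + D * root k |z - Q t s|\<close> and maximises the difference over
  \<open>z\<close>, \<open>t\<close> and \<open>s\<close> jointly; here \<open>N\<close> is an upper bound of \<open>u\<close> on a large ball. At a maximum with \<open>s \<noteq> 0\<close>, moving \<open>z\<close> along the disc through it contradicts
  the maximum principle: the weight is concave in \<open>|s|\<close> with a gain of order \<open>|s| powr (3/2)\<close>, which beats
  all errors. A maximum with \<open>s = 0\<close> and \<open>z \<noteq> Q t 0\<close> is impossible because other parameters
  \<open>t\<close> and \<open>s\<close> reach \<open>z\<close> better. So the maximum is attained on \<open>K\<close>, where \<open>u \<le> 0\<close>. It is enough for this
  that the discs are attached to \<open>K\<close> approximately.

  Now let \<open>N\<close> be the supremum of \<open>u\<close> on the large ball. The comparison gives \<open>u \<le> N / 2\<close> on a ball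
  of fixed radius, while \<open>N\<close> exceeds the supremum of \<open>u\<close> on that ball by at most a constant, because \<open>f\<close>
  has degree \<open>d\<close>. So \<open>N\<close> itself is bounded (\<open>disc_system_gradient_bound\<close>).

  The hypothesis on limits of tangent spaces enters through \<open>CR_generic_at_limit\<close>: each point of a
  polyhedral piece is a limit of points near which \<open>K\<close> is flat in the chart (\<open>flat_points_dense\<close>), so
  the image of the direction space of the piece is a limit of tangent spaces at regular points. All
  constants are uniform near each point, and compactness of \<open>K\<close> finishes the proof.
\<close>

section \<open>Polynomials on complex lines and discs\<close>

lemma norm_vector_scalar_mult:
  fixes v :: "complex ^ 'n"
  shows "norm (c *s v) = cmod c * norm v"
proof -
  have "norm (c *s v) = L2_set (\<lambda>i. cmod c * norm (v $ i)) UNIV"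
    by (simp add: norm_vec_def norm_mult)
  also have "\<dots> = cmod c * norm v"
    by (simp add: norm_vec_def L2_set_right_distrib)
  finally show ?thesis .
qed

lemma holomorphic_on_eval_cpoly:
  fixes p :: "'n::finite cpoly"
  assumes "\<And>i. (\<lambda>\<zeta>. h \<zeta> $ i) holomorphic_on S"
  shows "(\<lambda>\<zeta>. eval_cpoly p (h \<zeta>)) holomorphic_on S"
  unfolding eval_cpoly_def by (intro holomorphic_intros assms)

lemma continuous_on_eval_cpoly:
  fixes p :: "'n::finite cpoly"
  shows "continuous_on S (eval_cpoly p)"
  unfolding eval_cpoly_def by (intro continuous_intros)

lemma eval_cpoly_on_line:
  fixes p :: "'n::finite cpoly"
  obtains P :: "complex poly"
  where "degree P \<le> total_degree p" "\<And>\<zeta>. eval_cpoly p (a + \<zeta> *s w) = poly P \<zeta>"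
proof
  define P where "P = (\<Sum>\<alpha>\<in>Poly_Mapping.keys p. smult (Poly_Mapping.lookup p \<alpha>)
      (\<Prod>i\<in>UNIV. [:a $ i, w $ i:] ^ Poly_Mapping.lookup \<alpha> i))"
  show "eval_cpoly p (a + \<zeta> *s w) = poly P \<zeta>" for \<zeta>
    unfolding P_def eval_cpoly_def
    by (simp add: poly_sum poly_prod mult.commute)
  have "degree (smult (Poly_Mapping.lookup p \<alpha>)
      (\<Prod>i\<in>UNIV. [:a $ i, w $ i:] ^ Poly_Mapping.lookup \<alpha> i)) \<le> total_degree p"
    if "\<alpha> \<in> Poly_Mapping.keys p" for \<alpha>
  proof -
    have "degree (\<Prod>i\<in>UNIV. [:a $ i, w $ i:] ^ Poly_Mapping.lookup \<alpha> i)
        \<le> (\<Sum>i\<in>UNIV. degree ([:a $ i, w $ i:] ^ Poly_Mapping.lookup \<alpha> i))"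
      using degree_prod_sum_le[of UNIV "\<lambda>i. [:a $ i, w $ i:] ^ Poly_Mapping.lookup \<alpha> i"]
      by (simp add: o_def)
    also have "\<dots> \<le> (\<Sum>i\<in>UNIV. Poly_Mapping.lookup \<alpha> i)"
    proof (rule sum_mono)
      fix i
      have "degree ([:a $ i, w $ i:] ^ Poly_Mapping.lookup \<alpha> i)
          \<le> degree [:a $ i, w $ i:] * Poly_Mapping.lookup \<alpha> i"
        by (rule degree_power_le)
      also have "\<dots> \<le> 1 * Poly_Mapping.lookup \<alpha> i"
        by (intro mult_right_mono) auto
      finally show "degree ([:a $ i, w $ i:] ^ Poly_Mapping.lookup \<alpha> i) \<le> Poly_Mapping.lookup \<alpha> i"
        by simp
    qed
    also have "\<dots> \<le> total_degree p"
      unfolding total_degree_def using that by (intro Max_ge) auto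
    finally show ?thesis
      using degree_smult_le order_trans by blast
  qed
  then show "degree P \<le> total_degree p"
    unfolding P_def by (intro degree_sum_le) auto
qed

text \<open>Bernstein and Walsh: the reflected polynomial satisfies the same bound on the unit circle,
  hence on the unit disc.\<close>

lemma poly_growth_outside_disc:
  fixes P :: "complex poly"
  assumes bound: "\<And>\<zeta>. cmod \<zeta> = 1 \<Longrightarrow> cmod (poly P \<zeta>) \<le> M" and "cmod \<zeta> \<ge> 1"
  shows "cmod (poly P \<zeta>) \<le> M * cmod \<zeta> ^ degree P"
proof -
  have circle: "cmod (poly (reflect_poly P) w) \<le> M" if "cmod w = 1" for w
  proof -
    have "w \<noteq> 0" using that by auto
    then have "cmod (poly (reflect_poly P) w) = cmod (poly P (inverse w))"
      by (simp add: poly_reflect_poly_nz norm_mult norm_power that)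
    then show ?thesis
      using bound[of "inverse w"] that by (simp add: norm_inverse)
  qed
  have "cmod (poly (reflect_poly P) (inverse \<zeta>)) \<le> M"
  proof (rule maximum_modulus_frontier[where f = "poly (reflect_poly P)" and S = "cball 0 1"])
    show "poly (reflect_poly P) holomorphic_on interior (cball 0 1)"
      by (intro holomorphic_intros)
    show "continuous_on (closure (cball 0 1)) (poly (reflect_poly P))"
      by (intro continuous_intros)
    show "inverse \<zeta> \<in> cball 0 1"
      using assms(2) by (simp add: norm_inverse inverse_le_1_iff)
  qed (auto simp: circle frontier_cball)
  moreover have "\<zeta> \<noteq> 0" using assms(2) by auto
  then have "poly P \<zeta> = poly (reflect_poly P) (inverse \<zeta>) * \<zeta> ^ degree P"
    by (simp add: poly_reflect_poly_nz field_simps)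
  ultimately show ?thesis
    by (simp add: norm_mult norm_power mult_right_mono)
qed

text \<open>This is how the degree enters the argument: it bounds the growth on the complex line through the
  centre and the given point.\<close>

lemma eval_cpoly_growth:
  fixes p :: "'n::finite cpoly"
  assumes "0 < r" "r \<le> R"
    and bound: "\<And>z. z \<in> cball a r \<Longrightarrow> cmod (eval_cpoly p z) \<le> M"
    and z: "z \<in> cball a R"
  shows "cmod (eval_cpoly p z) \<le> M * (R / r) ^ total_degree p"
proof (cases "dist a z \<le> r")
  case True
  then have le: "cmod (eval_cpoly p z) \<le> M" by (simp add: bound)
  then have "0 \<le> M" by (rule order_trans[OF norm_ge_zero])
  then have "M * 1 \<le> M * (R / r) ^ total_degree p"
    using assms(1,2) by (intro mult_left_mono one_le_power) auto
  with le show ?thesis by simp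
next
  case False
  define \<rho> where "\<rho> = dist a z"
  have "\<rho> > r" "\<rho> > 0" using False assms(1) by (auto simp: \<rho>_def)
  define w where "w = complex_of_real (r / \<rho>) *s (z - a)"
  have nw: "norm w = r"
    using \<open>\<rho> > 0\<close> assms(1) unfolding w_def norm_vector_scalar_mult
    by (simp add: \<rho>_def dist_norm norm_minus_commute norm_divide)
  obtain P :: "complex poly" where P: "degree P \<le> total_degree p"
      "\<And>\<zeta>. eval_cpoly p (a + \<zeta> *s w) = poly P \<zeta>"
    using eval_cpoly_on_line[of p a w] by blast
  have circle: "cmod (poly P \<zeta>) \<le> M" if "cmod \<zeta> = 1" for \<zeta>
    using bound[of "a + \<zeta> *s w"] that nw P(2)[of \<zeta>]
    by (simp add: dist_norm norm_vector_scalar_mult)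
  then have "cmod (poly P 1) \<le> M" by simp
  then have "0 \<le> M" by (rule order_trans[OF norm_ge_zero])
  have "z = a + complex_of_real (\<rho> / r) *s w"
    using \<open>\<rho> > 0\<close> assms(1) unfolding w_def by (simp add: vector_smult_assoc flip: of_real_mult of_real_divide)
  then have "cmod (eval_cpoly p z) = cmod (poly P (complex_of_real (\<rho> / r)))"
    using P(2) by metis
  also have "\<dots> \<le> M * cmod (complex_of_real (\<rho> / r)) ^ degree P"
    using \<open>\<rho> > r\<close> assms(1) by (intro poly_growth_outside_disc circle) (auto simp: norm_divide)
  also have "\<dots> = M * (\<rho> / r) ^ degree P"
    using \<open>\<rho> > r\<close> assms(1) by (simp add: norm_divide)
  also have "\<dots> \<le> M * (\<rho> / r) ^ total_degree p"
    using \<open>\<rho> > r\<close> assms(1) \<open>0 \<le> M\<close> P(1) by (intro mult_left_mono power_increasing) auto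
  also have "\<dots> \<le> M * (R / r) ^ total_degree p"
    using z \<open>\<rho> > r\<close> assms(1) \<open>0 \<le> M\<close>
    by (intro mult_left_mono power_mono divide_right_mono) (auto simp: \<rho>_def)
  finally show ?thesis .
qed

lemma dist_self_add: "dist z (z + v) = norm v" for v :: "'a::real_normed_vector"
  by (simp add: dist_norm)

lemma coordinate_line:
  fixes z :: "complex ^ 'n"
  shows "(\<chi> j. if j = i then w else z $ j) = z + (w - z $ i) *s axis i 1"
  by (simp add: vec_eq_iff axis_def)

text \<open>Cauchy's inequality in each variable separately.\<close>

lemma norm_holo_gradient_le:
  fixes p :: "'n::finite cpoly"
  assumes "0 < r" and bound: "\<And>w. w \<in> cball z r \<Longrightarrow> cmod (eval_cpoly p w) \<le> B"
  shows "norm (holo_gradient (eval_cpoly p) z) \<le> real CARD('n) * (B / r)"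
proof -
  have "cmod (holo_gradient (eval_cpoly p) z $ i) \<le> B / r" for i
  proof -
    define g where "g w = eval_cpoly p (\<chi> j. if j = i then w else z $ j)" for w
    have holg: "g holomorphic_on S" for S
      unfolding g_def coordinate_line
      by (rule holomorphic_on_eval_cpoly) (auto intro!: holomorphic_intros)
    have "cmod ((deriv ^^ 1) g (z $ i)) \<le> fact 1 * B / r ^ 1"
    proof (rule Cauchy_inequality[OF holg _ \<open>0 < r\<close>])
      show "continuous_on (cball (z $ i) r) g"
        by (rule holomorphic_on_imp_continuous_on[OF holg])
      fix x assume "cmod (z $ i - x) = r"
      then have "norm ((x - z $ i) *s axis i 1 :: complex ^ 'n) = r"
        unfolding norm_vector_scalar_mult by (simp add: norm_minus_commute)
      then show "cmod (g x) \<le> B"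
        unfolding g_def coordinate_line by (intro bound) (simp only: mem_cball dist_self_add order_refl)
    qed
    then show ?thesis by (simp add: holo_gradient_def g_def[abs_def])
  qed
  then have "(\<Sum>i\<in>UNIV. norm (holo_gradient (eval_cpoly p) z $ i)) \<le> (\<Sum>i\<in>(UNIV::'n set). B / r)"
    by (intro sum_mono)
  moreover have "norm (holo_gradient (eval_cpoly p) z)
      \<le> (\<Sum>i\<in>UNIV. norm (holo_gradient (eval_cpoly p) z $ i))"
    unfolding norm_vec_def by (rule L2_set_le_sum) auto
  ultimately show ?thesis by simp
qed

lemma holo_gradient_degree_0:
  fixes p :: "'n::finite cpoly"
  assumes "total_degree p = 0"
  shows "holo_gradient (eval_cpoly p) z = 0"
proof -
  have "deriv (\<lambda>w. eval_cpoly p (\<chi> j. if j = i then w else z $ j)) (z $ i) = 0" for i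
  proof -
    obtain P :: "complex poly" where P: "degree P \<le> total_degree p"
      "\<And>\<zeta>. eval_cpoly p (z + \<zeta> *s axis i 1) = poly P \<zeta>"
      using eval_cpoly_on_line[of p z "axis i 1"] by blast
    then obtain c where "P = [:c:]" using assms by (auto elim: degree_eq_zeroE)
    then show ?thesis unfolding coordinate_line P(2) by simp
  qed
  then show ?thesis by (simp add: holo_gradient_def vec_eq_iff)
qed

section \<open>A maximum principle along approximate analytic discs\<close>

text \<open>Quantitative convexity of the power \<open>3/2\<close> at \<open>1\<close>. The remainder is quadratic in \<open>Y\<close>, so that on a
  circle about \<open>0\<close> it is a positive constant plus a harmonic quadratic form.\<close>

lemma three_halves_power_lower_bound:
  assumes "\<bar>Y\<bar> \<le> 1/2"
  shows "1 + 3/2 * Y + Y\<^sup>2 / 4 \<le> (1 + Y) * sqrt (1 + Y)"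
proof -
  define r where "r = sqrt (1 + Y)"
  have Y: "Y = r\<^sup>2 - 1" using assms unfolding r_def by simp
  have "0 \<le> r" using assms unfolding r_def by simp
  have "r \<le> 2" unfolding r_def using assms by (intro real_le_lsqrt) auto
  have "r ^ 3 - (1 + 3/2 * Y + Y\<^sup>2 / 4) = (r - 1)\<^sup>2 * (r + 1/2 - (r + 1)\<^sup>2 / 4)"
    unfolding Y by (simp add: field_simps power2_eq_square power3_eq_cube)
  moreover have "r + 1/2 - (r + 1)\<^sup>2 / 4 = (r * (2 - r) + 1) / 4"
    by (simp add: field_simps power2_eq_square)
  moreover have "0 \<le> r * (2 - r)" using \<open>0 \<le> r\<close> \<open>r \<le> 2\<close> by simp
  ultimately have "0 \<le> r ^ 3 - (1 + 3/2 * Y + Y\<^sup>2 / 4)"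
    by (metis add_nonneg_nonneg divide_nonneg_pos mult_nonneg_nonneg zero_le_one zero_le_power2 zero_less_numeral)
  moreover have "r ^ 3 = (1 + Y) * sqrt (1 + Y)"
    unfolding r_def[symmetric] Y using \<open>0 \<le> r\<close> by (simp add: power2_eq_square power3_eq_cube)
  ultimately show ?thesis by simp
qed

text \<open>The exponent is the real part of a polynomial, so the weight is the modulus of a holomorphic
  function.\<close>

lemma maximum_modulus_quadratic_weight:
  fixes F :: "complex \<Rightarrow> complex"
  assumes "F holomorphic_on UNIV"
    and circle: "\<And>\<xi>. cmod \<xi> = 1/2 \<Longrightarrow>
      cmod (F \<xi>) * exp (- l * (ca + cb * Re \<xi> + cc * Im \<xi> + cd * Re (\<xi>\<^sup>2))) \<le> G"
  shows "cmod (F 0) * exp (- l * ca) \<le> G"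
proof -
  define H where "H \<xi> = F \<xi> * exp (- of_real l *
      (of_real ca + of_real cb * \<xi> - \<i> * of_real cc * \<xi> + of_real cd * \<xi>\<^sup>2))" for \<xi>
  have norm_H: "cmod (H \<xi>) = cmod (F \<xi>) * exp (- l * (ca + cb * Re \<xi> + cc * Im \<xi> + cd * Re (\<xi>\<^sup>2)))" for \<xi>
    unfolding H_def norm_mult norm_exp_eq_Re by simp
  have holH: "H holomorphic_on S" for S
    unfolding H_def
    by (intro holomorphic_intros holomorphic_on_subset[OF assms(1)]) auto
  have "cmod (H 0) \<le> G"
  proof (rule maximum_modulus_frontier[where f = H and S = "cball 0 (1/2)" and \<xi> = 0])
    show "continuous_on (closure (cball 0 (1/2))) H"
      by (rule holomorphic_on_imp_continuous_on[OF holH])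
    show "cmod (H z) \<le> G" if "z \<in> frontier (cball 0 (1/2))" for z
      using circle[of z] that unfolding norm_H by (simp add: frontier_cball)
  qed (auto simp: holH)
  then show ?thesis unfolding norm_H by simp
qed

lemma root_1_or_2:
  assumes "k = 1 \<or> k = (2::nat)"
  obtains "k = 1" "root k = (\<lambda>x. x)" | "k = 2" "root k = sqrt"
proof -
  have "root 1 = (\<lambda>x. x)" by (auto simp: fun_eq_iff)
  then show thesis using that assms by (auto simp: sqrt_def)
qed

lemma le_sqrt_self:
  assumes "0 \<le> x" "x \<le> 1" shows "x \<le> sqrt x"
proof (rule real_le_rsqrt)
  show "x\<^sup>2 \<le> x" using mult_left_mono[of x 1 x] assms by (simp add: power2_eq_square)
qed

text \<open>The modulus of continuity \<^term>\<open>root k\<close> is the identity for \<open>k = 1\<close> and the square root for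
  \<open>k = 2\<close>. The facts below are all that the maximum principle uses; the last one says that a cubic
  error is of order \<open>\<epsilon> powr (3/2)\<close> in either case.\<close>

context
  fixes k :: nat assumes k: "k = 1 \<or> k = 2"
begin

lemma root_subadditive:
  assumes "0 \<le> x" "0 \<le> y" shows "root k (x + y) \<le> root k x + root k y"
  using k by (rule root_1_or_2) (use assms in \<open>simp_all add: sqrt_add_le_add_sqrt\<close>)

lemma root_quarter:
  assumes "0 \<le> x" shows "root k (x / 4) \<le> root k x / 2"
  using k by (rule root_1_or_2) (use assms in \<open>simp_all add: real_sqrt_divide\<close>)

lemma root_le_sqrt:
  assumes "0 \<le> x" "x \<le> 1" shows "root k x \<le> sqrt x"
  using k
  by (rule root_1_or_2) (use assms in \<open>simp_all add: le_sqrt_self\<close>)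

lemma root_cube_error:
  assumes "1 \<le> C" "0 \<le> \<epsilon>" "\<epsilon> \<le> 1" shows "root k (C * \<epsilon> ^ 3) \<le> C * (\<epsilon> * sqrt \<epsilon>)"
  using k
proof (rule root_1_or_2)
  assume "root k = (\<lambda>x. x)"
  moreover have "\<epsilon> ^ 3 \<le> \<epsilon> * sqrt \<epsilon>"
  proof -
    have "\<epsilon> * \<epsilon> \<le> sqrt \<epsilon>"
      by (rule real_le_rsqrt) (use assms power_decreasing[of 1 4 \<epsilon>] in \<open>simp add: power_mult_distrib flip: power_add power2_eq_square power_mult\<close>)
    then show ?thesis using assms(2) by (simp add: power3_eq_cube mult_left_mono mult.assoc)
  qed
  ultimately show ?thesis using assms by (simp add: mult_left_mono)
next
  assume "root k = sqrt"
  moreover have "sqrt (C * \<epsilon> ^ 3) = sqrt C * (\<epsilon> * sqrt \<epsilon>)"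
    using assms by (simp add: real_sqrt_mult power3_eq_cube)
  moreover have "sqrt C \<le> C" using assms by (intro real_le_lsqrt) (auto simp: power2_eq_square)
  ultimately show ?thesis using assms by (simp add: mult_right_mono)
qed

end

text \<open>\<open>Q t s\<close> is to be read as \<open>g (t + \<i> s)\<close> for a parametrisation \<open>g\<close> of a part of \<open>K\<close> that takes the value
  \<open>p\<close> at \<open>0\<close>. The fifth condition says that \<open>\<zeta> \<mapsto> g (t + \<zeta> s)\<close> is a quadratic polynomial in \<open>\<zeta>\<close> up to a cubic
  error, near \<open>\<zeta> = \<i>\<close> and exactly at \<open>\<zeta> = \<i>\<close>. The last one says that \<open>g\<close> is quantitatively onto: a
  displacement \<open>e\<close> of the point \<open>Q t 0\<close> of \<open>K\<close> can be produced, up to a quarter of its length, by moving \<open>t\<close>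
  and choosing \<open>s\<close> within \<open>C * root k |e|\<close>.\<close>

definition disc_system ::
  "nat \<Rightarrow> real \<Rightarrow> real \<Rightarrow> (complex ^ 'n) set \<Rightarrow> complex ^ 'n \<Rightarrow>
    ('b::euclidean_space \<Rightarrow> 'b \<Rightarrow> complex ^ 'n) \<Rightarrow> bool" where
  "disc_system k C r K p Q \<longleftrightarrow>
     continuous_on (cball 0 (2 * r) \<times> cball 0 (2 * r)) (\<lambda>x. Q (fst x) (snd x)) \<and>
     Q 0 0 = p \<and>
     (\<forall>t\<in>cball 0 (2 * r). Q t 0 \<in> K) \<and>
     (\<forall>t\<in>cball 0 (2 * r). \<forall>s\<in>cball 0 (2 * r). dist (Q t s) p \<le> C) \<and>
     (\<forall>t\<in>cball 0 r. \<forall>s\<in>cball 0 r. \<exists>A B. norm A \<le> C * norm s \<and> norm B \<le> C * norm s \<and>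
        Q t s = Q t 0 + \<i> *s A + \<i>\<^sup>2 *s B \<and>
        (\<forall>\<zeta>. \<bar>Re \<zeta>\<bar> \<le> 1/2 \<longrightarrow> \<bar>Im \<zeta> - 1\<bar> \<le> 1/2 \<longrightarrow>
           norm (Q t 0 + \<zeta> *s A + \<zeta>\<^sup>2 *s B - Q (t + Re \<zeta> *\<^sub>R s) (Im \<zeta> *\<^sub>R s)) \<le> C * norm s ^ 3)) \<and>
     (\<forall>t\<in>cball 0 r. \<forall>e. norm e \<le> r \<longrightarrow> (\<exists>t' s'. dist t' t \<le> C * root k (norm e) \<and>
        norm s' \<le> C * root k (norm e) \<and> norm (Q t 0 + e - Q t' s') \<le> norm e / 4))"

text \<open>The constant \<open>D\<close> depends on \<open>C\<close> and \<open>r\<close> only and not on the set, the point, the polynomial or \<open>l\<close>. This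
  uniformity, and the linear dependence of the exponent on \<open>l\<close>, are what the self-improvement in
  \<open>disc_system_gradient_bound\<close> relies on.\<close>

lemma disc_system_weight_bound:
  assumes k: "k = 1 \<or> k = 2" and C: "1 \<le> C" and r: "0 < r" "r \<le> 1"
  obtains D where "1 \<le> D"
    "\<And>K p (Q :: 'b::euclidean_space \<Rightarrow> 'b \<Rightarrow> complex ^ 'n) f M l z.
      \<lbrakk>disc_system k C r K p Q; 0 < M; 0 < l; \<And>z. z \<in> K \<Longrightarrow> cmod (eval_cpoly f z) \<le> M;
       \<And>z. z \<in> cball p (6 * C + 4) \<Longrightarrow> cmod (eval_cpoly f z) \<le> M * exp l;
       z \<in> cball p (6 * C + 4)\<rbrakk>
      \<Longrightarrow> cmod (eval_cpoly f z) \<le> M * exp (l * (D * root k (dist z p)))"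
proof -
  \<comment> \<open>The order of choice matters. \<open>\<kappa>\<close> makes the concavity gain \<open>a \<kappa> / 32\<close> twice the errors
    \<open>a + D C = a (1 + 10 C\<^sup>2)\<close>. Then \<open>s0\<close> keeps the concave term above half of its linear part, \<open>e0\<close> keeps
    corrections of the parameters inside their domain, and \<open>a\<close> is so large that the weight exceeds \<open>1\<close>
    as soon as one of \<open>|s|\<close>, \<open>|t|\<close>, \<open>|z - Q t s|\<close> reaches \<open>s0\<close>, \<open>r\<close>, \<open>e0\<close>.\<close>
  define \<kappa> where "\<kappa> = 64 * (1 + 10 * C\<^sup>2)"
  define s0 where "s0 = min r (1 / (8 * \<kappa>\<^sup>2))"
  define e0 where "e0 = min r ((s0 / C)\<^sup>2)"
  define a where "a = max (2 / s0) (max (1 / r\<^sup>2) (1 / root k e0))"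
  define D where "D = 10 * C * a"
  have "0 < \<kappa>" unfolding \<kappa>_def by (simp add: add_pos_nonneg)
  then have s0: "0 < s0" "s0 \<le> r" "s0 \<le> 1 / (8 * \<kappa>\<^sup>2)" using r unfolding s0_def by auto
  have e0: "0 < e0" "e0 \<le> r" "e0 \<le> (s0 / C)\<^sup>2" using r s0 C unfolding e0_def by auto
  have "0 < k" using k by auto
  have root_e0: "0 < root k e0" using e0(1) \<open>0 < k\<close> by simp
  have C_root_e0: "C * root k e0 \<le> s0"
  proof -
    have "root k e0 \<le> sqrt e0" using e0 r by (intro root_le_sqrt[OF k]) auto
    also have "\<dots> \<le> s0 / C" using e0(3) s0 C by (intro real_le_lsqrt) auto
    finally show ?thesis using C by (simp add: field_simps)
  qed
  have "0 < r\<^sup>2" "r\<^sup>2 \<le> 1" using r by (auto simp: power_le_one)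
  have a: "2 / s0 \<le> a" "1 / r\<^sup>2 \<le> a" "1 / root k e0 \<le> a" unfolding a_def by auto
  have a1: "2 \<le> a * s0" using a(1) s0(1) by (simp add: field_simps)
  have a2: "1 \<le> a * r\<^sup>2" using a(2) \<open>0 < r\<^sup>2\<close> by (simp add: field_simps)
  have a3: "1 \<le> a * root k e0" using a(3) root_e0 by (simp add: field_simps)
  have "1 \<le> 1 / r\<^sup>2" using \<open>0 < r\<^sup>2\<close> \<open>r\<^sup>2 \<le> 1\<close> by (simp add: field_simps)
  then have "1 \<le> a" using a(2) by linarith
  have "a \<le> D"
    using mult_mono[of 1 "10 * C" a a] C \<open>1 \<le> a\<close> unfolding D_def by simp
  have half: "\<kappa> * sqrt x \<le> 1/2" if "0 \<le> x" "x \<le> 2 * s0" for x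
  proof -
    have "x \<le> 1 / (4 * \<kappa>\<^sup>2)" using that s0(3) by simp
    also have "\<dots> = (1 / (2 * \<kappa>))\<^sup>2" by (simp add: power2_eq_square)
    finally have "sqrt x \<le> 1 / (2 * \<kappa>)" using \<open>0 < \<kappa>\<close> by (intro real_le_lsqrt) (auto simp: that)
    then show ?thesis using \<open>0 < \<kappa>\<close> by (simp add: field_simps)
  qed
  show thesis
  proof
    show "1 \<le> D" using \<open>1 \<le> a\<close> \<open>a \<le> D\<close> by simp
    fix K p f M l z0 and Q :: "'b \<Rightarrow> 'b \<Rightarrow> complex ^ 'n"
    assume sys: "disc_system k C r K p Q" and "0 < M" "0 < l"
      and fK: "\<And>z. z \<in> K \<Longrightarrow> cmod (eval_cpoly f z) \<le> M"
      and fZ: "\<And>z. z \<in> cball p (6 * C + 4) \<Longrightarrow> cmod (eval_cpoly f z) \<le> M * exp l"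
      and z0: "z0 \<in> cball p (6 * C + 4)"
    have Q_cont: "continuous_on (cball 0 (2 * r) \<times> cball 0 (2 * r)) (\<lambda>x. Q (fst x) (snd x))"
      and Q_0: "Q 0 0 = p"
      and Q_K: "\<And>t. norm t \<le> 2 * r \<Longrightarrow> Q t 0 \<in> K"
      and Q_bdd: "\<And>t s. norm t \<le> 2 * r \<Longrightarrow> norm s \<le> 2 * r \<Longrightarrow> dist (Q t s) p \<le> C"
      and Q_disc: "\<And>t s. norm t \<le> r \<Longrightarrow> norm s \<le> r \<Longrightarrow> \<exists>A B. norm A \<le> C * norm s \<and> norm B \<le> C * norm s \<and>
        Q t s = Q t 0 + \<i> *s A + \<i>\<^sup>2 *s B \<and>
        (\<forall>\<zeta>. \<bar>Re \<zeta>\<bar> \<le> 1/2 \<longrightarrow> \<bar>Im \<zeta> - 1\<bar> \<le> 1/2 \<longrightarrow>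
           norm (Q t 0 + \<zeta> *s A + \<zeta>\<^sup>2 *s B - Q (t + Re \<zeta> *\<^sub>R s) (Im \<zeta> *\<^sub>R s)) \<le> C * norm s ^ 3)"
      and Q_improve: "\<And>t e. norm t \<le> r \<Longrightarrow> norm e \<le> r \<Longrightarrow> \<exists>t' s'. dist t' t \<le> C * root k (norm e) \<and>
        norm s' \<le> C * root k (norm e) \<and> norm (Q t 0 + e - Q t' s') \<le> norm e / 4"
      using sys unfolding disc_system_def by auto
    define Br where "Br z t s = a * (norm s - \<kappa> * (norm s * sqrt (norm s))) + a * (norm t)\<^sup>2
        + D * root k (norm (z - Q t s))" for z t s
    define G where "G z t s = cmod (eval_cpoly f z) * exp (- l * Br z t s)" for z t s
    \<comment> \<open>The radius \<open>6 * C + 4\<close> leaves room for the discs used in the third case below.\<close>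
    define X where "X = cball p (6 * C + 4) \<times> cball (0::'b) (2 * r) \<times> cball (0::'b) (2 * s0)"
    have "compact X" unfolding X_def by (intro compact_Times compact_cball)
    moreover have "X \<noteq> {}" using C r s0 unfolding X_def by auto
    moreover have "continuous_on X (\<lambda>x. G (fst x) (fst (snd x)) (snd (snd x)))"
    proof -
      have "continuous_on X (\<lambda>x. (fst (snd x), snd (snd x)))" by (intro continuous_intros)
      moreover have "(\<lambda>x. (fst (snd x), snd (snd x))) ` X \<subseteq> cball 0 (2 * r) \<times> cball 0 (2 * r)"
        using s0 unfolding X_def by auto
      ultimately have "continuous_on X (\<lambda>x. Q (fst (snd x)) (snd (snd x)))"
        using continuous_on_compose2[OF Q_cont] by fastforce
      then show ?thesis
        unfolding G_def Br_def
        by (intro continuous_intros continuous_on_compose2[OF continuous_on_eval_cpoly[of UNIV]]) auto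
    qed
    ultimately obtain x where "x \<in> X" and
      "\<forall>y\<in>X. G (fst y) (fst (snd y)) (snd (snd y)) \<le> G (fst x) (fst (snd x)) (snd (snd x))"
      using continuous_attains_sup[of X] by blast
    then obtain z t s where X0: "(z, t, s) \<in> X"
      and max: "\<And>z' t' s'. (z', t', s') \<in> X \<Longrightarrow> G z' t' s' \<le> G z t s"
      by (metis fst_conv snd_conv prod.collapse)
    have z: "dist p z \<le> 6 * C + 4" and t: "norm t \<le> 2 * r" and s: "norm s \<le> 2 * s0"
      using X0 unfolding X_def by auto
    have "G z t s \<le> M"
    proof (rule ccontr)
      assume "\<not> G z t s \<le> M"
      then have big: "M < G z t s" by simp
      have fz_pos: "0 < cmod (eval_cpoly f z)"
        using big \<open>0 < M\<close> unfolding G_def by (auto simp: zero_less_mult_iff)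
      \<comment> \<open>A maximum above \<open>M\<close> is interior in \<open>t\<close>, \<open>s\<close> and the displacement \<open>e\<close>, since the weight is below
        \<open>1\<close> there.\<close>
      define e where "e = z - Q t s"
      have "G z t s \<le> M * exp l * exp (- l * Br z t s)"
        unfolding G_def using fZ[of z] z by (intro mult_right_mono) auto
      also have "\<dots> = M * exp (l * (1 - Br z t s))"
        by (simp add: algebra_simps flip: exp_add)
      finally have "M * 1 < M * exp (l * (1 - Br z t s))" using big by simp
      then have "0 < l * (1 - Br z t s)" using \<open>0 < M\<close> by simp
      then have Br1: "Br z t s < 1" using \<open>0 < l\<close> by (simp add: zero_less_mult_iff)
      have psi: "a * norm s / 2 \<le> a * (norm s - \<kappa> * (norm s * sqrt (norm s)))"
      proof -
        have "norm s * (\<kappa> * sqrt (norm s)) \<le> norm s * (1/2)"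
          using half[OF _ s] by (intro mult_left_mono) auto
        then have "norm s / 2 \<le> norm s - \<kappa> * (norm s * sqrt (norm s))" by (simp add: mult_ac)
        then show ?thesis using \<open>1 \<le> a\<close> mult_left_mono[of "norm s / 2"] by fastforce
      qed
      have nonneg: "0 \<le> a * norm s / 2" "0 \<le> a * (norm t)\<^sup>2" "0 \<le> D * root k (norm e)"
        using \<open>1 \<le> a\<close> \<open>a \<le> D\<close> \<open>0 < k\<close> by auto
      have Br_ge: "a * norm s / 2 + a * (norm t)\<^sup>2 + D * root k (norm e) \<le> Br z t s"
        using psi unfolding Br_def e_def by simp
      have s1: "norm s < s0"
      proof -
        have "a * norm s < a * s0" using Br1 Br_ge nonneg a1 by linarith
        then show ?thesis using \<open>1 \<le> a\<close> by simp
      qed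
      have t1: "norm t < r"
      proof -
        have "a * (norm t)\<^sup>2 < a * r\<^sup>2" using Br1 Br_ge nonneg a2 by linarith
        then have "(norm t)\<^sup>2 < r\<^sup>2" using \<open>1 \<le> a\<close> by simp
        then show ?thesis by (rule power2_less_imp_less) (use r in simp)
      qed
      have e1: "norm e < e0"
      proof (rule ccontr)
        assume "\<not> norm e < e0"
        then have "root k e0 \<le> root k (norm e)" using \<open>0 < k\<close> by simp
        then have "a * root k e0 \<le> D * root k (norm e)"
          using \<open>1 \<le> a\<close> \<open>a \<le> D\<close> root_e0 by (intro mult_mono) auto
        then show False using Br1 Br_ge nonneg a3 by linarith
      qed
      have root_e: "C * root k (norm e) \<le> s0"
      proof -
        have "root k (norm e) \<le> root k e0" using e1 \<open>0 < k\<close> by simp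
        then have "C * root k (norm e) \<le> C * root k e0" using C by (intro mult_left_mono) auto
        then show ?thesis using C_root_e0 by linarith
      qed
      have larger: False if "(z, t', s') \<in> X" "Br z t' s' < Br z t s" for t' s'
      proof -
        have "G z t s < G z t' s'"
          unfolding G_def using that(2) fz_pos \<open>0 < l\<close> by simp
        then show False using max[OF that(1)] by simp
      qed
      consider "s = 0" "e = 0" | "s = 0" "e \<noteq> 0" | "s \<noteq> 0" by blast
      then show False
      proof cases
        case 1
        then have "z \<in> K" using Q_K[OF t] unfolding e_def by simp
        have "0 \<le> Br z t s" using Br_ge nonneg by linarith
        then have "exp (- l * Br z t s) \<le> 1" using \<open>0 < l\<close> by simp
        then have "G z t s \<le> M * 1"
          unfolding G_def using fK[OF \<open>z \<in> K\<close>] \<open>0 < M\<close> by (intro mult_mono) auto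
        then show False using big by simp
      next
        case 2
        \<comment> \<open>Replacing \<open>(t, 0)\<close> by the improved parameters halves the last term of the weight, a gain of
          \<open>5 * a * w\<close>; the other two terms grow by at most \<open>4 * a * w\<close>.\<close>
        define w where "w = C * root k (norm e)"
        have "0 < w" using 2 C \<open>0 < k\<close> unfolding w_def by simp
        have "w \<le> s0" using root_e unfolding w_def .
        obtain t' s' where t': "dist t' t \<le> w" and s': "norm s' \<le> w"
          and e': "norm (Q t 0 + e - Q t' s') \<le> norm e / 4"
          using Q_improve[of t e] t1 e1 e0 unfolding w_def by fastforce
        have nt': "norm t' \<le> norm t + w" using t' norm_triangle_sub[of t' t] by (simp add: dist_norm)
        have "z - Q t' s' = Q t 0 + e - Q t' s'" using 2 by (simp add: e_def)
        then have "root k (norm (z - Q t' s')) \<le> root k (norm e / 4)"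
          using e' \<open>0 < k\<close> by simp
        also have "\<dots> \<le> root k (norm e) / 2" by (rule root_quarter[OF k]) simp
        finally have "D * root k (norm (z - Q t' s')) \<le> D * (root k (norm e) / 2)"
          using \<open>1 \<le> a\<close> \<open>a \<le> D\<close> by (intro mult_left_mono) auto
        then have b1: "D * root k (norm (z - Q t' s')) \<le> D * root k (norm e) - 5 * a * w"
          unfolding w_def D_def by (simp add: algebra_simps)
        have b2: "a * (norm s' - \<kappa> * (norm s' * sqrt (norm s'))) \<le> a * w"
        proof -
          have "norm s' - \<kappa> * (norm s' * sqrt (norm s')) \<le> norm s'" using \<open>0 < \<kappa>\<close> by simp
          then show ?thesis using s' \<open>1 \<le> a\<close> by (intro mult_left_mono) auto
        qed
        have "(norm t')\<^sup>2 \<le> (norm t + w)\<^sup>2" using nt' by (intro power_mono) auto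
        also have "\<dots> = (norm t)\<^sup>2 + (2 * norm t + w) * w" by (simp add: power2_eq_square algebra_simps)
        also have "\<dots> \<le> (norm t)\<^sup>2 + 3 * w"
          using t1 r \<open>w \<le> s0\<close> s0 \<open>0 < w\<close> by (intro add_left_mono mult_right_mono) auto
        finally have "a * (norm t')\<^sup>2 \<le> a * ((norm t)\<^sup>2 + 3 * w)"
          using \<open>1 \<le> a\<close> by (intro mult_left_mono) auto
        then have b3: "a * (norm t')\<^sup>2 \<le> a * (norm t)\<^sup>2 + 3 * a * w" by (simp add: algebra_simps)
        have "Br z t s = a * (norm t)\<^sup>2 + D * root k (norm e)"
          unfolding Br_def e_def using 2 by simp
        moreover have "0 < a * w" using \<open>1 \<le> a\<close> \<open>0 < w\<close> by simp
        ultimately have "Br z t' s' < Br z t s"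
          using b1 b2 b3 unfolding Br_def by linarith
        moreover have "(z, t', s') \<in> X"
          using z nt' s' t1 \<open>w \<le> s0\<close> s0 \<open>0 < w\<close> unfolding X_def by simp
        ultimately show False using larger by blast
      next
        case 3
        define \<epsilon> where "\<epsilon> = norm s"
        have \<epsilon>: "0 < \<epsilon>" "\<epsilon> < s0" "\<epsilon> \<le> 1" using 3 s1 s0 r unfolding \<epsilon>_def by auto
        define \<eta> where "\<eta> = \<epsilon> * sqrt \<epsilon>"
        have "0 < \<eta>" using \<epsilon> unfolding \<eta>_def by simp
        obtain A B where AB: "norm A \<le> C * \<epsilon>" "norm B \<le> C * \<epsilon>"
          and Qts: "Q t s = Q t 0 + \<i> *s A + \<i>\<^sup>2 *s B"
          and disc: "\<And>\<zeta>. \<bar>Re \<zeta>\<bar> \<le> 1/2 \<Longrightarrow> \<bar>Im \<zeta> - 1\<bar> \<le> 1/2 \<Longrightarrow>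
            norm (Q t 0 + \<zeta> *s A + \<zeta>\<^sup>2 *s B - Q (t + Re \<zeta> *\<^sub>R s) (Im \<zeta> *\<^sub>R s)) \<le> C * \<epsilon> ^ 3"
          using Q_disc[of t s] t1 s1 s0 unfolding \<epsilon>_def by fastforce
        define h where "h \<zeta> = Q t 0 + \<zeta> *s A + \<zeta>\<^sup>2 *s B + e" for \<zeta>
        have h_i: "h \<i> = z" unfolding h_def e_def Qts by simp
        \<comment> \<open>On the circle of radius \<open>1/2\<close> about \<open>\<i>\<close> the weight is at most the harmonic polynomial with these
          coefficients; its value \<open>c0\<close> at the centre is less than the weight at the maximum. The
          fraction \<open>1/32 = 1/4 * 1/8\<close> is the mean of \<open>y\<^sup>2 / 4\<close> over the circle.\<close>
        define c0 where "c0 = a * (\<epsilon> - \<kappa> * \<eta> * (1 + 1/32)) + a * (norm t)\<^sup>2 + a * \<eta>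
          + D * (root k (norm e) + C * \<eta>)"
        define c1 where "c1 = 2 * a * (t \<bullet> s)"
        define c2 where "c2 = a * (\<epsilon> - 3/2 * \<kappa> * \<eta>)"
        define c3 where "c3 = a * \<kappa> * \<eta> / 8"
        have "cmod (eval_cpoly f (h (\<i> + 0))) * exp (- l * c0) \<le> G z t s"
        proof (rule maximum_modulus_quadratic_weight[where F = "\<lambda>\<xi>. eval_cpoly f (h (\<i> + \<xi>))"
              and ca = c0 and cb = c1 and cc = c2 and cd = c3])
          show "(\<lambda>\<xi>. eval_cpoly f (h (\<i> + \<xi>))) holomorphic_on UNIV"
            unfolding h_def by (rule holomorphic_on_eval_cpoly) (auto intro!: holomorphic_intros)
          fix \<xi> :: complex assume \<xi>: "cmod \<xi> = 1/2"
          define x y where "x = Re \<xi>" and "y = Im \<xi>"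
          have xy: "\<bar>x\<bar> \<le> 1/2" "\<bar>y\<bar> \<le> 1/2"
            using \<xi> abs_Re_le_cmod[of \<xi>] abs_Im_le_cmod[of \<xi>] unfolding x_def y_def by auto
          have "(cmod \<xi>)\<^sup>2 = x\<^sup>2 + y\<^sup>2" unfolding x_def y_def by (rule cmod_power2)
          then have x2y2: "x\<^sup>2 + y\<^sup>2 = 1/4" using \<xi> by (simp add: power2_eq_square)
          have Re2: "Re (\<xi>\<^sup>2) = x\<^sup>2 - y\<^sup>2" unfolding x_def y_def by (simp add: power2_eq_square)
          have y2: "y\<^sup>2 = 1/8 - Re (\<xi>\<^sup>2) / 2" using x2y2 unfolding Re2 by (simp add: field_simps)
          define z' t' s' where "z' = h (\<i> + \<xi>)" and "t' = t + x *\<^sub>R s" and "s' = (1 + y) *\<^sub>R s"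
          have ns': "norm s' = (1 + y) * \<epsilon>" unfolding s'_def \<epsilon>_def using xy by simp
          have psi': "a * (norm s' - \<kappa> * (norm s' * sqrt (norm s')))
            \<le> a * (\<epsilon> - \<kappa> * \<eta> * (1 + 1/32)) + c2 * y + c3 * Re (\<xi>\<^sup>2)"
          proof -
            have "norm s' * sqrt (norm s') = \<eta> * ((1 + y) * sqrt (1 + y))"
              unfolding ns' \<eta>_def by (simp add: real_sqrt_mult)
            moreover have "\<eta> * (1 + 3/2 * y + y\<^sup>2 / 4) \<le> \<eta> * ((1 + y) * sqrt (1 + y))"
              using three_halves_power_lower_bound[OF xy(2)] \<open>0 < \<eta>\<close> by (intro mult_left_mono) auto
            ultimately have "\<kappa> * (\<eta> * (1 + 3/2 * y + y\<^sup>2 / 4)) \<le> \<kappa> * (norm s' * sqrt (norm s'))"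
              using \<open>0 < \<kappa>\<close> by (intro mult_left_mono) auto
            then have "a * (norm s' - \<kappa> * (norm s' * sqrt (norm s')))
              \<le> a * ((1 + y) * \<epsilon> - \<kappa> * (\<eta> * (1 + 3/2 * y + y\<^sup>2 / 4)))"
              using \<open>1 \<le> a\<close> ns' by (intro mult_left_mono) auto
            also have "\<dots> = a * (\<epsilon> - \<kappa> * \<eta> * (1 + 1/32)) + c2 * y + c3 * Re (\<xi>\<^sup>2)"
              unfolding y2 c2_def c3_def by (simp add: field_simps)
            finally show ?thesis .
          qed
          have t2: "a * (norm t')\<^sup>2 \<le> a * (norm t)\<^sup>2 + c1 * x + a * \<eta>"
          proof -
            have "x\<^sup>2 * \<epsilon>\<^sup>2 \<le> 1 * \<eta>"
            proof (intro mult_mono)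
              show "x\<^sup>2 \<le> 1" using x2y2 zero_le_power2[of y] by linarith
              show "\<epsilon>\<^sup>2 \<le> \<eta>" unfolding \<eta>_def power2_eq_square
                using \<epsilon> by (intro mult_left_mono le_sqrt_self) auto
            qed auto
            moreover have "(norm t')\<^sup>2 = (norm t)\<^sup>2 + 2 * (t \<bullet> s) * x + x\<^sup>2 * \<epsilon>\<^sup>2"
              unfolding t'_def \<epsilon>_def power2_norm_eq_inner
              by (simp add: inner_add_left inner_add_right inner_commute power2_eq_square algebra_simps)
            ultimately have "a * (norm t')\<^sup>2 \<le> a * ((norm t)\<^sup>2 + 2 * (t \<bullet> s) * x + \<eta>)"
              using \<open>1 \<le> a\<close> by (intro mult_left_mono) auto
            then show ?thesis unfolding c1_def by (simp add: algebra_simps)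
          qed
          have z3: "D * root k (norm (z' - Q t' s')) \<le> D * (root k (norm e) + C * \<eta>)"
          proof -
            have cancel: "v + e - w - e = v - w" for v w by simp
            have "norm (z' - Q t' s' - e) \<le> C * \<epsilon> ^ 3"
              unfolding z'_def h_def t'_def s'_def cancel
              using disc[of "\<i> + \<xi>"] xy unfolding x_def y_def by simp
            then have "norm (z' - Q t' s') \<le> norm e + C * \<epsilon> ^ 3"
              using norm_triangle_sub[of "z' - Q t' s'" e] by linarith
            then have "root k (norm (z' - Q t' s')) \<le> root k (norm e + C * \<epsilon> ^ 3)"
              using \<open>0 < k\<close> by simp
            also have "\<dots> \<le> root k (norm e) + root k (C * \<epsilon> ^ 3)"
              using C \<epsilon> by (intro root_subadditive[OF k]) auto
            also have "\<dots> \<le> root k (norm e) + C * \<eta>"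
              unfolding \<eta>_def using root_cube_error[OF k C] \<epsilon> by simp
            finally show ?thesis using \<open>1 \<le> a\<close> \<open>a \<le> D\<close> by (intro mult_left_mono) auto
          qed
          have Br': "Br z' t' s' \<le> c0 + c1 * Re \<xi> + c2 * Im \<xi> + c3 * Re (\<xi>\<^sup>2)"
            using psi' t2 z3 unfolding Br_def c0_def x_def y_def by linarith
          have "(z', t', s') \<in> X"
          proof -
            have n\<zeta>: "cmod (\<i> + \<xi>) \<le> 3/2" using norm_triangle_ineq[of \<i> \<xi>] \<xi> by simp
            have "cmod ((\<i> + \<xi>)\<^sup>2) \<le> (3/2)\<^sup>2"
              unfolding norm_power using n\<zeta> by (intro power_mono) auto
            then have n\<zeta>2: "cmod ((\<i> + \<xi>)\<^sup>2) \<le> 9/4" by (simp add: power2_eq_square)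
            have "C * \<epsilon> \<le> C" using C \<epsilon> by simp
            have "norm ((\<i> + \<xi>) *s A) \<le> 3/2 * C"
              unfolding norm_vector_scalar_mult using n\<zeta> AB \<open>C * \<epsilon> \<le> C\<close> by (intro mult_mono) auto
            moreover have "norm ((\<i> + \<xi>)\<^sup>2 *s B) \<le> 9/4 * C"
              unfolding norm_vector_scalar_mult using n\<zeta>2 AB \<open>C * \<epsilon> \<le> C\<close> by (intro mult_mono) auto
            moreover have "norm (Q t 0 - p) \<le> C"
              using Q_bdd[OF t, of 0] r by (simp add: dist_norm)
            moreover have "norm e \<le> 1" using e1 e0 r by simp
            moreover have "norm (z' - p) \<le> norm (Q t 0 - p) + norm ((\<i> + \<xi>) *s A)
              + norm ((\<i> + \<xi>)\<^sup>2 *s B) + norm e"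
            proof -
              have regroup: "u + v + w + e - p = (u - p) + v + w + e" for u v w by simp
              have triangle: "norm (u + v + w + e) \<le> norm u + norm v + norm w + norm e" for u v w
                by (intro norm_triangle_le add_right_mono) simp_all
              show ?thesis unfolding z'_def h_def regroup by (rule triangle)
            qed
            ultimately have "norm (z' - p) \<le> 6 * C + 4" using C by linarith
            moreover have "norm t' \<le> 2 * r"
            proof -
              have "norm (x *\<^sub>R s) \<le> 1/2 * \<epsilon>"
                unfolding \<epsilon>_def norm_scaleR using xy by (intro mult_right_mono) auto
              then show ?thesis using norm_triangle_ineq[of t "x *\<^sub>R s"] t1 \<epsilon> s0 unfolding t'_def by linarith
            qed
            moreover have "norm s' \<le> 2 * s0"
              unfolding ns' using mult_mono[of "1 + y" 2 \<epsilon> s0] xy \<epsilon> by simp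
            ultimately show ?thesis unfolding X_def by (simp add: dist_norm norm_minus_commute)
          qed
          then have "G z' t' s' \<le> G z t s" by (rule max)
          moreover have "- l * (c0 + c1 * Re \<xi> + c2 * Im \<xi> + c3 * Re (\<xi>\<^sup>2)) \<le> - l * Br z' t' s'"
            using mult_left_mono[OF Br', of l] \<open>0 < l\<close> by simp
          then have "cmod (eval_cpoly f z') * exp (- l * (c0 + c1 * Re \<xi> + c2 * Im \<xi> + c3 * Re (\<xi>\<^sup>2)))
            \<le> G z' t' s'"
            unfolding G_def by (intro mult_left_mono) auto
          ultimately show "cmod (eval_cpoly f (h (\<i> + \<xi>)))
            * exp (- l * (c0 + c1 * Re \<xi> + c2 * Im \<xi> + c3 * Re (\<xi>\<^sup>2))) \<le> G z t s"
            unfolding z'_def by simp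
        qed
        then have "exp (- l * c0) \<le> exp (- l * Br z t s)"
          using fz_pos h_i unfolding G_def by simp
        then have "Br z t s \<le> c0" using \<open>0 < l\<close> by simp
        moreover have "c0 = Br z t s - a * \<eta> * (1 + 10 * C\<^sup>2)"
          unfolding c0_def Br_def \<kappa>_def D_def e_def[symmetric] \<epsilon>_def[symmetric] \<eta>_def[symmetric]
          by (simp add: algebra_simps power2_eq_square)
        moreover have "0 < a * \<eta> * (1 + 10 * C\<^sup>2)"
          using \<open>1 \<le> a\<close> \<open>0 < \<eta>\<close> by (intro mult_pos_pos add_pos_nonneg) auto
        ultimately show False by linarith
      qed
    qed
    moreover have "(z0, 0, 0) \<in> X" using z0 r s0 unfolding X_def by auto
    ultimately have "G z0 0 0 \<le> M" using max by fastforce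
    then have "cmod (eval_cpoly f z0) \<le> M * exp (l * Br z0 0 0)"
      unfolding G_def by (simp add: exp_minus field_simps)
    then show "cmod (eval_cpoly f z0) \<le> M * exp (l * (D * root k (dist z0 p)))"
      unfolding Br_def Q_0 by (simp add: dist_norm)
  qed
qed

text \<open>Let \<open>l\<close> be the logarithm of the maximum of \<open>|f| / M\<close> on the large ball. The weight bound gives \<open>l / 2\<close> on
  a small ball of fixed radius, and the growth of a polynomial of degree \<open>d\<close> returns to the large ball
  at the cost of \<open>d * L\<close>. Hence \<open>l \<le> l / 2 + d * L\<close>, and with \<open>l = 2 * d * L\<close> the exponent in the weight bound is of order \<open>1\<close>
  at distance \<open>1 / d ^ k\<close> from \<open>p\<close>.\<close>

lemma disc_system_gradient_bound:
  assumes k: "k = 1 \<or> k = 2" and C: "1 \<le> C" and r: "0 < r" "r \<le> 1"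
  obtains B where "0 < B"
    "\<And>K p (Q :: 'b::euclidean_space \<Rightarrow> 'b \<Rightarrow> complex ^ 'n) f M.
      \<lbrakk>disc_system k C r K p Q; 0 < M; \<And>z. z \<in> K \<Longrightarrow> cmod (eval_cpoly f z) \<le> M\<rbrakk>
      \<Longrightarrow> norm (holo_gradient (eval_cpoly f) p) \<le> B * real (total_degree f) ^ k * M"
proof -
  obtain D where D: "1 \<le> D" and weight:
    "\<And>K p (Q :: 'b::euclidean_space \<Rightarrow> 'b \<Rightarrow> complex ^ 'n) f M l z.
      \<lbrakk>disc_system k C r K p Q; 0 < M; 0 < l; \<And>z. z \<in> K \<Longrightarrow> cmod (eval_cpoly f z) \<le> M;
       \<And>z. z \<in> cball p (6 * C + 4) \<Longrightarrow> cmod (eval_cpoly f z) \<le> M * exp l;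
       z \<in> cball p (6 * C + 4)\<rbrakk>
      \<Longrightarrow> cmod (eval_cpoly f z) \<le> M * exp (l * (D * root k (dist z p)))"
    by (rule disc_system_weight_bound[OF assms, where 'b = 'b and 'n = 'n]) blast
  have "0 < k" using k by auto
  define R where "R = 6 * C + 4"
  \<comment> \<open>On the ball of radius \<open>r1\<close> the factor \<open>D * root k (dist z p)\<close> is at most \<open>1/2\<close>.\<close>
  define r1 where "r1 = 1 / (2 * D)\<^sup>2"
  have "1 \<le> (2 * D)\<^sup>2" using D by (intro one_le_power) auto
  then have r1: "0 < r1" "r1 \<le> 1" unfolding r1_def using D by (auto simp: field_simps)
  have R: "10 \<le> R" using C unfolding R_def by simp
  define L where "L = ln (R / r1)"
  have "1 < R / r1" using r1 R by (simp add: field_simps)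
  then have L: "0 < L" "exp L = R / r1" unfolding L_def by (auto simp: ln_gt_zero)
  show thesis
  proof
    show "0 < real CARD('n) * exp (2 * L * D)" by simp
    fix K p f M and Q :: "'b \<Rightarrow> 'b \<Rightarrow> complex ^ 'n"
    assume sys: "disc_system k C r K p Q" and M: "0 < M"
      and fK: "\<And>z. z \<in> K \<Longrightarrow> cmod (eval_cpoly f z) \<le> M"
    show "norm (holo_gradient (eval_cpoly f) p)
      \<le> real CARD('n) * exp (2 * L * D) * real (total_degree f) ^ k * M"
    proof (cases "total_degree f = 0")
      case True
      then show ?thesis using \<open>0 < k\<close> M by (simp add: holo_gradient_degree_0)
    next
      case False
      define d where "d = total_degree f"
      have d: "1 \<le> real d" using False unfolding d_def by simp
      have crude: "cmod (eval_cpoly f z) \<le> M * exp (2 * d * L)" if "z \<in> cball p R" for z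
      proof -
        have "cball p R \<noteq> {}" using R by auto
        moreover have "continuous_on (cball p R) (\<lambda>z. cmod (eval_cpoly f z))"
          by (intro continuous_intros continuous_on_eval_cpoly)
        ultimately obtain z1 where z1: "z1 \<in> cball p R"
          and max: "\<And>z. z \<in> cball p R \<Longrightarrow> cmod (eval_cpoly f z) \<le> cmod (eval_cpoly f z1)"
          using continuous_attains_sup[OF compact_cball, of p R] by blast
        have "cmod (eval_cpoly f z1) \<le> M * exp (2 * d * L)"
        proof (rule ccontr)
          assume "\<not> ?thesis"
          then have gt: "M * exp (2 * d * L) < cmod (eval_cpoly f z1)" by simp
          define l where "l = ln (cmod (eval_cpoly f z1) / M)"
          have "exp (2 * d * L) < cmod (eval_cpoly f z1) / M" using gt M by (simp add: field_simps)
          moreover from this have "0 < cmod (eval_cpoly f z1) / M"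
            using exp_gt_zero order_less_trans by blast
          ultimately have exp_l: "exp l = cmod (eval_cpoly f z1) / M" and l: "2 * d * L < l"
            unfolding l_def by (simp, metis exp_less_cancel_iff exp_ln)
          have "0 < 2 * d * L" using d L by simp
          then have "0 < l" using l by linarith
          have small: "cmod (eval_cpoly f z) \<le> M * exp (l / 2)" if z: "z \<in> cball p r1" for z
          proof -
            have "cmod (eval_cpoly f z) \<le> M * exp (l * (D * root k (dist z p)))"
            proof (rule weight[OF sys M \<open>0 < l\<close> fK])
              show "cmod (eval_cpoly f z) \<le> M * exp l" if "z \<in> cball p (6 * C + 4)" for z
                using max[of z] that M unfolding exp_l R_def by simp
              show "z \<in> cball p (6 * C + 4)" using z r1 R unfolding R_def by auto
            qed
            also have "\<dots> \<le> M * exp (l * (1/2))"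
            proof -
              have "root k (dist z p) \<le> sqrt (dist z p)"
                using z r1 by (intro root_le_sqrt[OF k]) (auto simp: dist_commute)
              also have "\<dots> \<le> 1 / (2 * D)"
                using z D unfolding r1_def
                by (intro real_le_lsqrt) (auto simp: dist_commute power_divide)
              finally have "D * root k (dist z p) \<le> 1/2" using D by (simp add: field_simps)
              then show ?thesis using M \<open>0 < l\<close> by simp
            qed
            finally show ?thesis by simp
          qed
          have "cmod (eval_cpoly f z1) \<le> M * exp (l / 2) * (R / r1) ^ d"
            unfolding d_def by (rule eval_cpoly_growth[OF r1(1) _ small z1]) (use r1 R in auto)
          also have "\<dots> = M * exp (l / 2 + d * L)"
            unfolding L(2)[symmetric] by (simp add: exp_add mult_ac flip: exp_of_nat_mult)
          finally have "exp l \<le> exp (l / 2 + d * L)"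
            unfolding exp_l using M by (simp add: field_simps)
          then show False using l by simp
        qed
        then show ?thesis using max[OF that] by linarith
      qed
      have near: "cmod (eval_cpoly f z) \<le> M * exp (2 * L * D)" if z: "z \<in> cball p (1 / d ^ k)" for z
      proof -
        have "1 / real d ^ k \<le> 1" using d by (simp add: divide_le_eq_1 one_le_power)
        then have z': "z \<in> cball p R" using z R by auto
        have "cmod (eval_cpoly f z) \<le> M * exp (2 * d * L * (D * root k (dist z p)))"
          by (rule weight[OF sys M _ fK]) (use crude z' d L in \<open>auto simp: R_def\<close>)
        also have "\<dots> \<le> M * exp (2 * L * D)"
        proof -
          have "root k (dist z p) \<le> root k ((1 / d) ^ k)"
            using z \<open>0 < k\<close> by (simp add: dist_commute power_divide)
          also have "\<dots> = 1 / d" using \<open>0 < k\<close> by (simp add: real_root_power_cancel)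
          finally have "(2 * d * L * D) * root k (dist z p) \<le> (2 * d * L * D) * (1 / d)"
            using L D by (intro mult_left_mono) auto
          then show ?thesis using M d by (simp add: mult_ac)
        qed
        finally show ?thesis .
      qed
      have "norm (holo_gradient (eval_cpoly f) p)
        \<le> real CARD('n) * (M * exp (2 * L * D) / (1 / real d ^ k))"
        by (rule norm_holo_gradient_le[OF _ near]) (use d in auto)
      then show ?thesis unfolding d_def by (simp add: mult_ac)
    qed
  qed
qed

section \<open>Directional derivatives along quadratic curves\<close>

definition dderiv :: "('a::real_normed_vector \<Rightarrow> 'b::real_normed_vector) \<Rightarrow> 'a \<Rightarrow> 'a \<Rightarrow> 'b" where
  "dderiv f v = (\<lambda>x. frechet_derivative f (at x) v)"

lemma Ck_on_Suc_iff:
  "Ck_on (Suc k) f S \<longleftrightarrow> (\<forall>x\<in>S. f differentiable (at x)) \<and> (\<forall>v. Ck_on k (dderiv f v) S)"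
  by (simp add: dderiv_def)

lemma Ck_on_imp_continuous_on:
  assumes "Ck_on k f S" shows "continuous_on S f"
proof (cases k)
  case 0
  then show ?thesis using assms by simp
next
  case (Suc j)
  then show ?thesis
    using assms by (auto intro!: continuous_at_imp_continuous_on differentiable_imp_continuous_within)
qed

lemma Ck_on_Suc_imp: "Ck_on (Suc k) f S \<Longrightarrow> Ck_on k f S"
proof (induction k arbitrary: f)
  case 0
  then show ?case using Ck_on_imp_continuous_on[of 1 f S] by simp
next
  case (Suc k)
  then show ?case by (subst Ck_on_Suc_iff) (auto simp: Ck_on_Suc_iff simp del: Ck_on.simps)
qed

lemma Ck_on_le:
  assumes "Ck_on k f S" "j \<le> k" shows "Ck_on j f S"
  using assms(2,1) by (induction rule: dec_induct) (auto dest: Ck_on_Suc_imp simp del: Ck_on.simps)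

lemma has_derivative_dderiv:
  assumes "f differentiable (at x)"
  shows "(f has_derivative (\<lambda>v. dderiv f v x)) (at x)"
  using assms unfolding dderiv_def by (simp add: frechet_derivative_works)

lemma dderiv_basis:
  fixes f :: "'a::euclidean_space \<Rightarrow> 'b::real_normed_vector"
  assumes "f differentiable (at x)"
  shows "dderiv f v x = (\<Sum>i\<in>Basis. (v \<bullet> i) *\<^sub>R dderiv f i x)"
proof -
  interpret linear "\<lambda>v. dderiv f v x"
    using has_derivative_dderiv[OF assms] by (rule has_derivative_linear)
  have "dderiv f (\<Sum>i\<in>Basis. (v \<bullet> i) *\<^sub>R i) x = (\<Sum>i\<in>Basis. (v \<bullet> i) *\<^sub>R dderiv f i x)"
    by (simp only: sum scale)
  then show ?thesis by (simp add: euclidean_representation)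
qed

text \<open>The first three differentials as multilinear forms. Expanding them in the standard basis reduces their
  derivatives along curves to the product rule. The arguments are listed in the order of
  differentiation.\<close>

definition jet1 :: "('a::euclidean_space \<Rightarrow> 'b::real_normed_vector) \<Rightarrow> 'a \<Rightarrow> 'a \<Rightarrow> 'b" where
  "jet1 f y v = (\<Sum>i\<in>Basis. (v \<bullet> i) *\<^sub>R dderiv f i y)"

definition jet2 :: "('a::euclidean_space \<Rightarrow> 'b::real_normed_vector) \<Rightarrow> 'a \<Rightarrow> 'a \<Rightarrow> 'a \<Rightarrow> 'b" where
  "jet2 f y v w = (\<Sum>i\<in>Basis. (v \<bullet> i) *\<^sub>R jet1 (dderiv f i) y w)"

definition jet3 :: "('a::euclidean_space \<Rightarrow> 'b::real_normed_vector) \<Rightarrow> 'a \<Rightarrow> 'a \<Rightarrow> 'a \<Rightarrow> 'a \<Rightarrow> 'b" where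
  "jet3 f y v w u = (\<Sum>i\<in>Basis. (v \<bullet> i) *\<^sub>R jet2 (dderiv f i) y w u)"

lemma jet1_eq_dderiv: "f differentiable (at x) \<Longrightarrow> jet1 f x v = dderiv f v x"
  unfolding jet1_def by (rule dderiv_basis[symmetric])

lemma jet_scale:
  "jet1 f y (c *\<^sub>R v) = c *\<^sub>R jet1 f y v"
  "jet2 f y (c *\<^sub>R v) w = c *\<^sub>R jet2 f y v w"
  "jet2 f y v (c *\<^sub>R w) = c *\<^sub>R jet2 f y v w"
  by (simp_all add: jet1_def jet2_def scaleR_sum_right mult_ac)

lemma jet_zero: "jet1 f y 0 = 0" "jet2 f y 0 w = 0" "jet2 f y w 0 = 0"
  by (simp_all add: jet1_def jet2_def)

lemma jet1_add: "jet1 f y (v + w) = jet1 f y v + jet1 f y w"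
  by (simp add: jet1_def inner_add_left scaleR_left_distrib sum.distrib)

lemma jet1_diff: "jet1 f y (v - w) = jet1 f y v - jet1 f y w"
  by (simp add: jet1_def inner_diff_left scaleR_left_diff_distrib sum_subtractf)

lemma norm_basis_sum_le:
  fixes v :: "'a::euclidean_space" and H :: real
  assumes "\<And>i. i \<in> Basis \<Longrightarrow> norm (h i) \<le> H"
  shows "norm (\<Sum>i\<in>Basis. (v \<bullet> i) *\<^sub>R h i) \<le> DIM('a) * norm v * H"
proof -
  have "norm (\<Sum>i\<in>Basis. (v \<bullet> i) *\<^sub>R h i) \<le> (\<Sum>i\<in>(Basis::'a set). norm v * H)"
    by (rule sum_norm_le) (auto intro!: mult_mono assms simp: Basis_le_norm)
  then show ?thesis by (simp add: mult_ac)
qed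

lemma norm_jet1_le:
  fixes f :: "'a::euclidean_space \<Rightarrow> 'b::real_normed_vector" and H :: real
  assumes "\<And>i. i \<in> Basis \<Longrightarrow> norm (dderiv f i y) \<le> H"
  shows "norm (jet1 f y v) \<le> DIM('a) * H * norm v"
  using norm_basis_sum_le[of "\<lambda>i. dderiv f i y" H v, OF assms] by (simp add: jet1_def mult_ac)

lemma norm_jet2_le:
  fixes f :: "'a::euclidean_space \<Rightarrow> 'b::real_normed_vector" and H :: real
  assumes "\<And>i j. i \<in> Basis \<Longrightarrow> j \<in> Basis \<Longrightarrow> norm (dderiv (dderiv f i) j y) \<le> H"
  shows "norm (jet2 f y v w) \<le> (DIM('a))\<^sup>2 * H * (norm v * norm w)"
proof -
  have "norm (jet1 (dderiv f i) y w) \<le> DIM('a) * H * norm w" if "i \<in> Basis" for i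
    using that by (intro norm_jet1_le assms)
  from norm_basis_sum_le[OF this, where v = v] show ?thesis
    by (simp add: jet2_def mult_ac power2_eq_square)
qed

lemma norm_jet3_le:
  fixes f :: "'a::euclidean_space \<Rightarrow> 'b::real_normed_vector" and H :: real
  assumes "\<And>i j l. i \<in> Basis \<Longrightarrow> j \<in> Basis \<Longrightarrow> l \<in> Basis \<Longrightarrow> norm (dderiv (dderiv (dderiv f i) j) l y) \<le> H"
  shows "norm (jet3 f y v w u) \<le> DIM('a) ^ 3 * H * (norm v * norm w * norm u)"
proof -
  have "norm (jet2 (dderiv f i) y w u) \<le> (DIM('a))\<^sup>2 * H * (norm w * norm u)" if "i \<in> Basis" for i
    using that by (intro norm_jet2_le assms)
  from norm_basis_sum_le[OF this, where v = v] show ?thesis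
    by (simp add: jet3_def mult_ac power2_eq_square power3_eq_cube)
qed

lemma has_vector_derivative_along_curve:
  fixes f :: "'a::euclidean_space \<Rightarrow> 'b::real_normed_vector"
  assumes "f differentiable (at (\<gamma> x))" "(\<gamma> has_vector_derivative v) (at x)"
  shows "((\<lambda>x. f (\<gamma> x)) has_vector_derivative jet1 f (\<gamma> x) v) (at x)"
proof -
  have "(\<gamma> has_derivative (\<lambda>h. h *\<^sub>R v)) (at x)"
    using assms(2) by (simp add: has_vector_derivative_def)
  from has_derivative_compose[OF this has_derivative_dderiv[OF assms(1)]]
  have "((\<lambda>x. f (\<gamma> x)) has_derivative (\<lambda>h. dderiv f (h *\<^sub>R v) (\<gamma> x))) (at x)" .
  moreover have "dderiv f (h *\<^sub>R v) (\<gamma> x) = h *\<^sub>R jet1 f (\<gamma> x) v" for h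
    using jet1_eq_dderiv[OF assms(1)] by (metis jet_scale(1))
  ultimately show ?thesis by (simp add: has_vector_derivative_def)
qed

lemma has_vector_derivative_jet1:
  fixes f :: "'a::euclidean_space \<Rightarrow> 'b::real_normed_vector"
  assumes "\<And>i. dderiv f i differentiable (at (\<gamma> x))" "(\<gamma> has_vector_derivative u) (at x)"
    and "(v has_vector_derivative v') (at x)"
  shows "((\<lambda>x. jet1 f (\<gamma> x) (v x)) has_vector_derivative
      jet1 f (\<gamma> x) v' + jet2 f (\<gamma> x) (v x) u) (at x)"
proof -
  have "((\<lambda>x. v x \<bullet> i) has_real_derivative v' \<bullet> i) (at x)" for i
    using bounded_linear.has_vector_derivative[OF bounded_linear_inner_left assms(3), of i]
    by (simp add: has_real_derivative_iff_has_vector_derivative)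
  then have "((\<lambda>x. jet1 f (\<gamma> x) (v x)) has_vector_derivative
      (\<Sum>i\<in>Basis. (v x \<bullet> i) *\<^sub>R jet1 (dderiv f i) (\<gamma> x) u + (v' \<bullet> i) *\<^sub>R dderiv f i (\<gamma> x))) (at x)"
    unfolding jet1_def[of f]
    by (intro has_vector_derivative_sum has_vector_derivative_scaleR
        has_vector_derivative_along_curve assms)
  then show ?thesis by (simp add: sum.distrib jet1_def[of f] jet2_def add.commute)
qed

lemma has_vector_derivative_jet2:
  fixes f :: "'a::euclidean_space \<Rightarrow> 'b::real_normed_vector"
  assumes "\<And>i j. dderiv (dderiv f i) j differentiable (at (\<gamma> x))" "(\<gamma> has_vector_derivative u) (at x)"
    and "(v has_vector_derivative v') (at x)" "(w has_vector_derivative w') (at x)"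
  shows "((\<lambda>x. jet2 f (\<gamma> x) (v x) (w x)) has_vector_derivative
      jet2 f (\<gamma> x) v' (w x) + jet2 f (\<gamma> x) (v x) w' + jet3 f (\<gamma> x) (v x) (w x) u) (at x)"
proof -
  have "((\<lambda>x. v x \<bullet> i) has_real_derivative v' \<bullet> i) (at x)" for i
    using bounded_linear.has_vector_derivative[OF bounded_linear_inner_left assms(3), of i]
    by (simp add: has_real_derivative_iff_has_vector_derivative)
  then have "((\<lambda>x. jet2 f (\<gamma> x) (v x) (w x)) has_vector_derivative
      (\<Sum>i\<in>Basis. (v x \<bullet> i) *\<^sub>R (jet1 (dderiv f i) (\<gamma> x) w' + jet2 (dderiv f i) (\<gamma> x) (w x) u)
        + (v' \<bullet> i) *\<^sub>R jet1 (dderiv f i) (\<gamma> x) (w x))) (at x)"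
    unfolding jet2_def[of f]
    by (intro has_vector_derivative_sum has_vector_derivative_scaleR
        has_vector_derivative_jet1 assms)
  then show ?thesis
    by (simp add: sum.distrib jet2_def[of f] jet3_def scaleR_right_distrib algebra_simps)
qed

lemma norm_increment_le:
  fixes g :: "real \<Rightarrow> 'b::real_normed_vector"
  assumes "\<And>x. \<bar>x\<bar> \<le> 1/2 \<Longrightarrow> (g has_vector_derivative g' x) (at x)"
    and "\<And>x. \<bar>x\<bar> \<le> 1/2 \<Longrightarrow> norm (g' x) \<le> G" and "\<bar>x\<bar> \<le> 1/2"
  shows "norm (g x - g 0) \<le> G"
proof -
  have "norm (g x - g 0) \<le> G * norm (x - 0)"
  proof (rule differentiable_bound[where S = "{-1/2..1/2}" and f' = "\<lambda>x h. h *\<^sub>R g' x"])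
    show "(g has_derivative (\<lambda>h. h *\<^sub>R g' y)) (at y within {-1/2..1/2})" if "y \<in> {-1/2..1/2}" for y
      using assms(1)[of y] that unfolding has_vector_derivative_def
      by (auto simp: abs_le_iff intro: has_derivative_at_withinI)
    show "onorm (\<lambda>h. h *\<^sub>R g' y) \<le> G" if "y \<in> {-1/2..1/2}" for y
    proof (rule onorm_le)
      fix h :: real
      have "norm (g' y) \<le> G" using that by (intro assms(2)) (auto simp: abs_le_iff)
      then show "norm (h *\<^sub>R g' y) \<le> G * norm h"
        by (simp add: mult.commute[of "\<bar>h\<bar>"] mult_right_mono)
    qed
  qed (use assms(3) in \<open>auto simp: abs_le_iff\<close>)
  also have "\<dots> \<le> G * 1"
    using assms(3) order_trans[OF norm_ge_zero assms(2)[of 0]] by (intro mult_left_mono) auto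
  finally show ?thesis by simp
qed

text \<open>On an interval of radius \<open>1/2\<close> the usual powers of \<open>x\<close> in the remainders may be dropped.\<close>

lemma second_order_expansions:
  fixes g :: "real \<Rightarrow> 'b::real_normed_vector"
  assumes g: "\<And>x. \<bar>x\<bar> \<le> 1/2 \<Longrightarrow> (g has_vector_derivative g1 x) (at x)"
    and g1: "\<And>x. \<bar>x\<bar> \<le> 1/2 \<Longrightarrow> (g1 has_vector_derivative g2 x) (at x)"
    and g2: "\<And>x. \<bar>x\<bar> \<le> 1/2 \<Longrightarrow> (g2 has_vector_derivative g3 x) (at x)"
    and G: "\<And>x. \<bar>x\<bar> \<le> 1/2 \<Longrightarrow> norm (g3 x) \<le> G" and x: "\<bar>x\<bar> \<le> 1/2"
  shows "norm (g2 x - g2 0) \<le> G"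
    and "norm (g1 x - g1 0 - x *\<^sub>R g2 0) \<le> G"
    and "norm (g x - g 0 - x *\<^sub>R g1 0 - (x\<^sup>2 / 2) *\<^sub>R g2 0) \<le> G"
proof -
  have 2: "norm (g2 x - g2 0) \<le> G" if "\<bar>x\<bar> \<le> 1/2" for x
    by (rule norm_increment_le[OF g2 G that])
  have "((\<lambda>x. g1 x - x *\<^sub>R g2 0) has_vector_derivative g2 x - g2 0) (at x)" if "\<bar>x\<bar> \<le> 1/2" for x
    using g1[OF that] by (auto intro!: derivative_eq_intros)
  from norm_increment_le[OF this 2]
  have 1: "norm (g1 x - g1 0 - x *\<^sub>R g2 0) \<le> G" if "\<bar>x\<bar> \<le> 1/2" for x
    using that by (simp add: algebra_simps)
  show "norm (g2 x - g2 0) \<le> G" "norm (g1 x - g1 0 - x *\<^sub>R g2 0) \<le> G"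
    using 1 2 x by auto
  have "((\<lambda>x. g x - x *\<^sub>R g1 0 - (x\<^sup>2 / 2) *\<^sub>R g2 0) has_vector_derivative g1 x - g1 0 - x *\<^sub>R g2 0) (at x)"
    if "\<bar>x\<bar> \<le> 1/2" for x
    using g[OF that] by (auto intro!: derivative_eq_intros)
  from norm_increment_le[OF this 1] x
  show "norm (g x - g 0 - x *\<^sub>R g1 0 - (x\<^sup>2 / 2) *\<^sub>R g2 0) \<le> G"
    by (simp add: algebra_simps)
qed

text \<open>If \<open>\<gamma> x = a + x b + x\<^sup>2 c\<close> with derivative \<open>b\<close> and second derivative \<open>2 c\<close> at \<open>0\<close>, this is the second-order
  Taylor polynomial of \<open>f \<circ> \<gamma>\<close> at \<open>0\<close>, evaluated at \<open>\<i>\<close>.\<close>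

definition quasi_extension ::
  "('a::euclidean_space \<Rightarrow> complex ^ 'n) \<Rightarrow> 'a \<Rightarrow> 'a \<Rightarrow> 'a \<Rightarrow> complex ^ 'n" where
  "quasi_extension f a b c = f a + \<i> *s jet1 f a b - (jet1 f a c + (1/2) *\<^sub>R jet2 f a b b)"

text \<open>With \<open>g = f \<circ> \<gamma>\<close> the left-hand side compares the Taylor polynomial of \<open>g\<close> at \<open>0\<close>, evaluated at
  \<open>\<zeta> = x + \<i> y\<close>, with the Taylor polynomial at \<open>x\<close>, evaluated at the increment \<open>\<i> y\<close>. Both are
  expansions of the same function, and the third derivative of \<open>g\<close> is \<open>O(\<epsilon>\<^sup>3)\<close> because \<open>\<gamma>'\<close> is \<open>O(\<epsilon>)\<close> and
  \<open>\<gamma>''\<close> is \<open>O(\<epsilon>\<^sup>2)\<close>.\<close>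

lemma quasi_extension_disc_error:
  fixes f :: "'a::euclidean_space \<Rightarrow> complex ^ 'n" and H V \<epsilon> :: real
  assumes diff: "\<And>y. y \<in> U \<Longrightarrow> f differentiable (at y)"
      "\<And>y i. y \<in> U \<Longrightarrow> dderiv f i differentiable (at y)"
      "\<And>y i j. y \<in> U \<Longrightarrow> dderiv (dderiv f i) j differentiable (at y)"
    and H2: "\<And>y i j. y \<in> U \<Longrightarrow> i \<in> Basis \<Longrightarrow> j \<in> Basis \<Longrightarrow> norm (dderiv (dderiv f i) j y) \<le> H"
    and H3: "\<And>y i j l. y \<in> U \<Longrightarrow> i \<in> Basis \<Longrightarrow> j \<in> Basis \<Longrightarrow> l \<in> Basis \<Longrightarrow>
      norm (dderiv (dderiv (dderiv f i) j) l y) \<le> H"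
    and U: "\<And>x. \<bar>x\<bar> \<le> 1/2 \<Longrightarrow> a + x *\<^sub>R b + x\<^sup>2 *\<^sub>R c \<in> U"
    and V: "norm b \<le> V * \<epsilon>" "norm c \<le> V * \<epsilon>\<^sup>2" "0 \<le> \<epsilon>" "\<epsilon> \<le> 1" "1 \<le> V"
    and \<zeta>: "\<bar>Re \<zeta>\<bar> \<le> 1/2" "\<bar>Im \<zeta> - 1\<bar> \<le> 1/2"
  shows "norm (f a + \<zeta> *s jet1 f a b + \<zeta>\<^sup>2 *s (jet1 f a c + (1/2) *\<^sub>R jet2 f a b b)
      - quasi_extension f (a + Re \<zeta> *\<^sub>R b + (Re \<zeta>)\<^sup>2 *\<^sub>R c)
          (Im \<zeta> *\<^sub>R (b + (2 * Re \<zeta>) *\<^sub>R c)) ((Im \<zeta>)\<^sup>2 *\<^sub>R c))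
    \<le> 80 * DIM('a) ^ 3 * H * V ^ 3 * \<epsilon> ^ 3"
proof -
  define n where "n = real DIM('a)"
  have n: "1 \<le> n" unfolding n_def using DIM_positive[where 'a = 'a] by (simp add: Suc_leI)
  define \<gamma> where "\<gamma> x = a + x *\<^sub>R b + x\<^sup>2 *\<^sub>R c" for x
  define \<gamma>1 where "\<gamma>1 x = b + (2 * x) *\<^sub>R c" for x
  define g1 where "g1 x = jet1 f (\<gamma> x) (\<gamma>1 x)" for x
  define g2 where "g2 x = jet1 f (\<gamma> x) (2 *\<^sub>R c) + jet2 f (\<gamma> x) (\<gamma>1 x) (\<gamma>1 x)" for x
  define g3 where "g3 x = jet2 f (\<gamma> x) (2 *\<^sub>R c) (\<gamma>1 x) + (jet2 f (\<gamma> x) (2 *\<^sub>R c) (\<gamma>1 x)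
    + jet2 f (\<gamma> x) (\<gamma>1 x) (2 *\<^sub>R c) + jet3 f (\<gamma> x) (\<gamma>1 x) (\<gamma>1 x) (\<gamma>1 x))" for x
  define G where "G = 20 * n ^ 3 * H * V ^ 3 * \<epsilon> ^ 3"
  have \<gamma>U: "\<gamma> x \<in> U" if "\<bar>x\<bar> \<le> 1/2" for x unfolding \<gamma>_def by (rule U[OF that])
  have d\<gamma>: "(\<gamma> has_vector_derivative \<gamma>1 x) (at x)" for x
    unfolding \<gamma>_def \<gamma>1_def by (auto intro!: derivative_eq_intros)
  have d\<gamma>1: "(\<gamma>1 has_vector_derivative 2 *\<^sub>R c) (at x)" for x
    unfolding \<gamma>1_def by (auto intro!: derivative_eq_intros)
  have d0: "((\<lambda>x. f (\<gamma> x)) has_vector_derivative g1 x) (at x)" if "\<bar>x\<bar> \<le> 1/2" for x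
    unfolding g1_def by (intro has_vector_derivative_along_curve d\<gamma> diff \<gamma>U that)
  have d1: "(g1 has_vector_derivative g2 x) (at x)" if "\<bar>x\<bar> \<le> 1/2" for x
    unfolding g1_def[abs_def] g2_def by (intro has_vector_derivative_jet1 d\<gamma> d\<gamma>1 diff \<gamma>U that)
  have d2: "(g2 has_vector_derivative g3 x) (at x)" if "\<bar>x\<bar> \<le> 1/2" for x
  proof -
    have "((\<lambda>x. jet1 f (\<gamma> x) (2 *\<^sub>R c)) has_vector_derivative
        jet1 f (\<gamma> x) 0 + jet2 f (\<gamma> x) (2 *\<^sub>R c) (\<gamma>1 x)) (at x)"
      by (intro has_vector_derivative_jet1 d\<gamma> has_vector_derivative_const diff \<gamma>U that)
    then show ?thesis
      unfolding g2_def[abs_def] g3_def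
      by (intro has_vector_derivative_add has_vector_derivative_jet2 d\<gamma> d\<gamma>1 diff \<gamma>U that)
        (simp add: jet_zero)
  qed
  have "norm (g3 x) \<le> G" if x: "\<bar>x\<bar> \<le> 1/2" for x
  proof -
    obtain i where i: "i \<in> (Basis :: 'a set)" using nonempty_Basis by blast
    have "0 \<le> H" using H2[OF \<gamma>U[OF x] i i] norm_ge_zero order_trans by blast
    have "\<epsilon>\<^sup>2 \<le> \<epsilon>" using V(3,4) mult_left_mono[of \<epsilon> 1 \<epsilon>] by (simp add: power2_eq_square)
    have "norm ((2 * x) *\<^sub>R c) \<le> 1 * (V * \<epsilon>\<^sup>2)"
      unfolding norm_scaleR using x V by (intro mult_mono) auto
    also have "\<dots> \<le> V * \<epsilon>" using V \<open>\<epsilon>\<^sup>2 \<le> \<epsilon>\<close> by simp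
    finally have n\<gamma>1: "norm (\<gamma>1 x) \<le> 2 * V * \<epsilon>"
      unfolding \<gamma>1_def using norm_triangle_ineq[of b "(2 * x) *\<^sub>R c"] V by linarith
    have nc: "norm (2 *\<^sub>R c) \<le> 2 * V * \<epsilon>\<^sup>2" using V by simp
    have VV: "V\<^sup>2 \<le> V ^ 3" "n\<^sup>2 \<le> n ^ 3" using V n by (auto intro: power_increasing)
    have P: "norm u * norm w \<le> 4 * V ^ 3 * \<epsilon> ^ 3"
      if "norm u \<le> 2 * V * \<epsilon>\<^sup>2" "norm w \<le> 2 * V * \<epsilon>" for u w :: 'a
    proof -
      have "norm u * norm w \<le> (2 * V * \<epsilon>\<^sup>2) * (2 * V * \<epsilon>)"
        using that V by (intro mult_mono) auto
      also have "\<dots> = 4 * V\<^sup>2 * \<epsilon> ^ 3" by (simp add: power2_eq_square power3_eq_cube)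
      also have "\<dots> \<le> 4 * V ^ 3 * \<epsilon> ^ 3" using VV V by (intro mult_right_mono) auto
      finally show ?thesis .
    qed
    have j2: "norm (jet2 f (\<gamma> x) u w) \<le> n ^ 3 * H * (4 * V ^ 3 * \<epsilon> ^ 3)"
      if "norm u * norm w \<le> 4 * V ^ 3 * \<epsilon> ^ 3" for u w
    proof -
      have "norm (jet2 f (\<gamma> x) u w) \<le> n\<^sup>2 * H * (norm u * norm w)"
        unfolding n_def using norm_jet2_le[OF H2[OF \<gamma>U[OF x]], of u w] by simp
      also have "\<dots> \<le> n ^ 3 * H * (4 * V ^ 3 * \<epsilon> ^ 3)"
        using VV \<open>0 \<le> H\<close> n by (intro mult_mono[OF _ that] mult_right_mono) auto
      finally show ?thesis .
    qed
    have j3: "norm (jet3 f (\<gamma> x) (\<gamma>1 x) (\<gamma>1 x) (\<gamma>1 x)) \<le> n ^ 3 * H * (8 * V ^ 3 * \<epsilon> ^ 3)"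
    proof -
      have "norm (jet3 f (\<gamma> x) (\<gamma>1 x) (\<gamma>1 x) (\<gamma>1 x)) \<le> n ^ 3 * H * norm (\<gamma>1 x) ^ 3"
        unfolding n_def using norm_jet3_le[OF H3[OF \<gamma>U[OF x]], of "\<gamma>1 x" "\<gamma>1 x" "\<gamma>1 x"]
        by (simp add: power3_eq_cube)
      also have "\<dots> \<le> n ^ 3 * H * (2 * V * \<epsilon>) ^ 3"
        using n\<gamma>1 \<open>0 \<le> H\<close> n by (intro mult_left_mono power_mono) auto
      finally show ?thesis by (simp add: power_mult_distrib)
    qed
    have "norm (g3 x) \<le> n ^ 3 * H * (4 * V ^ 3 * \<epsilon> ^ 3) + (n ^ 3 * H * (4 * V ^ 3 * \<epsilon> ^ 3)
        + n ^ 3 * H * (4 * V ^ 3 * \<epsilon> ^ 3) + n ^ 3 * H * (8 * V ^ 3 * \<epsilon> ^ 3))"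
      unfolding g3_def
      using P[OF nc n\<gamma>1] P[OF nc n\<gamma>1] by (intro norm_triangle_le add_mono j2 j3) (auto simp: mult.commute)
    then show ?thesis unfolding G_def by (simp add: algebra_simps)
  qed
  note expansions = second_order_expansions[OF d0 d1 d2 this \<zeta>(1)]
  define x y where "x = Re \<zeta>" and "y = Im \<zeta>"
  have \<zeta>_eq: "\<zeta> = of_real x + \<i> * of_real y" unfolding x_def y_def by (simp add: complex_eq)
  have y: "0 \<le> y" "y \<le> 3/2" using \<zeta>(2) unfolding y_def by linarith+
  define E0 where "E0 = f (\<gamma> x) - f (\<gamma> 0) - x *\<^sub>R g1 0 - (x\<^sup>2 / 2) *\<^sub>R g2 0"
  define E1 where "E1 = g1 x - g1 0 - x *\<^sub>R g2 0"
  define E2 where "E2 = g2 x - g2 0"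
  have E: "norm E0 \<le> G" "norm E1 \<le> G" "norm E2 \<le> G"
    using expansions unfolding E0_def E1_def E2_def x_def by auto
  have g2_half: "jet1 f (\<gamma> x) c + (1/2) *\<^sub>R jet2 f (\<gamma> x) (\<gamma>1 x) (\<gamma>1 x) = (1/2) *\<^sub>R g2 x" for x
    unfolding g2_def by (simp add: jet_scale scaleR_right_distrib)
  have at0: "\<gamma> 0 = a" "\<gamma>1 0 = b" unfolding \<gamma>_def \<gamma>1_def by simp_all
  have Q: "quasi_extension f (\<gamma> x) (y *\<^sub>R \<gamma>1 x) (y\<^sup>2 *\<^sub>R c)
      = f (\<gamma> x) + \<i> *s (y *\<^sub>R g1 x) - y\<^sup>2 *\<^sub>R ((1/2) *\<^sub>R g2 x)"
    unfolding quasi_extension_def g2_half[symmetric] g1_def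
    by (simp add: jet_scale scaleR_right_distrib power2_eq_square)
  have "f a + \<zeta> *s g1 0 + \<zeta>\<^sup>2 *s ((1/2) *\<^sub>R g2 0) - quasi_extension f (\<gamma> x) (y *\<^sub>R \<gamma>1 x) (y\<^sup>2 *\<^sub>R c)
      = - E0 - (\<i> * of_real y) *s E1 + (y\<^sup>2 / 2) *\<^sub>R E2"
    unfolding Q E0_def E1_def E2_def at0 \<zeta>_eq
    by (simp add: vec_eq_iff) (simp add: scaleR_conv_of_real field_simps power2_eq_square)
  moreover have "norm (- E0 - (\<i> * of_real y) *s E1 + (y\<^sup>2 / 2) *\<^sub>R E2) \<le> G + 3/2 * G + 9/8 * G"
  proof (intro norm_triangle_le norm_triangle_le_diff add_mono)
    have "0 \<le> G" using E(1) norm_ge_zero order_trans by blast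
    show "norm (- E0) \<le> G" using E by simp
    show "norm ((\<i> * of_real y) *s E1) \<le> 3/2 * G"
      unfolding norm_vector_scalar_mult using y E by (intro mult_mono) (auto simp: norm_mult)
    have "y\<^sup>2 \<le> (3/2)\<^sup>2" using y by (intro power_mono)
    then show "norm ((y\<^sup>2 / 2) *\<^sub>R E2) \<le> 9/8 * G"
      unfolding norm_scaleR using E \<open>0 \<le> G\<close> by (intro mult_mono) (auto simp: power2_eq_square)
  qed
  moreover have "G + 3/2 * G + 9/8 * G \<le> 80 * n ^ 3 * H * V ^ 3 * \<epsilon> ^ 3"
    using order_trans[OF norm_ge_zero E(1)] unfolding G_def by simp
  ultimately show ?thesis
    unfolding g1_def g2_half[symmetric] at0 n_def \<gamma>_def \<gamma>1_def x_def y_def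
    by simp
qed

section \<open>Disc systems on images of cones and of linear subspaces\<close>

text \<open>For \<open>k = 2\<close>, the two roots \<open>w\<close> and \<open>- w\<close> satisfy \<open>(w - t) * (w + t) = \<eta>\<close>, so one of them is within the
  square root of \<open>|\<eta>|\<close> from \<open>t\<close>.\<close>

lemma complex_root_near_real:
  fixes t :: real
  assumes k: "k = 1 \<or> k = (2::nat)"
  obtains w where "w ^ k = complex_of_real t ^ k + \<eta>" "cmod (w - of_real t) \<le> root k (cmod \<eta>)"
  using k
proof (rule root_1_or_2)
  assume "k = 1" "root k = (\<lambda>x. x)"
  then show thesis by (intro that[of "of_real t + \<eta>"]) auto
next
  assume k2: "k = 2" "root k = sqrt"
  define w where "w = csqrt (of_real t ^ 2 + \<eta>)"
  have w: "w\<^sup>2 = of_real t ^ 2 + \<eta>" unfolding w_def by simp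
  have prod: "(w - of_real t) * (w + of_real t) = \<eta>"
    using w by (simp add: algebra_simps power2_eq_square)
  have small: "cmod u \<le> sqrt (cmod \<eta>)" if "cmod u \<le> cmod u'" "u * u' = \<eta>" for u u'
  proof (rule real_le_rsqrt)
    have "(cmod u)\<^sup>2 \<le> cmod u * cmod u'" using that by (simp add: power2_eq_square mult_left_mono)
    then show "(cmod u)\<^sup>2 \<le> cmod \<eta>" using that(2) by (simp flip: norm_mult)
  qed
  show thesis
  proof (cases "cmod (w - of_real t) \<le> cmod (w + of_real t)")
    case True
    then show thesis using that[of w] small[OF True prod] w k2 by simp
  next
    case False
    then have "cmod (- w - of_real t) \<le> cmod (of_real t - w)"
      by (metis add.commute minus_add_distrib norm_minus_cancel norm_minus_commute uminus_add_conv_diff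
          diff_conv_add_uminus linear)
    moreover have "(- w - of_real t) * (of_real t - w) = \<eta>"
      using prod by (simp add: algebra_simps)
    ultimately show thesis using that[of "- w"] small w k2 by simp
  qed
qed

text \<open>For \<open>k = 1\<close> the map \<open>t \<mapsto> power_map k q v t\<close> parametrises an affine subspace, and for \<open>k = 2\<close> it folds the
  parameter space onto the convex cone with apex \<open>q\<close> generated by the \<open>v b\<close>. The functions
  \<open>power_map1\<close> and \<open>power_map2\<close> are the coefficients of \<open>x\<close> and \<open>x\<^sup>2\<close> in \<open>power_map k q v (t + x *\<^sub>R s)\<close>; the
  factor \<open>real (k - 1)\<close> makes the quadratic one vanish for \<open>k = 1\<close>.\<close>

definition power_map :: "nat \<Rightarrow> 'a::real_vector \<Rightarrow> ('b::euclidean_space \<Rightarrow> 'a) \<Rightarrow> 'b \<Rightarrow> 'a" where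
  "power_map k q v t = q + (\<Sum>b\<in>Basis. (t \<bullet> b) ^ k *\<^sub>R v b)"

definition power_map1 :: "nat \<Rightarrow> ('b::euclidean_space \<Rightarrow> 'a::real_vector) \<Rightarrow> 'b \<Rightarrow> 'b \<Rightarrow> 'a" where
  "power_map1 k v t s = (\<Sum>b\<in>Basis. (real k * (t \<bullet> b) ^ (k - 1) * (s \<bullet> b)) *\<^sub>R v b)"

definition power_map2 :: "nat \<Rightarrow> ('b::euclidean_space \<Rightarrow> 'a::real_vector) \<Rightarrow> 'b \<Rightarrow> 'a" where
  "power_map2 k v s = (\<Sum>b\<in>Basis. (real (k - 1) * (s \<bullet> b)\<^sup>2) *\<^sub>R v b)"

lemma norm_sum_scaleR_le:
  fixes v :: "'b \<Rightarrow> 'a::real_normed_vector"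
  assumes "\<And>b. b \<in> B \<Longrightarrow> \<bar>c b\<bar> \<le> x" "(\<Sum>b\<in>B. norm (v b)) \<le> V" "0 \<le> x"
  shows "norm (\<Sum>b\<in>B. c b *\<^sub>R v b) \<le> x * V"
proof -
  have "norm (\<Sum>b\<in>B. c b *\<^sub>R v b) \<le> (\<Sum>b\<in>B. x * norm (v b))"
    by (rule sum_norm_le) (auto intro!: mult_right_mono assms)
  also have "\<dots> = x * (\<Sum>b\<in>B. norm (v b))" by (simp add: sum_distrib_left)
  also have "\<dots> \<le> x * V" using assms by (intro mult_left_mono)
  finally show ?thesis .
qed

lemma power_map_line:
  assumes k: "k = 1 \<or> k = 2"
  shows "power_map k q v (t + x *\<^sub>R s) =
    power_map k q v t + x *\<^sub>R power_map1 k v t s + x\<^sup>2 *\<^sub>R power_map2 k v s"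
  unfolding power_map_def power_map1_def power_map2_def
  using k by (auto simp: scaleR_sum_right inner_add_left power2_eq_square algebra_simps
      scaleR_left_distrib sum.distrib)

lemma power_map1_line:
  assumes k: "k = 1 \<or> k = 2"
  shows "power_map1 k v (t + x *\<^sub>R s) (y *\<^sub>R s) = y *\<^sub>R (power_map1 k v t s + (2 * x) *\<^sub>R power_map2 k v s)"
  unfolding power_map1_def power_map2_def
  using k by (auto simp: scaleR_sum_right inner_add_left power2_eq_square algebra_simps
      scaleR_left_distrib sum.distrib)

lemma power_map2_scale: "power_map2 k v (y *\<^sub>R s) = y\<^sup>2 *\<^sub>R power_map2 k v s"
  unfolding power_map2_def by (simp add: scaleR_sum_right power_mult_distrib mult_ac)

context
  fixes k :: nat and v :: "'b::euclidean_space \<Rightarrow> 'a::real_normed_vector" and V :: real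
  assumes k: "k = 1 \<or> k = 2" and V: "(\<Sum>b\<in>Basis. norm (v b)) \<le> V"
begin

lemma norm_power_map_diff:
  assumes "norm t \<le> 1" shows "norm (power_map k q v t - q) \<le> norm t * V"
proof -
  have "\<bar>(t \<bullet> b) ^ k\<bar> \<le> norm t" if "b \<in> Basis" for b
  proof -
    have le: "\<bar>t \<bullet> b\<bar> \<le> norm t" by (rule Basis_le_norm[OF that])
    then have "\<bar>t \<bullet> b\<bar> * \<bar>t \<bullet> b\<bar> \<le> norm t * 1" using assms by (intro mult_mono) auto
    then show ?thesis using k le by (auto simp: power2_eq_square abs_mult)
  qed
  then show ?thesis unfolding power_map_def using V by (simp add: norm_sum_scaleR_le)
qed

lemma norm_power_map1_le:
  assumes "norm t \<le> 1" shows "norm (power_map1 k v t s) \<le> 2 * V * norm s"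
proof -
  have "\<bar>real k * (t \<bullet> b) ^ (k - 1) * (s \<bullet> b)\<bar> \<le> 2 * norm s" if "b \<in> Basis" for b
  proof -
    have "\<bar>t \<bullet> b\<bar> \<le> 1" "\<bar>s \<bullet> b\<bar> \<le> norm s"
      using Basis_le_norm[OF that, of t] Basis_le_norm[OF that, of s] assms by auto
    moreover from this have "\<bar>t \<bullet> b\<bar> * \<bar>s \<bullet> b\<bar> \<le> 1 * norm s" by (intro mult_mono) auto
    ultimately show ?thesis using k by (auto simp: abs_mult)
  qed
  then show ?thesis
    unfolding power_map1_def using norm_sum_scaleR_le[OF _ V, of _ "2 * norm s"] by (simp add: mult_ac)
qed

lemma norm_power_map2_le: "norm (power_map2 k v s) \<le> V * (norm s)\<^sup>2"
proof -
  have "\<bar>real (k - 1) * (s \<bullet> b)\<^sup>2\<bar> \<le> (norm s)\<^sup>2" if "b \<in> Basis" for b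
  proof -
    have "(s \<bullet> b)\<^sup>2 \<le> (norm s)\<^sup>2"
      using Basis_le_norm[OF that, of s] by (simp flip: abs_le_square_iff)
    then show ?thesis using k by auto
  qed
  then show ?thesis
    unfolding power_map2_def using norm_sum_scaleR_le[OF _ V, of _ "(norm s)\<^sup>2"] by (simp add: mult_ac)
qed

text \<open>Formally \<open>t' + \<i> s'\<close> is obtained by solving \<open>(t' + \<i> s') ^ k = t ^ k + \<eta>\<close> in each coordinate. The three
  equations are the real and imaginary parts of this equation.\<close>

lemma power_map_complex_shift:
  fixes t :: 'b and \<eta> :: "'b \<Rightarrow> complex"
  assumes \<eta>: "\<And>b. b \<in> Basis \<Longrightarrow> cmod (\<eta> b) \<le> h"
  obtains t' s' where
    "power_map k q v t' = power_map k q v t + (\<Sum>b\<in>Basis. Re (\<eta> b) *\<^sub>R v b) + power_map2 k v s'"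
    "power_map1 k v t' s' = (\<Sum>b\<in>Basis. Im (\<eta> b) *\<^sub>R v b)"
    "norm (t' - t) \<le> DIM('b) * root k h" "norm s' \<le> DIM('b) * root k h"
    "norm (power_map2 k v s') \<le> h * V"
proof -
  have "\<exists>w. \<forall>b. w b ^ k = complex_of_real (t \<bullet> b) ^ k + \<eta> b \<and>
      cmod (w b - of_real (t \<bullet> b)) \<le> root k (cmod (\<eta> b))"
    using complex_root_near_real[OF k] by (intro choice) metis
  then obtain w where w: "\<And>b. w b ^ k = complex_of_real (t \<bullet> b) ^ k + \<eta> b"
    and w_near: "\<And>b. cmod (w b - of_real (t \<bullet> b)) \<le> root k (cmod (\<eta> b))" by metis
  have "0 < k" using k by auto
  have near: "cmod (w b - of_real (t \<bullet> b)) \<le> root k h" if "b \<in> Basis" for b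
    using w_near[of b] \<eta>[OF that] \<open>0 < k\<close> by (smt (verit) real_root_le_iff)
  define t' s' where "t' = (\<Sum>b\<in>Basis. Re (w b) *\<^sub>R b)" and "s' = (\<Sum>b\<in>Basis. Im (w b) *\<^sub>R b)"
  have coords: "t' \<bullet> b = Re (w b)" "s' \<bullet> b = Im (w b)" if "b \<in> Basis" for b
    unfolding t'_def s'_def using that by (simp_all add: inner_sum_left inner_Basis if_distrib cong: if_cong)
  have re: "Re (w b) ^ k = (t \<bullet> b) ^ k + Re (\<eta> b) + real (k - 1) * (Im (w b))\<^sup>2" for b
    using arg_cong[OF w[of b], of Re] k by (auto simp: power2_eq_square)
  have im: "real k * Re (w b) ^ (k - 1) * Im (w b) = Im (\<eta> b)" for b
    using arg_cong[OF w[of b], of Im] k by (auto simp: power2_eq_square mult_ac)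
  show thesis
  proof
    show "power_map k q v t' = power_map k q v t + (\<Sum>b\<in>Basis. Re (\<eta> b) *\<^sub>R v b) + power_map2 k v s'"
      unfolding power_map_def power_map2_def
      by (simp add: coords re scaleR_left_distrib sum.distrib)
    show "power_map1 k v t' s' = (\<Sum>b\<in>Basis. Im (\<eta> b) *\<^sub>R v b)"
      unfolding power_map1_def by (simp add: coords im del: One_nat_def)
    have "norm (t' - t) \<le> (\<Sum>b\<in>Basis. \<bar>(t' - t) \<bullet> b\<bar>)" by (rule norm_le_l1)
    also have "\<dots> \<le> (\<Sum>b\<in>(Basis::'b set). root k h)"
    proof (rule sum_mono)
      fix b :: 'b assume "b \<in> Basis"
      then show "\<bar>(t' - t) \<bullet> b\<bar> \<le> root k h"
        using abs_Re_le_cmod[of "w b - of_real (t \<bullet> b)"] near[of b] by (simp add: inner_diff_left coords)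
    qed
    finally show "norm (t' - t) \<le> DIM('b) * root k h" by simp
    have im_le: "\<bar>Im (w b)\<bar> \<le> root k h" if "b \<in> Basis" for b
      using abs_Im_le_cmod[of "w b - of_real (t \<bullet> b)"] near[OF that] by simp
    have "norm s' \<le> (\<Sum>b\<in>Basis. \<bar>s' \<bullet> b\<bar>)" by (rule norm_le_l1)
    also have "\<dots> \<le> (\<Sum>b\<in>(Basis::'b set). root k h)"
      by (rule sum_mono) (simp add: coords im_le)
    finally show "norm s' \<le> DIM('b) * root k h" by simp
    have "0 \<le> h" using \<eta> nonempty_Basis norm_ge_zero order_trans by blast
    have "\<bar>real (k - 1) * (s' \<bullet> b)\<^sup>2\<bar> \<le> h" if "b \<in> Basis" for b
    proof -
      have "\<bar>Im (w b)\<bar> ^ 2 \<le> (root k h) ^ 2" if "k = 2"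
        using im_le[OF \<open>b \<in> Basis\<close>] by (intro power_mono) auto
      then show ?thesis using k \<open>0 \<le> h\<close> coords[OF that] by (auto simp: sqrt_def[symmetric])
    qed
    then show "norm (power_map2 k v s') \<le> h * V"
      unfolding power_map2_def using V \<open>0 \<le> h\<close> by (intro norm_sum_scaleR_le)
  qed
qed

end

text \<open>A quantitative form of the genericity condition \<open>E + \<i> E = UNIV\<close> for \<open>E = T ` span (v ` Basis)\<close>: complex
  coordinates of \<open>e\<close> that are bounded by a multiple of \<open>|e|\<close>.\<close>

lemma complex_span_coordinates:
  fixes T :: "'a::euclidean_space \<Rightarrow> complex ^ 'n" and v :: "'b::euclidean_space \<Rightarrow> 'a"
  assumes T: "linear T"
    and span: "{u + \<i> *s w | u w. u \<in> T ` span (v ` Basis) \<and> w \<in> T ` span (v ` Basis)} = UNIV"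
  obtains C where "1 \<le> C" "\<And>e. \<exists>\<eta>. (\<forall>b. cmod (\<eta> b) \<le> C * norm e) \<and>
    T (\<Sum>b\<in>Basis. Re (\<eta> b) *\<^sub>R v b) + \<i> *s T (\<Sum>b\<in>Basis. Im (\<eta> b) *\<^sub>R v b) = e"
proof -
  define h where "h c = (\<Sum>b\<in>Basis. (c \<bullet> b) *\<^sub>R v b)" for c :: 'b
  have lin: "linear h" unfolding h_def
    by (rule linearI) (simp_all add: inner_add_left scaleR_left_distrib sum.distrib scaleR_sum_right)
  have "h b = v b" if "b \<in> Basis" for b
    unfolding h_def using that by (simp add: inner_Basis if_distrib if_distribR cong: if_cong)
  then have "v ` Basis = h ` Basis" by force
  then have "span (v ` Basis) = range h"
    using linear_span_image[OF lin, of Basis] by simp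
  then have "\<exists>c d. e = T (h c) + \<i> *s T (h d)" for e
  proof -
    have "e \<in> {u + \<i> *s w | u w. u \<in> T ` range h \<and> w \<in> T ` range h}"
      using span \<open>span (v ` Basis) = range h\<close> by simp
    then show ?thesis by blast
  qed
  then have "\<forall>e. \<exists>cd. T (h (fst cd)) + \<i> *s T (h (snd cd)) = e" by (metis fst_conv snd_conv)
  from choice[OF this] obtain cd where cd_ex: "\<forall>e. T (h (fst (cd e))) + \<i> *s T (h (snd (cd e))) = e" ..
  define c d where "c = fst \<circ> cd" and "d = snd \<circ> cd"
  have cd: "T (h (c e)) + \<i> *s T (h (d e)) = e" for e
    using cd_ex unfolding c_def d_def by simp
  define B where "B = 1 + (\<Sum>j\<in>(Basis :: (complex ^ 'n) set). norm (c j) + norm (d j))"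
  have "1 \<le> B" unfolding B_def by (simp add: sum_nonneg)
  show thesis
  proof
    show "1 \<le> B" by fact
    fix e :: "complex ^ 'n"
    define c' d' where "c' = (\<Sum>j\<in>Basis. (e \<bullet> j) *\<^sub>R c j)" and "d' = (\<Sum>j\<in>Basis. (e \<bullet> j) *\<^sub>R d j)"
    define \<eta> where "\<eta> b = (if b \<in> Basis then Complex (c' \<bullet> b) (d' \<bullet> b) else 0)" for b
    have "cmod (\<eta> b) \<le> B * norm e" for b
    proof (cases "b \<in> Basis")
      case True
      have "norm c' + norm d' \<le> (\<Sum>j\<in>(Basis :: (complex ^ 'n) set). norm e * norm (c j)) +
          (\<Sum>j\<in>(Basis :: (complex ^ 'n) set). norm e * norm (d j))"
        unfolding c'_def d'_def
        by (intro add_mono sum_norm_le) (auto intro!: mult_right_mono simp: Basis_le_norm)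
      also have "\<dots> = norm e * (B - 1)"
        unfolding B_def by (simp add: sum.distrib sum_distrib_left distrib_left)
      also have "\<dots> \<le> B * norm e" by (simp add: algebra_simps)
      finally have "norm c' + norm d' \<le> B * norm e" .
      moreover have "cmod (\<eta> b) \<le> \<bar>c' \<bullet> b\<bar> + \<bar>d' \<bullet> b\<bar>"
        using True cmod_le[of "\<eta> b"] unfolding \<eta>_def by simp
      ultimately show ?thesis using Basis_le_norm[OF True, of c'] Basis_le_norm[OF True, of d'] by linarith
    next
      case False
      then show ?thesis using \<open>1 \<le> B\<close> unfolding \<eta>_def by simp
    qed
    moreover have "T (h c') + \<i> *s T (h d') = e"
    proof -
      interpret Th: linear "\<lambda>x. T (h x)" using linear_compose[OF lin T] by (simp add: o_def)
      have i_sum: "\<i> *s (\<Sum>j\<in>Basis. (e \<bullet> j) *\<^sub>R f j) = (\<Sum>j\<in>Basis. (e \<bullet> j) *\<^sub>R (\<i> *s f j))" for f :: "complex ^ 'n \<Rightarrow> complex ^ 'n"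
        by (simp add: vec_eq_iff sum_distrib_left mult_ac)
      have "T (h c') + \<i> *s T (h d') = (\<Sum>j\<in>Basis. (e \<bullet> j) *\<^sub>R (T (h (c j)) + \<i> *s T (h (d j))))"
        unfolding c'_def d'_def Th.sum Th.scale i_sum by (simp add: scaleR_right_distrib sum.distrib)
      also have "\<dots> = (\<Sum>j\<in>Basis. (e \<bullet> j) *\<^sub>R j)" by (simp add: cd)
      finally show ?thesis by (simp add: euclidean_representation)
    qed
    ultimately show "\<exists>\<eta>. (\<forall>b. cmod (\<eta> b) \<le> B * norm e) \<and>
      T (\<Sum>b\<in>Basis. Re (\<eta> b) *\<^sub>R v b) + \<i> *s T (\<Sum>b\<in>Basis. Im (\<eta> b) *\<^sub>R v b) = e"
      unfolding h_def by (intro exI[of _ \<eta>]) (simp add: \<eta>_def)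
  qed
qed

lemma Ck_on_3_facts:
  assumes "Ck_on 3 f S"
  shows "\<And>x. x \<in> S \<Longrightarrow> f differentiable (at x)"
    "\<And>x v. x \<in> S \<Longrightarrow> dderiv f v differentiable (at x)"
    "\<And>x v w. x \<in> S \<Longrightarrow> dderiv (dderiv f v) w differentiable (at x)"
    "\<And>v w u. continuous_on S (dderiv (dderiv (dderiv f v) w) u)"
    "\<And>v w. continuous_on S (dderiv (dderiv f v) w)"
    "\<And>v. continuous_on S (dderiv f v)"
    "continuous_on S f"
proof -
  have 3: "Ck_on (Suc (Suc (Suc 0))) f S" using assms by (simp only: numeral_3_eq_3)
  have D1: "f differentiable (at x)" if "x \<in> S" for x
    using 3 that unfolding Ck_on_Suc_iff[of "Suc (Suc 0)"] by blast
  have 2: "Ck_on (Suc (Suc 0)) (dderiv f v) S" for v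
    using 3 unfolding Ck_on_Suc_iff[of "Suc (Suc 0)"] by blast
  have D2: "dderiv f v differentiable (at x)" if "x \<in> S" for x v
    using 2 that unfolding Ck_on_Suc_iff[of "Suc 0"] by blast
  have 1: "Ck_on (Suc 0) (dderiv (dderiv f v) w) S" for v w
    using 2 unfolding Ck_on_Suc_iff[of "Suc 0"] by blast
  have D3: "dderiv (dderiv f v) w differentiable (at x)" if "x \<in> S" for x v w
    using 1 that unfolding Ck_on_Suc_iff[of 0] by blast
  have 0: "Ck_on 0 (dderiv (dderiv (dderiv f v) w) u) S" for v w u
    using 1 unfolding Ck_on_Suc_iff[of 0] by blast
  show "\<And>x. x \<in> S \<Longrightarrow> f differentiable (at x)"
    "\<And>x v. x \<in> S \<Longrightarrow> dderiv f v differentiable (at x)"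
    "\<And>x v w. x \<in> S \<Longrightarrow> dderiv (dderiv f v) w differentiable (at x)"
    by (fact D1 D2 D3)+
  show "\<And>v w u. continuous_on S (dderiv (dderiv (dderiv f v) w) u)"
    "\<And>v w. continuous_on S (dderiv (dderiv f v) w)"
    "\<And>v. continuous_on S (dderiv f v)" "continuous_on S f"
    by (rule Ck_on_imp_continuous_on[OF 0] Ck_on_imp_continuous_on[OF 1]
        Ck_on_imp_continuous_on[OF 2] Ck_on_imp_continuous_on[OF 3])+
qed

lemma C3_bounds_on_compact:
  fixes f :: "'a::euclidean_space \<Rightarrow> 'b::real_normed_vector"
  assumes f: "Ck_on 3 f S" and U: "compact U" "U \<subseteq> S"
  obtains H where "1 \<le> H"
    "\<And>y i. y \<in> U \<Longrightarrow> i \<in> Basis \<Longrightarrow> norm (dderiv f i y) \<le> H"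
    "\<And>y i j. y \<in> U \<Longrightarrow> i \<in> Basis \<Longrightarrow> j \<in> Basis \<Longrightarrow> norm (dderiv (dderiv f i) j y) \<le> H"
    "\<And>y i j l. y \<in> U \<Longrightarrow> i \<in> Basis \<Longrightarrow> j \<in> Basis \<Longrightarrow> l \<in> Basis \<Longrightarrow>
      norm (dderiv (dderiv (dderiv f i) j) l y) \<le> H"
proof -
  have bdd: "bounded (g ` U)" if "continuous_on S g" for g :: "'a \<Rightarrow> 'b"
    by (intro compact_imp_bounded compact_continuous_image continuous_on_subset[OF that] U)
  define X where "X = (\<Union>i\<in>(Basis::'a set). dderiv f i ` U \<union> (\<Union>j\<in>(Basis::'a set). dderiv (dderiv f i) j ` U \<union>
      (\<Union>l\<in>(Basis::'a set). dderiv (dderiv (dderiv f i) j) l ` U)))"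
  have "bounded X" unfolding X_def
    by (intro bounded_UN finite_Basis ballI iffD2[OF bounded_Un] conjI bdd Ck_on_3_facts[OF f])
  then obtain H where H: "\<forall>x\<in>X. norm x \<le> H" by (auto simp: bounded_iff)
  show thesis
  proof (rule that[of "max 1 H"])
    show "norm (dderiv f i y) \<le> max 1 H" if "y \<in> U" "i \<in> Basis" for y i
      by (rule order_trans[OF _ max.cobounded2], rule H[rule_format], unfold X_def,
          rule UN_I[OF that(2)], rule UnI1, rule imageI, rule that(1))
    show "norm (dderiv (dderiv f i) j y) \<le> max 1 H" if "y \<in> U" "i \<in> Basis" "j \<in> Basis" for y i j
      by (rule order_trans[OF _ max.cobounded2], rule H[rule_format], unfold X_def,
          rule UN_I[OF that(2)], rule UnI2, rule UN_I[OF that(3)], rule UnI1, rule imageI, rule that(1))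
    show "norm (dderiv (dderiv (dderiv f i) j) l y) \<le> max 1 H"
      if "y \<in> U" "i \<in> Basis" "j \<in> Basis" "l \<in> Basis" for y i j l
      by (rule order_trans[OF _ max.cobounded2], rule H[rule_format], unfold X_def,
          rule UN_I[OF that(2)], rule UnI2, rule UN_I[OF that(3)], rule UnI2, rule UN_I[OF that(4)], rule imageI, rule that(1))
  qed simp
qed

lemma jet1_close:
  fixes f :: "'a::euclidean_space \<Rightarrow> 'b::real_normed_vector"
  assumes "open S" "q \<in> S" "\<And>i. continuous_on S (dderiv f i)" "0 < \<kappa>"
  obtains \<rho> where "0 < \<rho>" "\<And>y w. dist y q \<le> \<rho> \<Longrightarrow> norm (jet1 f y w - jet1 f q w) \<le> \<kappa> * norm w"
proof -
  define n where "n = real DIM('a)"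
  have n: "0 < n" unfolding n_def using DIM_positive[where 'a = 'a] by simp
  have "\<forall>\<^sub>F y in at q. norm (dderiv f i y - dderiv f i q) < \<kappa> / n" for i
  proof -
    have "isCont (dderiv f i) q" using assms by (simp add: continuous_on_eq_continuous_at)
    then have "(dderiv f i \<longlongrightarrow> dderiv f i q) (at q)" by (simp add: isCont_def)
    from tendstoD[OF this, of "\<kappa> / n"] show ?thesis using \<open>0 < \<kappa>\<close> n by (simp add: dist_norm)
  qed
  then have "\<forall>\<^sub>F y in at q. \<forall>i\<in>(Basis::'a set). norm (dderiv f i y - dderiv f i q) < \<kappa> / n"
    by (simp add: eventually_ball_finite_distrib)
  then obtain \<rho> where \<rho>: "0 < \<rho>" "\<And>y i. y \<noteq> q \<Longrightarrow> dist y q < \<rho> \<Longrightarrow> i \<in> Basis \<Longrightarrow>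
      norm (dderiv f i y - dderiv f i q) < \<kappa> / n"
    unfolding eventually_at by auto
  show thesis
  proof
    show "0 < \<rho> / 2" using \<rho> by simp
    fix y w assume y: "dist y q \<le> \<rho> / 2"
    have "norm (dderiv f i y - dderiv f i q) \<le> \<kappa> / n" if "i \<in> Basis" for i
    proof (cases "y = q")
      case True
      then show ?thesis using \<open>0 < \<kappa>\<close> n by simp
    next
      case False
      then show ?thesis using \<rho>(2)[OF False _ that] y \<rho>(1) by (intro less_imp_le) simp
    qed
    then have "norm (\<Sum>i\<in>Basis. (w \<bullet> i) *\<^sub>R (dderiv f i y - dderiv f i q)) \<le> n * norm w * (\<kappa> / n)"
      unfolding n_def by (rule norm_basis_sum_le)
    then show "norm (jet1 f y w - jet1 f q w) \<le> \<kappa> * norm w"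
      unfolding jet1_def using n by (simp add: scaleR_right_diff_distrib sum_subtractf mult_ac)
  qed
qed

lemma linear_jet1: "linear (jet1 f y)"
  by (rule linearI) (simp_all add: jet1_add jet_scale)

text \<open>The mean value inequality for \<open>f\<close> minus its differential at the centre.\<close>

lemma linearization_error:
  fixes f :: "'a::euclidean_space \<Rightarrow> 'b::real_normed_vector"
  assumes "\<And>y. y \<in> cball q \<rho> \<Longrightarrow> f differentiable (at y)"
    and "\<And>y w. y \<in> cball q \<rho> \<Longrightarrow> norm (jet1 f y w - jet1 f q w) \<le> \<kappa> * norm w"
    and "y \<in> cball q \<rho>" "y' \<in> cball q \<rho>"
  shows "norm (f y - f y' - jet1 f q (y - y')) \<le> \<kappa> * norm (y - y')"
proof -
  define g where "g y = f y - jet1 f q y" for y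
  have "norm (g y - g y') \<le> \<kappa> * norm (y - y')"
  proof (rule differentiable_bound[where S = "cball q \<rho>" and f' = "\<lambda>y h. jet1 f y h - jet1 f q h"])
    fix x assume x: "x \<in> cball q \<rho>"
    have "jet1 f x = (\<lambda>v. dderiv f v x)" by (intro ext jet1_eq_dderiv assms(1) x)
    then have "(f has_derivative jet1 f x) (at x)"
      using has_derivative_dderiv[OF assms(1)[OF x]] by simp
    moreover have "(jet1 f q has_derivative jet1 f q) (at x)"
      by (intro linear_imp_has_derivative linear_jet1)
    ultimately show "(g has_derivative (\<lambda>h. jet1 f x h - jet1 f q h)) (at x within cball q \<rho>)"
      unfolding g_def[abs_def] by (rule has_derivative_at_withinI[OF has_derivative_diff])
    show "onorm (\<lambda>h. jet1 f x h - jet1 f q h) \<le> \<kappa>"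
      by (rule onorm_le) (rule assms(2)[OF x])
  qed (use assms(3,4) in auto)
  then show ?thesis unfolding g_def by (simp add: jet1_diff algebra_simps)
qed

lemma continuous_on_vector_scalar_mult [continuous_intros]:
  fixes g :: "'a::topological_space \<Rightarrow> complex ^ 'n"
  assumes "continuous_on S g"
  shows "continuous_on S (\<lambda>x. c *s g x)"
  unfolding vector_scalar_mult_def
  by (intro continuous_on_vec_lambda continuous_intros assms continuous_on_component)

text \<open>The constants are uniform in \<open>q\<close> near \<open>q0\<close> and in \<open>v\<close> near \<open>v0\<close>, which is needed because the singular
  points near a given one carry different cones. Only the last condition of \<^const>\<open>disc_system\<close> needs
  genericity. Expand \<open>e\<close> in complex coordinates \<open>\<eta>\<close> with respect to the \<open>v0 b\<close> and shift the parameters by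
  \<open>\<eta>\<close>; to first order this moves the point by exactly \<open>e\<close>, and the remaining errors come from replacing
  differentials at nearby points and \<open>v\<close> by \<open>v0\<close>, and from the second-order term.\<close>

lemma disc_system_of_power_map:
  fixes f :: "'a::euclidean_space \<Rightarrow> complex ^ 'n" and v0 :: "'b::euclidean_space \<Rightarrow> 'a"
  assumes k: "k = 1 \<or> k = 2" and f: "Ck_on 3 f S" and "open S" "q0 \<in> S"
    and span: "{u + \<i> *s w | u w. u \<in> jet1 f q0 ` span (v0 ` Basis) \<and> w \<in> jet1 f q0 ` span (v0 ` Basis)} = UNIV"
  obtains \<rho> C r where "0 < \<rho>" "1 \<le> C" "0 < r" "r \<le> 1"
    "\<And>K q v. \<lbrakk>dist q q0 < \<rho>; \<And>b. b \<in> Basis \<Longrightarrow> norm (v b - v0 b) < \<rho>;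
      \<And>t. norm t \<le> 1 \<Longrightarrow> power_map k q v t \<in> S \<Longrightarrow> f (power_map k q v t) \<in> K\<rbrakk> \<Longrightarrow>
      disc_system k C r K (f q)
        (\<lambda>t s. quasi_extension f (power_map k q v t) (power_map1 k v t s) (power_map2 k v s))"
proof -
  define T where "T = jet1 f q0"
  have linT: "linear T" unfolding T_def by (rule linear_jet1)
  note D = Ck_on_3_facts[OF f]
  define n where "n = real DIM('a)"
  define n' where "n' = real DIM('b)"
  have n: "1 \<le> n" "1 \<le> n'"
    unfolding n_def n'_def using DIM_positive[where 'a = 'a] DIM_positive[where 'a = 'b]
    by (auto simp: Suc_le_eq)
  obtain \<rho>0 where \<rho>0: "0 < \<rho>0" "cball q0 \<rho>0 \<subseteq> S"
    using \<open>open S\<close> \<open>q0 \<in> S\<close> open_contains_cball by blast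
  obtain H where H: "1 \<le> H"
    and H1: "\<And>y i. y \<in> cball q0 \<rho>0 \<Longrightarrow> i \<in> Basis \<Longrightarrow> norm (dderiv f i y) \<le> H"
    and H2: "\<And>y i j. y \<in> cball q0 \<rho>0 \<Longrightarrow> i \<in> Basis \<Longrightarrow> j \<in> Basis \<Longrightarrow> norm (dderiv (dderiv f i) j y) \<le> H"
    and H3: "\<And>y i j l. y \<in> cball q0 \<rho>0 \<Longrightarrow> i \<in> Basis \<Longrightarrow> j \<in> Basis \<Longrightarrow> l \<in> Basis \<Longrightarrow>
      norm (dderiv (dderiv (dderiv f i) j) l y) \<le> H"
    by (rule C3_bounds_on_compact[OF f compact_cball \<rho>0(2)]) blast
  obtain C0 where C0: "1 \<le> C0" and coords: "\<And>e. \<exists>\<eta>. (\<forall>b. cmod (\<eta> b) \<le> C0 * norm e) \<and>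
    T (\<Sum>b\<in>Basis. Re (\<eta> b) *\<^sub>R v0 b) + \<i> *s T (\<Sum>b\<in>Basis. Im (\<eta> b) *\<^sub>R v0 b) = e"
    by (rule complex_span_coordinates[OF linT span[folded T_def]]) blast
  define V where "V = (\<Sum>b\<in>Basis. norm (v0 b)) + n'"
  have V: "1 \<le> V" unfolding V_def using n by (simp add: add_increasing sum_nonneg)
  define L where "L = C0 * V"
  have L: "1 \<le> L" "V \<le> L" "C0 \<le> L"
    unfolding L_def using mult_mono[OF C0 V] mult_right_mono[OF C0, of V] mult_left_mono[OF V, of C0] C0 V by auto
  define \<kappa> where "\<kappa> = 1 / (64 * L)"
  have \<kappa>: "0 < \<kappa>" "\<kappa> \<le> 1" "\<kappa> * L = 1/64" unfolding \<kappa>_def using L by (auto simp: field_simps)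
  obtain \<rho>2 where \<rho>2: "0 < \<rho>2" "\<And>y w. dist y q0 \<le> \<rho>2 \<Longrightarrow> norm (jet1 f y w - jet1 f q0 w) \<le> \<kappa> * norm w"
    by (rule jet1_close[OF \<open>open S\<close> \<open>q0 \<in> S\<close> D(6) \<kappa>(1)]) blast
  define \<rho>1 where "\<rho>1 = min 1 (min \<rho>0 \<rho>2)"
  have \<rho>1: "0 < \<rho>1" "\<rho>1 \<le> 1" "\<rho>1 \<le> \<rho>0" "\<rho>1 \<le> \<rho>2" unfolding \<rho>1_def using \<rho>0 \<rho>2 by auto
  define U where "U = cball q0 \<rho>1"
  have US: "U \<subseteq> S" unfolding U_def using \<rho>0 \<rho>1 by auto
  have U0: "y \<in> cball q0 \<rho>0" if "y \<in> U" for y using that \<rho>1 unfolding U_def by auto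
  have close: "norm (jet1 f y w - T w) \<le> \<kappa> * norm w" if "y \<in> U" for y w
    unfolding T_def using that \<rho>1 by (intro \<rho>2(2)) (auto simp: U_def dist_commute)
  have Tn: "norm (T w) \<le> n * H * norm w" for w
    unfolding T_def n_def by (rule norm_jet1_le[OF H1]) (use \<rho>0 in auto)
  have jn1: "norm (jet1 f y w) \<le> n * H * norm w" if "y \<in> U" for y w
    unfolding n_def by (rule norm_jet1_le[OF H1[OF U0[OF that]]])
  have jn2: "norm (jet2 f y w w) \<le> n\<^sup>2 * H * (norm w)\<^sup>2" if "y \<in> U" for y w
    unfolding n_def power2_eq_square[of "norm w"]
    using norm_jet2_le[OF H2[OF U0[OF that]], of w w] by simp
  have lin_err: "norm (f y - f y' - T (y - y')) \<le> \<kappa> * norm (y - y')" if "y \<in> U" "y' \<in> U" for y y'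
    unfolding T_def using that US unfolding U_def
    by (intro linearization_error[where q = q0 and \<rho> = \<rho>1] D close[unfolded T_def U_def]) auto
  \<comment> \<open>\<open>W\<close> dominates every product of bounds that occurs in the conditions on sizes below.\<close>
  define W where "W = n ^ 3 * H * V ^ 3"
  have W: "n * H \<le> W" "n * H * V \<le> W" "n\<^sup>2 * H * V\<^sup>2 \<le> W" "1 \<le> W"
  proof -
    have np: "n \<le> n ^ 3" "n\<^sup>2 \<le> n ^ 3"
      using power_increasing[of 1 3 n] power_increasing[of 2 3 n] n by simp_all
    have Vp: "1 \<le> V ^ 3" "V \<le> V ^ 3" "V\<^sup>2 \<le> V ^ 3"
      using power_increasing[of 0 3 V] power_increasing[of 1 3 V] power_increasing[of 2 3 V] V by simp_all
    have "n * H * 1 \<le> W"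
      unfolding W_def using np Vp n H V by (intro mult_mono mult_right_mono) auto
    then show "n * H \<le> W" by simp
    show "n * H * V \<le> W" "n\<^sup>2 * H * V\<^sup>2 \<le> W"
      unfolding W_def using np Vp n H V by (auto intro!: mult_mono)
    have "1 * 1 \<le> n * H" using n H by (intro mult_mono) auto
    then show "1 \<le> W" using \<open>n * H \<le> W\<close> by simp
  qed
  \<comment> \<open>\<open>\<kappa>\<close>, \<open>\<rho>\<close> and \<open>r\<close> are chosen so that the six error terms in the last condition add up to at most
    \<open>|e| / 4\<close>. The coefficient \<open>700\<close> covers \<open>80 * 2 ^ 3\<close> from the disc error, where \<open>2 * V\<close> takes the place
    of \<open>V\<close>.\<close>
  define \<rho> where "\<rho> = min (\<rho>1 / 2) (1 / (32 * n * H * C0 * n'))"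
  define r where "r = min (\<rho>1 / (16 * L)) (1 / (16 * n\<^sup>2 * H * L\<^sup>2))"
  define C where "C = 2 + 700 * W + n' * C0"
  have nH: "0 < n * H * C0 * n'" "0 < n\<^sup>2 * H * L\<^sup>2"
    using n H C0 L by (auto intro!: mult_pos_pos)
  have \<rho>: "0 < \<rho>" "\<rho> \<le> \<rho>1 / 2" "n * H * C0 * n' * \<rho> \<le> 1/32"
  proof -
    have "0 < 1 / (32 * n * H * C0 * n')" using nH by (simp add: mult.assoc)
    then show "0 < \<rho>" "\<rho> \<le> \<rho>1 / 2" unfolding \<rho>_def using \<rho>1 by auto
    have "\<rho> \<le> 1 / (32 * n * H * C0 * n')" unfolding \<rho>_def by simp
    then show "n * H * C0 * n' * \<rho> \<le> 1/32" using nH by (simp add: field_simps)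
  qed
  have r: "0 < r" "16 * L * r \<le> \<rho>1" "n\<^sup>2 * H * L\<^sup>2 * r \<le> 1/16" "r \<le> 1/16"
  proof -
    have "0 < 1 / (16 * n\<^sup>2 * H * L\<^sup>2)" using nH by (simp add: mult.assoc)
    then show "0 < r" unfolding r_def using \<rho>1 L by auto
    have "r \<le> 1 / (16 * n\<^sup>2 * H * L\<^sup>2)" unfolding r_def by simp
    then show "n\<^sup>2 * H * L\<^sup>2 * r \<le> 1/16" using nH by (simp add: field_simps)
    have "r \<le> \<rho>1 / (16 * L)" unfolding r_def by simp
    then show *: "16 * L * r \<le> \<rho>1" using L by (simp add: field_simps)
    have "16 * 1 * r \<le> 16 * L * r" using L \<open>0 < r\<close> by (intro mult_right_mono) auto
    then show "r \<le> 1/16" using * \<rho>1 by simp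
  qed
  have C: "2 + 6 * W \<le> C" "640 * W \<le> C" "n' * C0 \<le> C" "1 \<le> C"
    unfolding C_def using W n C0 by (auto intro!: add_nonneg_nonneg)
  show thesis
  proof
    show "0 < \<rho>" "1 \<le> C" "0 < r" "r \<le> 1" using \<rho> C r by auto
    fix K q and v :: "'b \<Rightarrow> 'a"
    assume q: "dist q q0 < \<rho>" and v: "\<And>b. b \<in> Basis \<Longrightarrow> norm (v b - v0 b) < \<rho>"
      and K: "\<And>t. norm t \<le> 1 \<Longrightarrow> power_map k q v t \<in> S \<Longrightarrow> f (power_map k q v t) \<in> K"
    define Q where "Q t s = quasi_extension f (power_map k q v t) (power_map1 k v t s) (power_map2 k v s)" for t s
    have vV: "(\<Sum>b\<in>Basis. norm (v b)) \<le> V"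
    proof -
      have "norm (v b) \<le> norm (v0 b) + 1" if "b \<in> Basis" for b
        using norm_triangle_sub[of "v b" "v0 b"] v[OF that] \<rho>(2) \<rho>1 by linarith
      then have "(\<Sum>b\<in>Basis. norm (v b)) \<le> (\<Sum>b\<in>(Basis::'b set). norm (v0 b) + 1)" by (rule sum_mono)
      then show ?thesis unfolding V_def n'_def by (simp add: sum.distrib)
    qed
    note line = power_map_line[OF k, of q v] power_map1_line[OF k, of v] power_map2_scale[of k v]
    have map_small: "norm (power_map k q v t - q) \<le> \<rho>1 / 8" if "norm t \<le> 2 * r" for t
    proof -
      have "norm (power_map k q v t - q) \<le> norm t * V"
        using that r by (intro norm_power_map_diff[OF k vV]) auto
      also have "\<dots> \<le> 2 * r * L" using that L V r(1) by (intro mult_mono) auto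
      finally show ?thesis using r(2) by (simp add: mult_ac)
    qed
    have mapU: "power_map k q v t \<in> U" "dist (power_map k q v t) q0 \<le> 5/8 * \<rho>1" if "norm t \<le> 2 * r" for t
    proof -
      show "dist (power_map k q v t) q0 \<le> 5/8 * \<rho>1"
        using map_small[OF that] q \<rho> dist_triangle[of "power_map k q v t" q0 q] by (simp add: dist_norm)
      then show "power_map k q v t \<in> U" unfolding U_def using \<rho>1 by (simp add: dist_commute)
    qed
    have qU: "q \<in> U" unfolding U_def using q \<rho> \<rho>1 by (simp add: dist_commute)
    have n1: "norm (power_map1 k v t s) \<le> 2 * V * norm s" if "norm t \<le> 2 * r" for t s
      using that r by (intro norm_power_map1_le[OF k vV]) auto
    have n2: "norm (power_map2 k v s) \<le> V * (norm s)\<^sup>2" for s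
      by (rule norm_power_map2_le[OF k vV])
    have map_s0: "power_map1 k v t 0 = 0" "power_map2 k v 0 = 0" for t
      unfolding power_map1_def power_map2_def by simp_all
    have Q0: "Q t 0 = f (power_map k q v t)" for t
      unfolding Q_def quasi_extension_def map_s0 jet_zero by simp
    have cont: "continuous_on (cball 0 (2 * r) \<times> cball 0 (2 * r)) (\<lambda>x. Q (fst x) (snd x))"
    proof -
      define X where "X = cball (0::'b) (2 * r) \<times> cball (0::'b) (2 * r)"
      have m: "continuous_on X (\<lambda>x. power_map k q v (fst x))"
        "continuous_on X (\<lambda>x. power_map1 k v (fst x) (snd x))"
        "continuous_on X (\<lambda>x. power_map2 k v (snd x))"
        unfolding power_map_def power_map1_def power_map2_def by (intro continuous_intros)+
      have "(\<lambda>x. power_map k q v (fst x)) ` X \<subseteq> S" using mapU(1) US unfolding X_def by auto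
      note m' = continuous_on_compose2[OF _ m(1) this]
      show ?thesis
        unfolding Q_def quasi_extension_def jet1_def jet2_def X_def[symmetric]
        by (intro continuous_intros m m' D)
    qed
    have bdd: "dist (Q t s) (f q) \<le> C" if t: "norm t \<le> 2 * r" and s: "norm s \<le> 2 * r" for t s
    proof -
      define a b c where "a = power_map k q v t" and "b = power_map1 k v t s" and "c = power_map2 k v s"
      have aU: "a \<in> U" unfolding a_def by (rule mapU[OF t])
      have s1: "norm s \<le> 1" using s r by simp
      have "norm b \<le> 2 * V * norm s" unfolding b_def by (rule n1[OF t])
      also have "\<dots> \<le> 2 * V * 1" using s1 V by (intro mult_left_mono) auto
      finally have b: "norm b \<le> 2 * V" by simp
      have "norm c \<le> V * (norm s)\<^sup>2" unfolding c_def by (rule n2)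
      also have "\<dots> \<le> V * 1" using s1 V by (intro mult_left_mono power_le_one) auto
      finally have c: "norm c \<le> V" by simp
      have aq: "norm (a - q) \<le> 1" using map_small[OF t] \<rho>1 unfolding a_def by simp
      have "norm (f a - f q) \<le> norm (f a - f q - T (a - q)) + norm (T (a - q))"
        using norm_triangle_sub[of "f a - f q" "T (a - q)"] by simp
      also have "\<dots> \<le> \<kappa> * norm (a - q) + n * H * norm (a - q)"
        by (intro add_mono lin_err aU qU Tn)
      also have "\<dots> \<le> 1 * 1 + n * H * 1"
        using \<kappa> aq n H by (intro add_mono mult_mono) auto
      finally have 1: "norm (f a - f q) \<le> 1 + W" using W by simp
      have "norm (jet1 f a b) \<le> n * H * norm b" by (rule jn1[OF aU])
      also have "\<dots> \<le> n * H * (2 * V)" using b n H by (intro mult_left_mono) auto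
      finally have 2: "norm (\<i> *s jet1 f a b) \<le> 2 * W" using W unfolding norm_vector_scalar_mult by simp
      have "norm (jet1 f a c) \<le> n * H * norm c" by (rule jn1[OF aU])
      also have "\<dots> \<le> n * H * V" using c n H by (intro mult_left_mono) auto
      finally have 3: "norm (jet1 f a c) \<le> W" using W by simp
      have "norm (jet2 f a b b) \<le> n\<^sup>2 * H * (norm b)\<^sup>2" by (rule jn2[OF aU])
      also have "\<dots> \<le> n\<^sup>2 * H * (2 * V)\<^sup>2" using b n H by (intro mult_left_mono power_mono) auto
      finally have 4: "norm ((1/2) *\<^sub>R jet2 f a b b) \<le> 2 * W" using W by (simp add: power_mult_distrib)
      have "Q t s - f q = (f a - f q) + \<i> *s jet1 f a b - (jet1 f a c + (1/2) *\<^sub>R jet2 f a b b)"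
        unfolding Q_def quasi_extension_def a_def b_def c_def by simp
      also have "norm \<dots> \<le> ((1 + W) + 2 * W) + (W + 2 * W)"
        by (intro norm_triangle_le_diff norm_triangle_le add_mono 1 2 3 4)
      finally show ?thesis using C by (simp add: dist_norm)
    qed
    have disc: "\<exists>A B. norm A \<le> C * norm s \<and> norm B \<le> C * norm s \<and>
        Q t s = Q t 0 + \<i> *s A + \<i>\<^sup>2 *s B \<and>
        (\<forall>\<zeta>. \<bar>Re \<zeta>\<bar> \<le> 1/2 \<longrightarrow> \<bar>Im \<zeta> - 1\<bar> \<le> 1/2 \<longrightarrow>
           norm (Q t 0 + \<zeta> *s A + \<zeta>\<^sup>2 *s B - Q (t + Re \<zeta> *\<^sub>R s) (Im \<zeta> *\<^sub>R s)) \<le> C * norm s ^ 3)"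
      if t: "norm t \<le> r" and s: "norm s \<le> r" for t s
    proof -
      define a b c where "a = power_map k q v t" and "b = power_map1 k v t s" and "c = power_map2 k v s"
      have t2: "norm t \<le> 2 * r" using t r by simp
      have aU: "a \<in> U" unfolding a_def by (rule mapU[OF t2])
      have s1: "norm s \<le> 1" using s r by simp
      have b: "norm b \<le> 2 * V * norm s" unfolding b_def by (rule n1[OF t2])
      have c: "norm c \<le> V * (norm s)\<^sup>2" unfolding c_def by (rule n2)
      have s2: "(norm s)\<^sup>2 \<le> norm s" using s1 mult_left_mono[of "norm s" 1 "norm s"] by (simp add: power2_eq_square)
      define A where "A = jet1 f a b"
      define B where "B = jet1 f a c + (1/2) *\<^sub>R jet2 f a b b"
      have "norm A \<le> n * H * norm b" unfolding A_def by (rule jn1[OF aU])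
      also have "\<dots> \<le> n * H * (2 * V * norm s)" using b n H by (intro mult_left_mono) auto
      also have "\<dots> = 2 * (n * H * V) * norm s" by simp
      also have "\<dots> \<le> C * norm s" using W C by (intro mult_right_mono) auto
      finally have A: "norm A \<le> C * norm s" .
      have "norm (jet1 f a c) \<le> n * H * norm c" by (rule jn1[OF aU])
      also have "\<dots> \<le> n * H * (V * norm s)"
        using order_trans[OF c mult_left_mono[OF s2]] V n H by (intro mult_left_mono) auto
      also have "\<dots> = (n * H * V) * norm s" by simp
      also have "\<dots> \<le> W * norm s" using W by (intro mult_right_mono) auto
      finally have B1: "norm (jet1 f a c) \<le> W * norm s" .
      have "norm (jet2 f a b b) \<le> n\<^sup>2 * H * (norm b)\<^sup>2" by (rule jn2[OF aU])
      also have "\<dots> \<le> n\<^sup>2 * H * (2 * V * norm s)\<^sup>2" using b n H by (intro mult_left_mono power_mono) auto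
      also have "\<dots> = 4 * (n\<^sup>2 * H * V\<^sup>2) * (norm s)\<^sup>2" by (simp add: power_mult_distrib)
      also have "\<dots> \<le> 4 * W * norm s" using W s2 by (intro mult_mono[OF mult_left_mono]) auto
      finally have "norm ((1/2) *\<^sub>R jet2 f a b b) \<le> 2 * W * norm s" by simp
      then have "norm B \<le> W * norm s + 2 * W * norm s"
        unfolding B_def by (intro norm_triangle_le add_mono B1)
      also have "\<dots> \<le> C * norm s"
        using mult_right_mono[of "3 * W" C "norm s"] W C by (simp add: algebra_simps)
      finally have B: "norm B \<le> C * norm s" .
      have Qts: "Q t s = Q t 0 + \<i> *s A + \<i>\<^sup>2 *s B"
        unfolding Q0 unfolding Q_def quasi_extension_def A_def B_def a_def b_def c_def
        by (simp add: vec_eq_iff)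
      have err: "norm (Q t 0 + \<zeta> *s A + \<zeta>\<^sup>2 *s B - Q (t + Re \<zeta> *\<^sub>R s) (Im \<zeta> *\<^sub>R s)) \<le> C * norm s ^ 3"
        if \<zeta>: "\<bar>Re \<zeta>\<bar> \<le> 1/2" "\<bar>Im \<zeta> - 1\<bar> \<le> 1/2" for \<zeta>
      proof -
        have inU: "a + x *\<^sub>R b + x\<^sup>2 *\<^sub>R c \<in> U" if "\<bar>x\<bar> \<le> 1/2" for x
        proof -
          have "norm (x *\<^sub>R s) \<le> 1 * r" unfolding norm_scaleR using that s r by (intro mult_mono) auto
          then have "norm (t + x *\<^sub>R s) \<le> 2 * r" using t by (intro norm_triangle_le) simp
          from mapU(1)[OF this] show ?thesis unfolding a_def b_def c_def by (simp only: line)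
        qed
        have "norm (f a + \<zeta> *s A + \<zeta>\<^sup>2 *s B
          - quasi_extension f (a + Re \<zeta> *\<^sub>R b + (Re \<zeta>)\<^sup>2 *\<^sub>R c)
              (Im \<zeta> *\<^sub>R (b + (2 * Re \<zeta>) *\<^sub>R c)) ((Im \<zeta>)\<^sup>2 *\<^sub>R c))
          \<le> 80 * DIM('a) ^ 3 * H * (2 * V) ^ 3 * norm s ^ 3"
          unfolding A_def B_def
        proof (rule quasi_extension_disc_error[where U = U])
          show "norm b \<le> 2 * V * norm s" by (rule b)
          have "V * (norm s)\<^sup>2 \<le> 2 * V * (norm s)\<^sup>2" using V by (intro mult_right_mono) auto
          then show "norm c \<le> 2 * V * (norm s)\<^sup>2" using c by linarith
        qed (use D US H2 H3 U0 inU \<zeta> s1 V in auto)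
        also have "\<dots> = 640 * W * norm s ^ 3"
          unfolding W_def n_def by (simp add: power_mult_distrib)
        also have "\<dots> \<le> C * norm s ^ 3" using C by (intro mult_right_mono) auto
        also have "quasi_extension f (a + Re \<zeta> *\<^sub>R b + (Re \<zeta>)\<^sup>2 *\<^sub>R c)
              (Im \<zeta> *\<^sub>R (b + (2 * Re \<zeta>) *\<^sub>R c)) ((Im \<zeta>)\<^sup>2 *\<^sub>R c) = Q (t + Re \<zeta> *\<^sub>R s) (Im \<zeta> *\<^sub>R s)"
          unfolding Q_def line a_def b_def c_def ..
        finally show ?thesis unfolding Q0 a_def .
      qed
      show ?thesis using A B Qts err by blast
    qed
    have improve: "\<exists>t' s'. dist t' t \<le> C * root k (norm e) \<and> norm s' \<le> C * root k (norm e) \<and>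
        norm (Q t 0 + e - Q t' s') \<le> norm e / 4"
      if t: "norm t \<le> r" and e: "norm e \<le> r" for t e
    proof -
      obtain \<eta> where \<eta>: "\<And>b. cmod (\<eta> b) \<le> C0 * norm e"
        and e_eq: "T (\<Sum>b\<in>Basis. Re (\<eta> b) *\<^sub>R v0 b) + \<i> *s T (\<Sum>b\<in>Basis. Im (\<eta> b) *\<^sub>R v0 b) = e"
        using coords[of e] by blast
      define h where "h = C0 * norm e"
      have h: "0 \<le> h" "h \<le> C0 * r" unfolding h_def using C0 e by (auto intro: mult_left_mono)
      define x y where "x = (\<Sum>b\<in>Basis. Re (\<eta> b) *\<^sub>R v b)" and "y = (\<Sum>b\<in>Basis. Im (\<eta> b) *\<^sub>R v b)"
      define x0 y0 where "x0 = (\<Sum>b\<in>Basis. Re (\<eta> b) *\<^sub>R v0 b)" and "y0 = (\<Sum>b\<in>Basis. Im (\<eta> b) *\<^sub>R v0 b)"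
      obtain t' s' where map: "power_map k q v t' = power_map k q v t + x + power_map2 k v s'"
        and map1: "power_map1 k v t' s' = y"
        and near: "norm (t' - t) \<le> n' * root k h" "norm s' \<le> n' * root k h"
        and c_le: "norm (power_map2 k v s') \<le> h * V"
        unfolding x_def y_def n'_def
        by (rule power_map_complex_shift[OF k vV, where \<eta> = \<eta> and h = h and t = t and q = q])
          (use \<eta> in \<open>auto simp: h_def\<close>)
      define a a' c where "a = power_map k q v t" and "a' = power_map k q v t'" and "c = power_map2 k v s'"
      have hV: "h * V = L * norm e" unfolding h_def L_def by simp
      have "\<bar>Re (\<eta> b)\<bar> \<le> h" "\<bar>Im (\<eta> b)\<bar> \<le> h" for b
        using \<eta>[of b] abs_Re_le_cmod[of "\<eta> b"] abs_Im_le_cmod[of "\<eta> b"] unfolding h_def by linarith+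
      note reim = this
      have x: "norm x \<le> L * norm e" and y: "norm y \<le> L * norm e"
        unfolding x_def y_def hV[symmetric] using reim vV h by (auto intro!: norm_sum_scaleR_le)
      have v_diff: "(\<Sum>b\<in>Basis. norm (v b - v0 b)) \<le> n' * \<rho>"
        unfolding n'_def using sum_bounded_above[of Basis "\<lambda>b. norm (v b - v0 b)" \<rho>] v by (simp add: less_imp_le)
      have "x - x0 = (\<Sum>b\<in>Basis. Re (\<eta> b) *\<^sub>R (v b - v0 b))" "y - y0 = (\<Sum>b\<in>Basis. Im (\<eta> b) *\<^sub>R (v b - v0 b))"
        unfolding x_def y_def x0_def y0_def by (simp_all add: scaleR_right_diff_distrib sum_subtractf)
      then have xy0: "norm (x - x0) \<le> h * (n' * \<rho>)" "norm (y - y0) \<le> h * (n' * \<rho>)"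
        using reim v_diff h by (auto intro!: norm_sum_scaleR_le)
      have c: "norm c \<le> L * norm e" using c_le unfolding c_def hV .
      have a'_eq: "a' = a + (x + c)" unfolding a_def a'_def c_def map by simp
      have xc: "norm (x + c) \<le> 2 * (L * norm e)" using norm_triangle_ineq[of x c] x c by linarith
      have aU: "a \<in> U" and a_near: "dist a q0 \<le> 5/8 * \<rho>1"
        unfolding a_def using mapU[of t] t r by auto
      have "L * norm e \<le> L * r" using e L by (intro mult_left_mono) auto
      then have "L * norm e \<le> \<rho>1 / 16" using r(2) by simp
      then have a'U: "a' \<in> U"
        unfolding U_def a'_eq using a_near xc norm_triangle_ineq[of "a - q0" "x + c"] \<rho>1
        by (simp add: dist_norm norm_minus_commute algebra_simps)
      define e1 where "e1 = f a' - f a - T (a' - a)"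
      have e1: "norm e1 \<le> norm e / 32"
      proof -
        have "norm e1 \<le> \<kappa> * norm (x + c)" unfolding e1_def using lin_err[OF a'U aU] by (simp add: a'_eq)
        also have "\<dots> \<le> \<kappa> * (2 * (L * norm e))" using xc \<kappa> by (intro mult_left_mono) auto
        also have "\<dots> = 2 * (\<kappa> * L) * norm e" by simp
        finally show ?thesis unfolding \<kappa>(3) by simp
      qed
      have T_small: "norm (T z) \<le> norm e / 32" if "norm z \<le> h * (n' * \<rho>)" for z
      proof -
        have "norm (T z) \<le> n * H * norm z" by (rule Tn)
        also have "\<dots> \<le> n * H * (h * (n' * \<rho>))" using that n H by (intro mult_left_mono) auto
        also have "\<dots> = (n * H * C0 * n' * \<rho>) * norm e" unfolding h_def by simp
        also have "\<dots> \<le> 1/32 * norm e" using \<rho> by (intro mult_right_mono) auto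
        finally show ?thesis by simp
      qed
      have j_small: "norm (jet1 f a' z - T z) \<le> norm e / 64" if "norm z \<le> L * norm e" for z
      proof -
        have "norm (jet1 f a' z - T z) \<le> \<kappa> * norm z" by (rule close[OF a'U])
        also have "\<dots> \<le> \<kappa> * (L * norm e)" using that \<kappa> by (intro mult_left_mono) auto
        also have "\<dots> = (\<kappa> * L) * norm e" by simp
        finally show ?thesis unfolding \<kappa>(3) by simp
      qed
      have j2_small: "norm ((1/2) *\<^sub>R jet2 f a' y y) \<le> norm e / 32"
      proof -
        have "norm (jet2 f a' y y) \<le> n\<^sup>2 * H * (norm y)\<^sup>2" by (rule jn2[OF a'U])
        also have "\<dots> \<le> n\<^sup>2 * H * (L * norm e)\<^sup>2" using y n H by (intro mult_left_mono power_mono) auto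
        also have "\<dots> = (n\<^sup>2 * H * L\<^sup>2) * (norm e * norm e)" by (simp add: power2_eq_square)
        also have "\<dots> \<le> (n\<^sup>2 * H * L\<^sup>2) * (r * norm e)"
          using e nH by (intro mult_left_mono mult_right_mono) auto
        also have "\<dots> = (n\<^sup>2 * H * L\<^sup>2 * r) * norm e" by simp
        also have "\<dots> \<le> 1/16 * norm e" using r by (intro mult_right_mono) auto
        finally show ?thesis by simp
      qed
      have Qa': "Q t' s' = f a' + \<i> *s jet1 f a' y - (jet1 f a' c + (1/2) *\<^sub>R jet2 f a' y y)"
        unfolding Q_def quasi_extension_def map1 a'_def c_def ..
      have T_add: "T (u + w) = T u + T w" "T (u - w) = T u - T w" for u w
        using linT by (simp_all add: linear_add linear_diff)
      have "Q t' s' - (Q t 0 + e) = e1 + T (x - x0) + \<i> *s (jet1 f a' y - T y) + \<i> *s T (y - y0)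
          - ((jet1 f a' c - T c) + (1/2) *\<^sub>R jet2 f a' y y)"
        unfolding Qa' Q0 a_def[symmetric] e_eq[symmetric] e1_def a'_eq x0_def[symmetric] y0_def[symmetric]
        by (simp add: T_add vector_ssub_ldistrib vector_add_ldistrib algebra_simps)
      also have "norm \<dots> \<le> (((norm e / 32 + norm e / 32) + norm e / 64) + norm e / 32)
          + (norm e / 64 + norm e / 32)"
        by (intro norm_triangle_le_diff norm_triangle_le add_mono e1 T_small j_small j2_small
            x y c xy0 order_refl | simp only: norm_vector_scalar_mult norm_ii mult_1)+
      also have "\<dots> \<le> norm e / 4" by simp
      finally have final: "norm (Q t 0 + e - Q t' s') \<le> norm e / 4" by (simp add: norm_minus_commute)
      have "0 < k" using k by auto
      have "root k h \<le> C0 * root k (norm e)"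
        using k
      proof (rule root_1_or_2)
        assume "root k = sqrt"
        moreover have "sqrt C0 \<le> C0" using C0 by (intro real_le_lsqrt) (auto simp: power2_eq_square)
        ultimately show ?thesis unfolding h_def by (simp add: real_sqrt_mult mult_right_mono)
      qed (simp add: h_def)
      then have "n' * root k h \<le> n' * (C0 * root k (norm e))" using n by (intro mult_left_mono) auto
      also have "\<dots> = (n' * C0) * root k (norm e)" by simp
      also have "\<dots> \<le> C * root k (norm e)" using C \<open>0 < k\<close> by (intro mult_right_mono) auto
      finally have "n' * root k h \<le> C * root k (norm e)" .
      then show ?thesis using near final by (intro exI[of _ t'] exI[of _ s']) (auto simp: dist_norm)
    qed
    have "disc_system k C r K (f q) Q"
      unfolding disc_system_def
    proof (intro conjI ballI allI impI)
      show "Q 0 0 = f q" unfolding Q0 power_map_def using k by auto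
      show "Q t 0 \<in> K" if "t \<in> cball 0 (2 * r)" for t
        unfolding Q0 using that mapU(1)[of t] US r by (intro K) auto
    qed (use cont bdd disc improve in auto)
    then show "disc_system k C r K (f q)
        (\<lambda>t s. quasi_extension f (power_map k q v t) (power_map1 k v t s) (power_map2 k v s))"
      unfolding Q_def .
  qed
qed

section \<open>Charts and tangent spaces\<close>

lemma Ck_on_subset: "Ck_on k f S \<Longrightarrow> T \<subseteq> S \<Longrightarrow> Ck_on k f T"
proof (induction k arbitrary: f)
  case 0
  then show ?case by (auto intro: continuous_on_subset)
next
  case (Suc k)
  then show ?case unfolding Ck_on_Suc_iff by blast
qed

lemma has_derivative_cong_open:
  assumes "open S" "x \<in> S" "\<And>y. y \<in> S \<Longrightarrow> f y = g y" "(f has_derivative D) (at x)"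
  shows "(g has_derivative D) (at x)"
  using assms by (metis has_derivative_transform_within_open)

lemma dderiv_eqI: "(f has_derivative D) (at x) \<Longrightarrow> dderiv f v x = D v"
  unfolding dderiv_def by (metis frechet_derivative_at)

lemma Ck_on_cong_open:
  assumes "open S" "\<And>x. x \<in> S \<Longrightarrow> f x = g x" "Ck_on k f S"
  shows "Ck_on k g S"
  using assms(2,3)
proof (induction k arbitrary: f g)
  case 0
  then show ?case by (metis Ck_on.simps(1) continuous_on_cong)
next
  case (Suc k)
  have d: "(g has_derivative (\<lambda>v. dderiv f v x)) (at x)" if "x \<in> S" for x
  proof (rule has_derivative_cong_open[OF \<open>open S\<close> that Suc.prems(1)])
    show "(f has_derivative (\<lambda>v. dderiv f v x)) (at x)"
      using Suc.prems(2) that unfolding Ck_on_Suc_iff by (blast intro: has_derivative_dderiv)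
  qed
  show ?case
    unfolding Ck_on_Suc_iff
  proof (intro conjI ballI allI)
    show "g differentiable at x" if "x \<in> S" for x using d[OF that] by (auto simp: differentiable_def)
    fix v
    show "Ck_on k (dderiv g v) S"
    proof (rule Suc.IH)
      show "dderiv f v x = dderiv g v x" if "x \<in> S" for x using dderiv_eqI[OF d[OF that], of v] by simp
      show "Ck_on k (dderiv f v) S" using Suc.prems(2) unfolding Ck_on_Suc_iff by blast
    qed
  qed
qed

text \<open>Rescaling a chart in its target, and correspondingly its inverse in its source, keeps it of class
  \<open>C\<close> to the \<open>k\<close>. This is used to restrict a chart to a small ball and blow that ball up to the unit
  ball.\<close>

lemma Ck_on_affine_post:
  assumes "open S" "Ck_on k f S"
  shows "Ck_on k (\<lambda>x. c *\<^sub>R (f x - w)) S"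
  using assms(2)
proof (induction k arbitrary: f w)
  case 0
  then show ?case by (auto intro!: continuous_intros)
next
  case (Suc k)
  have d: "((\<lambda>x. c *\<^sub>R (f x - w)) has_derivative (\<lambda>v. c *\<^sub>R (dderiv f v x - 0))) (at x)" if "x \<in> S" for x
  proof -
    have "(f has_derivative (\<lambda>v. dderiv f v x)) (at x)"
      using Suc.prems that unfolding Ck_on_Suc_iff by (blast intro: has_derivative_dderiv)
    then show ?thesis by (intro has_derivative_scaleR_right has_derivative_diff has_derivative_const)
  qed
  show ?case
    unfolding Ck_on_Suc_iff
  proof (intro conjI ballI allI)
    show "(\<lambda>x. c *\<^sub>R (f x - w)) differentiable at x" if "x \<in> S" for x
      using d[OF that] by (auto simp: differentiable_def)
    fix v
    have "Ck_on k (\<lambda>x. c *\<^sub>R (dderiv f v x - 0)) S"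
      using Suc.prems unfolding Ck_on_Suc_iff by (intro Suc.IH) blast
    then show "Ck_on k (dderiv (\<lambda>x. c *\<^sub>R (f x - w)) v) S"
      by (rule Ck_on_cong_open[OF \<open>open S\<close>, rotated]) (use dderiv_eqI[OF d] in simp)
  qed
qed

lemma Ck_on_affine_pre:
  assumes "open S" "open T" "\<And>x. x \<in> T \<Longrightarrow> w + c *\<^sub>R x \<in> S" "Ck_on k f S"
  shows "Ck_on k (\<lambda>x. f (w + c *\<^sub>R x)) T"
  using assms(4)
proof (induction k arbitrary: f)
  case 0
  then show ?case using assms(3) by (auto intro!: continuous_on_compose2[of S f] continuous_intros)
next
  case (Suc k)
  have d: "((\<lambda>x. f (w + c *\<^sub>R x)) has_derivative (\<lambda>v. c *\<^sub>R (dderiv f v (w + c *\<^sub>R x) - 0))) (at x)"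
    if "x \<in> T" for x
  proof -
    have df: "(f has_derivative (\<lambda>v. dderiv f v (w + c *\<^sub>R x))) (at (w + c *\<^sub>R x))"
      using Suc.prems assms(3)[OF that] unfolding Ck_on_Suc_iff by (blast intro: has_derivative_dderiv)
    have "((\<lambda>x. w + c *\<^sub>R x) has_derivative (\<lambda>v. c *\<^sub>R v)) (at x)"
      by (auto intro!: derivative_eq_intros)
    from has_derivative_compose[OF this df]
    have "((\<lambda>x. f (w + c *\<^sub>R x)) has_derivative (\<lambda>v. dderiv f (c *\<^sub>R v) (w + c *\<^sub>R x))) (at x)" .
    moreover have "dderiv f (c *\<^sub>R v) (w + c *\<^sub>R x) = c *\<^sub>R dderiv f v (w + c *\<^sub>R x)" for v
      by (rule linear_scale[OF has_derivative_linear[OF df]])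
    ultimately show ?thesis by simp
  qed
  show ?case
    unfolding Ck_on_Suc_iff
  proof (intro conjI ballI allI)
    show "(\<lambda>x. f (w + c *\<^sub>R x)) differentiable at x" if "x \<in> T" for x
      using d[OF that] by (auto simp: differentiable_def)
    fix v
    have "Ck_on k (\<lambda>x. dderiv f v (w + c *\<^sub>R x)) T"
      using Suc.prems unfolding Ck_on_Suc_iff by (intro Suc.IH) blast
    then have "Ck_on k (\<lambda>x. c *\<^sub>R (dderiv f v (w + c *\<^sub>R x) - 0)) T"
      by (rule Ck_on_affine_post[OF \<open>open T\<close>])
    then show "Ck_on k (dderiv (\<lambda>x. f (w + c *\<^sub>R x)) v) T"
      by (rule Ck_on_cong_open[OF \<open>open T\<close>, rotated]) (use dderiv_eqI[OF d] in simp)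
  qed
qed

lemma has_vector_derivative_quotient:
  fixes g :: "real \<Rightarrow> 'a::real_normed_vector"
  assumes "(g has_vector_derivative v) (at 0)"
  shows "((\<lambda>t. (g t - g 0) /\<^sub>R t) \<longlongrightarrow> v) (at 0)"
proof -
  have "((\<lambda>t. norm (g t - g 0 - t *\<^sub>R v) / norm t) \<longlongrightarrow> 0) (at 0)"
    using assms unfolding has_vector_derivative_def has_derivative_iff_norm by simp
  moreover have "\<forall>\<^sub>F t in at 0. norm (g t - g 0 - t *\<^sub>R v) / norm t = norm ((g t - g 0) /\<^sub>R t - v)"
  proof (rule eventually_at_filter[THEN iffD2], rule always_eventually, intro allI impI)
    fix t :: real assume "t \<noteq> 0"
    then have "(g t - g 0) /\<^sub>R t - v = (g t - g 0 - t *\<^sub>R v) /\<^sub>R t"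
      by (simp add: scaleR_right_diff_distrib)
    then show "norm (g t - g 0 - t *\<^sub>R v) / norm t = norm ((g t - g 0) /\<^sub>R t - v)"
      by (simp add: divide_inverse mult.commute)
  qed
  ultimately have "((\<lambda>t. norm ((g t - g 0) /\<^sub>R t - v)) \<longlongrightarrow> 0) (at 0)"
    by (rule Lim_transform_eventually)
  then show ?thesis by (simp add: Lim_null[of _ v] tendsto_norm_zero_iff)
qed

lemma has_derivative_jet1: "f differentiable (at x) \<Longrightarrow> (f has_derivative jet1 f x) (at x)"
  for f :: "'c::euclidean_space \<Rightarrow> 'd::real_normed_vector"
proof -
  assume f: "f differentiable (at x)"
  then have "jet1 f x = (\<lambda>v. dderiv f v x)" by (intro ext jet1_eq_dderiv)
  then show ?thesis using has_derivative_dderiv[OF f] by simp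
qed

context
  fixes k :: nat and \<Psi> :: "'a::euclidean_space \<Rightarrow> 'a" and W V :: "'a set"
  assumes diffeo: "Ck_diffeomorphism (Suc k) \<Psi> W V"
begin

lemma diffeo_facts:
  shows "open W" "open V" "Ck_on (Suc k) \<Psi> W" "Ck_on (Suc k) (inv_into W \<Psi>) V"
    "\<And>y. y \<in> V \<Longrightarrow> inv_into W \<Psi> y \<in> W" "\<And>y. y \<in> V \<Longrightarrow> \<Psi> (inv_into W \<Psi> y) = y"
    "\<And>z. z \<in> W \<Longrightarrow> inv_into W \<Psi> (\<Psi> z) = z" "\<And>z. z \<in> W \<Longrightarrow> \<Psi> z \<in> V"
    "\<And>y. y \<in> V \<Longrightarrow> inv_into W \<Psi> differentiable (at y)"
    "\<And>z. z \<in> W \<Longrightarrow> \<Psi> differentiable (at z)"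
    "continuous_on W \<Psi>" "continuous_on V (inv_into W \<Psi>)" "\<And>v. continuous_on V (dderiv (inv_into W \<Psi>) v)"
proof -
  show 1: "open W" "open V" "Ck_on (Suc k) \<Psi> W" "Ck_on (Suc k) (inv_into W \<Psi>) V"
    using diffeo unfolding Ck_diffeomorphism_def by blast+
  have b: "bij_betw \<Psi> W V" using diffeo unfolding Ck_diffeomorphism_def by blast
  then show "\<And>y. y \<in> V \<Longrightarrow> inv_into W \<Psi> y \<in> W" "\<And>y. y \<in> V \<Longrightarrow> \<Psi> (inv_into W \<Psi> y) = y"
    "\<And>z. z \<in> W \<Longrightarrow> inv_into W \<Psi> (\<Psi> z) = z" "\<And>z. z \<in> W \<Longrightarrow> \<Psi> z \<in> V"
    by (auto simp: bij_betw_def inv_into_into f_inv_into_f)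
  show "\<And>y. y \<in> V \<Longrightarrow> inv_into W \<Psi> differentiable (at y)" "\<And>z. z \<in> W \<Longrightarrow> \<Psi> differentiable (at z)"
    using 1 unfolding Ck_on_Suc_iff by blast+
  show "continuous_on W \<Psi>" "continuous_on V (inv_into W \<Psi>)" using 1 Ck_on_imp_continuous_on by blast+
  show "continuous_on V (dderiv (inv_into W \<Psi>) v)" for v
    using 1(4) unfolding Ck_on_Suc_iff by (blast intro: Ck_on_imp_continuous_on)
qed

lemma jet1_inverse:
  assumes y: "y \<in> V"
  shows "jet1 \<Psi> (inv_into W \<Psi> y) (jet1 (inv_into W \<Psi>) y v) = v"
proof -
  define \<Phi> where "\<Phi> = inv_into W \<Psi>"
  have "(\<Phi> has_derivative jet1 \<Phi> y) (at y)"
    unfolding \<Phi>_def using y by (intro has_derivative_jet1 diffeo_facts)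
  moreover have "(\<Psi> has_derivative jet1 \<Psi> (\<Phi> y)) (at (\<Phi> y))"
    unfolding \<Phi>_def using y by (intro has_derivative_jet1 diffeo_facts)
  ultimately have "((\<lambda>x. \<Psi> (\<Phi> x)) has_derivative (\<lambda>v. jet1 \<Psi> (\<Phi> y) (jet1 \<Phi> y v))) (at y)"
    by (rule has_derivative_compose)
  then have "((\<lambda>x. x) has_derivative (\<lambda>v. jet1 \<Psi> (\<Phi> y) (jet1 \<Phi> y v))) (at y)"
    by (rule has_derivative_cong_open[OF diffeo_facts(2) y, rotated]) (simp add: \<Phi>_def diffeo_facts)
  from has_derivative_unique[OF this has_derivative_ident]
  have "(\<lambda>v. jet1 \<Psi> (\<Phi> y) (jet1 \<Phi> y v)) = (\<lambda>v. v)" .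
  then show ?thesis unfolding \<Phi>_def by metis
qed

lemma jet1_inverse':
  assumes y: "y \<in> V"
  shows "jet1 (inv_into W \<Psi>) y (jet1 \<Psi> (inv_into W \<Psi> y) v) = v"
proof -
  have "linear (jet1 (inv_into W \<Psi>) y)" "linear (jet1 \<Psi> (inv_into W \<Psi> y))" by (rule linear_jet1)+
  moreover have "jet1 \<Psi> (inv_into W \<Psi> y) \<circ> jet1 (inv_into W \<Psi>) y = id"
    using jet1_inverse[OF y] by (auto simp: fun_eq_iff)
  ultimately have "jet1 (inv_into W \<Psi>) y \<circ> jet1 \<Psi> (inv_into W \<Psi> y) = id"
    by (simp add: linear_inverse_left)
  then show ?thesis by (metis comp_apply id_apply)
qed

text \<open>Velocities of curves in \<open>K\<close> are read off in the chart: there the difference quotients stay in the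
  closed set \<open>L\<close>. Conversely, straight lines in direction \<open>l \<in> L\<close> are pushed forward to \<open>K\<close>.\<close>

lemma tangent_space_in_chart:
  fixes K L :: "'a set"
  assumes y: "y \<in> V" and "subspace L" and "0 < e" "ball y e \<subseteq> V"
    and flat: "\<Psi> ` (K \<inter> W) \<inter> ball y e = (+) y ` L \<inter> ball y e"
  shows "tangent_space_at K (inv_into W \<Psi> y) = jet1 (inv_into W \<Psi>) y ` L"
proof -
  define \<Phi> where "\<Phi> = inv_into W \<Psi>"
  note facts = diffeo_facts[folded \<Phi>_def]
  show ?thesis
    unfolding \<Phi>_def[symmetric]
  proof (intro equalityI subsetI)
    fix u assume "u \<in> tangent_space_at K (\<Phi> y)"
    then obtain \<gamma> e' where "e' > 0" and \<gamma>K: "\<gamma> ` {- e'<..<e'} \<subseteq> K" and \<gamma>0: "\<gamma> 0 = \<Phi> y"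
      and d\<gamma>: "(\<gamma> has_vector_derivative u) (at (0::real))"
      unfolding tangent_space_at_def by blast
    have "\<Psi> differentiable (at (\<gamma> 0))" unfolding \<gamma>0 using y facts by blast
    from has_vector_derivative_along_curve[OF this d\<gamma>]
    have d: "((\<lambda>t. \<Psi> (\<gamma> t)) has_vector_derivative jet1 \<Psi> (\<Phi> y) u) (at 0)" unfolding \<gamma>0 .
    have \<Psi>\<gamma>0: "\<Psi> (\<gamma> 0) = y" unfolding \<gamma>0 using y facts by blast
    have "isCont \<gamma> 0" using d\<gamma> by (rule has_vector_derivative_continuous)
    then have "\<forall>\<^sub>F t in at 0. \<gamma> t \<in> W"
      using facts(1,5) y \<gamma>0 by (auto simp: isCont_def intro: topological_tendstoD)
    moreover have "isCont (\<lambda>t. \<Psi> (\<gamma> t)) 0" using d by (rule has_vector_derivative_continuous)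
    then have "\<forall>\<^sub>F t in at 0. \<Psi> (\<gamma> t) \<in> ball y e"
      using \<Psi>\<gamma>0 \<open>0 < e\<close> unfolding isCont_def by (intro topological_tendstoD[where S = "ball y e"]) auto
    moreover have "\<forall>\<^sub>F t in at 0. t \<in> {- e'<..<e'}"
      using \<open>e' > 0\<close> by (intro eventually_at_in_open') auto
    ultimately have ev: "\<forall>\<^sub>F t in at 0. (\<Psi> (\<gamma> t) - \<Psi> (\<gamma> 0)) /\<^sub>R t \<in> L"
    proof eventually_elim
      case (elim t)
      then have "\<Psi> (\<gamma> t) \<in> \<Psi> ` (K \<inter> W) \<inter> ball y e" using \<gamma>K by blast
      then obtain l where "l \<in> L" "\<Psi> (\<gamma> t) = y + l" using flat by auto
      then show ?case using \<open>subspace L\<close> \<Psi>\<gamma>0 by (simp add: subspace_scale)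
    qed
    have "((\<lambda>t. (\<Psi> (\<gamma> t) - \<Psi> (\<gamma> 0)) /\<^sub>R t) \<longlongrightarrow> jet1 \<Psi> (\<Phi> y) u) (at 0)"
      by (rule has_vector_derivative_quotient[OF d])
    then have "jet1 \<Psi> (\<Phi> y) u \<in> L"
      using Lim_in_closed_set[OF closed_subspace[OF \<open>subspace L\<close>] ev] by simp
    then show "u \<in> jet1 \<Phi> y ` L" using jet1_inverse'[OF y, of u] unfolding \<Phi>_def by (metis imageI)
  next
    fix u assume "u \<in> jet1 \<Phi> y ` L"
    then obtain l where "l \<in> L" and u: "u = jet1 \<Phi> y l" by blast
    define e' where "e' = e / (norm l + 1)"
    have e': "e' > 0" unfolding e'_def using \<open>0 < e\<close> by (simp add: add_nonneg_pos)
    define \<gamma> where "\<gamma> t = \<Phi> (y + t *\<^sub>R l)" for t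
    have inb: "y + t *\<^sub>R l \<in> ball y e" if "t \<in> {- e'<..<e'}" for t
    proof -
      have "norm (t *\<^sub>R l) \<le> \<bar>t\<bar> * (norm l + 1)" by (simp add: algebra_simps)
      also have "\<dots> < e' * (norm l + 1)" using that by (intro mult_strict_right_mono) (auto simp: add_nonneg_pos)
      also have "\<dots> = e" unfolding e'_def using add_nonneg_pos[of "norm l" 1] by simp
      finally show ?thesis by (simp add: dist_norm)
    qed
    then have inV: "y + t *\<^sub>R l \<in> V" if "t \<in> {- e'<..<e'}" for t using that assms(4) by blast
    have d\<gamma>: "(\<gamma> has_vector_derivative jet1 \<Phi> (y + t *\<^sub>R l) l) (at t)" if "t \<in> {- e'<..<e'}" for t
      unfolding \<gamma>_def
      by (rule has_vector_derivative_along_curve)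
        (use inV[OF that] facts in \<open>auto intro!: derivative_eq_intros\<close>)
    have "Ck_on 1 \<gamma> {- e'<..<e'}"
    proof -
      have fd: "dderiv \<gamma> h t = h *\<^sub>R jet1 \<Phi> (y + t *\<^sub>R l) l" if "t \<in> {- e'<..<e'}" for h t
        using d\<gamma>[OF that] unfolding has_vector_derivative_def by (rule dderiv_eqI)
      have "continuous_on {- e'<..<e'} (\<lambda>t. h *\<^sub>R jet1 \<Phi> (y + t *\<^sub>R l) l)" for h
        unfolding jet1_def using inV
        by (intro continuous_intros continuous_on_compose2[OF facts(13)]) auto
      then have "continuous_on {- e'<..<e'} (dderiv \<gamma> h)" for h
        using fd by (metis (no_types, lifting) continuous_on_cong)
      moreover have "\<gamma> differentiable at t" if "t \<in> {- e'<..<e'}" for t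
        using d\<gamma>[OF that] by (auto simp: differentiable_def has_vector_derivative_def)
      ultimately show ?thesis unfolding One_nat_def Ck_on_Suc_iff by simp
    qed
    moreover have "\<gamma> ` {- e'<..<e'} \<subseteq> K"
    proof clarify
      fix t assume t: "t \<in> {- e'<..<e'}"
      have "y + t *\<^sub>R l \<in> (+) y ` L \<inter> ball y e"
        using inb[OF t] \<open>l \<in> L\<close> \<open>subspace L\<close> by (simp add: subspace_scale)
      then have "y + t *\<^sub>R l \<in> \<Psi> ` (K \<inter> W) \<inter> ball y e" by (simp only: flat)
      then obtain z where "z \<in> K" "z \<in> W" "\<Psi> z = y + t *\<^sub>R l" by auto
      then show "\<gamma> t \<in> K" unfolding \<gamma>_def using facts(7)[of z] by simp
    qed
    moreover have "\<gamma> 0 = \<Phi> y" unfolding \<gamma>_def by simp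
    moreover have "(\<gamma> has_vector_derivative u) (at 0)" using d\<gamma>[of 0] e' unfolding u by simp
    ultimately show "u \<in> tangent_space_at K (\<Phi> y)"
      unfolding tangent_space_at_def using e' by blast
  qed
qed

end

lemma closest_point_subspace_orthogonal:
  fixes E :: "'a::euclidean_space set"
  assumes E: "subspace E" and "u \<in> E"
  shows "(v - closest_point E v) \<bullet> u = 0"
proof -
  have cl: "closed E" "convex E" "E \<noteq> {}"
    using E by (auto simp: closed_subspace subspace_imp_convex dest: subspace_0)
  have c: "closest_point E v \<in> E" by (rule closest_point_in_set[OF cl(1,3)])
  have "(v - closest_point E v) \<bullet> (x - closest_point E v) \<le> 0" if "x \<in> E" for x
    by (rule closest_point_dot[OF cl(2,1) that])
  from this[of "closest_point E v + u"] this[of "closest_point E v - u"] show ?thesis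
    using E c \<open>u \<in> E\<close> by (simp add: subspace_add subspace_diff)
qed

text \<open>Let \<open>a\<close> and \<open>b\<close> be the projections of \<open>v\<close> to \<open>E\<close> and \<open>F\<close>. Then \<open>|a - b|\<^sup>2 = (v - b) \<bullet> a + (v - a) \<bullet> b\<close>, and
  each summand is small because \<open>v - b\<close> is orthogonal to \<open>F\<close> and \<open>a\<close> is close to \<open>F\<close>, and
  symmetrically.\<close>

lemma gap_dist_le:
  fixes E F :: "'a::euclidean_space set"
  assumes E: "subspace E" and F: "subspace F" and "0 \<le> \<eta>"
    and EF: "\<And>u. u \<in> E \<Longrightarrow> \<exists>w\<in>F. norm (u - w) \<le> \<eta> * norm u"
    and FE: "\<And>u. u \<in> F \<Longrightarrow> \<exists>w\<in>E. norm (u - w) \<le> \<eta> * norm u"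
  shows "0 \<le> gap_dist E F \<and> gap_dist E F \<le> sqrt (2 * \<eta>)"
proof -
  have in_set: "closest_point G v \<in> G" if "subspace G" for G :: "'a set" and v
    using that by (intro closest_point_in_set) (auto simp: closed_subspace dest: subspace_0)
  have pyth: "(norm v)\<^sup>2 = (norm (closest_point G v))\<^sup>2 + (norm (v - closest_point G v))\<^sup>2"
    if "subspace G" for G :: "'a set" and v
    using closest_point_subspace_orthogonal[OF that in_set[OF that, of v], of v]
    unfolding power2_norm_eq_inner by (simp add: inner_diff_left inner_diff_right inner_commute)
  have contr: "norm (closest_point G v) \<le> norm v" "norm (v - closest_point G v) \<le> norm v"
    if "subspace G" for G :: "'a set" and v
  proof -
    have "(norm (closest_point G v))\<^sup>2 \<le> (norm v)\<^sup>2" "(norm (v - closest_point G v))\<^sup>2 \<le> (norm v)\<^sup>2"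
      unfolding pyth[OF that, of v] by simp_all
    then show "norm (closest_point G v) \<le> norm v" "norm (v - closest_point G v) \<le> norm v"
      by (auto dest: power2_le_imp_le)
  qed
  have cross: "(v - closest_point G v) \<bullet> a \<le> \<eta> * (norm v)\<^sup>2"
    if G: "subspace G" "norm a \<le> norm v" "\<exists>w\<in>G. norm (a - w) \<le> \<eta> * norm a" for G :: "'a set" and v a
  proof -
    obtain w where "w \<in> G" and w: "norm (a - w) \<le> \<eta> * norm a" using G(3) by blast
    have "(v - closest_point G v) \<bullet> a = (v - closest_point G v) \<bullet> (a - w)"
      using closest_point_subspace_orthogonal[OF G(1) \<open>w \<in> G\<close>, of v] by (simp add: inner_diff_right)
    also have "\<dots> \<le> norm (v - closest_point G v) * norm (a - w)" by (rule norm_cauchy_schwarz)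
    also have "\<dots> \<le> norm v * (\<eta> * norm v)"
      using contr(2)[OF G(1)] order_trans[OF w mult_left_mono[OF G(2) \<open>0 \<le> \<eta>\<close>]]
      by (intro mult_mono) auto
    finally show ?thesis by (simp add: power2_eq_square mult_ac)
  qed
  define g where "g v = closest_point E v - closest_point F v" for v
  have bound: "norm (g v) \<le> sqrt (2 * \<eta>) * norm v" for v
  proof (rule power2_le_imp_le)
    define a b where "a = closest_point E v" and "b = closest_point F v"
    have "(norm (g v))\<^sup>2 = (v - b) \<bullet> a + (v - a) \<bullet> b - ((v - a) \<bullet> a + (v - b) \<bullet> b)"
      unfolding g_def a_def b_def power2_norm_eq_inner
      by (simp add: inner_diff_left inner_diff_right inner_commute)
    also have "\<dots> = (v - b) \<bullet> a + (v - a) \<bullet> b"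
      unfolding a_def b_def
      using closest_point_subspace_orthogonal[OF E in_set[OF E, of v], of v]
        closest_point_subspace_orthogonal[OF F in_set[OF F, of v], of v] by simp
    also have "\<dots> \<le> \<eta> * (norm v)\<^sup>2 + \<eta> * (norm v)\<^sup>2"
      unfolding a_def b_def by (intro add_mono cross E F contr EF FE in_set)
    also have "\<dots> = (sqrt (2 * \<eta>) * norm v)\<^sup>2" using \<open>0 \<le> \<eta>\<close> by (simp add: power_mult_distrib)
    finally show "(norm (g v))\<^sup>2 \<le> (sqrt (2 * \<eta>) * norm v)\<^sup>2" .
    show "0 \<le> sqrt (2 * \<eta>) * norm v" using \<open>0 \<le> \<eta>\<close> by simp
  qed
  have upper: "gap_dist E F \<le> sqrt (2 * \<eta>)"
    unfolding gap_dist_def g_def[symmetric] by (rule onorm_le[OF bound])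
  have "bdd_above (range (\<lambda>x. norm (g x) / norm x))"
  proof (rule bdd_aboveI2)
    show "norm (g x) / norm x \<le> sqrt (2 * \<eta>)" for x
      using bound[of x] \<open>0 \<le> \<eta>\<close> by (cases "x = 0") (simp_all add: divide_le_eq)
  qed
  then have "norm (g 0) / norm (0::'a) \<le> (SUP x. norm (g x) / norm x)" by (rule cSUP_upper[rotated]) simp
  then have "0 \<le> gap_dist E F" unfolding gap_dist_def g_def[symmetric] onorm_def by simp
  with upper show ?thesis by simp
qed

section \<open>Genericity along a polyhedral piece\<close>

text \<open>Continuity of \<open>T \<mapsto> T ` L\<close> at an injective \<open>T\<close>, in the metric of the Grassmannian. Injectivity bounds
  \<open>|v|\<close> by a multiple of \<open>|T v|\<close>, which turns the operator estimate into a relative one on the image.\<close>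

lemma gap_dist_linear_images:
  fixes T :: "'a::euclidean_space \<Rightarrow> 'b::euclidean_space"
  assumes T: "linear T" and inj: "inj_on T L" and L: "subspace L" and "0 < \<epsilon>"
  obtains \<kappa> where "0 < \<kappa>"
    "\<And>T'. \<lbrakk>linear T'; \<And>v. norm (T' v - T v) \<le> \<kappa> * norm v\<rbrakk> \<Longrightarrow>
      0 \<le> gap_dist (T' ` L) (T ` L) \<and> gap_dist (T' ` L) (T ` L) \<le> \<epsilon>"
proof -
  obtain B where B: "0 < B" "\<And>v. v \<in> L \<Longrightarrow> B * norm v \<le> norm (T v)"
    using injective_imp_isometric[OF closed_subspace[OF L] L linear_conv_bounded_linear[THEN iffD1, OF T]]
      linear_injective_0 inj linear_inj_on_iff_eq_0[OF T L] by metis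
  define \<kappa> where "\<kappa> = min (B / 2) (B * \<epsilon>\<^sup>2 / 4)"
  have \<kappa>: "0 < \<kappa>" "\<kappa> \<le> B / 2" "4 * \<kappa> / B \<le> \<epsilon>\<^sup>2"
  proof -
    show "0 < \<kappa>" "\<kappa> \<le> B / 2" unfolding \<kappa>_def using B \<open>0 < \<epsilon>\<close> by auto
    have "\<kappa> \<le> B * \<epsilon>\<^sup>2 / 4" unfolding \<kappa>_def by simp
    then show "4 * \<kappa> / B \<le> \<epsilon>\<^sup>2" using B by (simp add: field_simps)
  qed
  show thesis
  proof
    show "0 < \<kappa>" by (rule \<kappa>)
    fix T' assume T': "linear T'" and close: "\<And>v. norm (T' v - T v) \<le> \<kappa> * norm v"
    define \<eta> where "\<eta> = 2 * \<kappa> / B"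
    have \<eta>: "0 \<le> \<eta>" "\<kappa> = \<eta> * (B / 2)" unfolding \<eta>_def using \<kappa> B by auto
    have near: "\<kappa> * norm v \<le> \<eta> * norm u" if "B / 2 * norm v \<le> norm u" for v :: 'a and u :: 'b
      using mult_left_mono[OF that \<eta>(1)] unfolding \<eta>(2) by simp
    have gap: "0 \<le> gap_dist (T' ` L) (T ` L) \<and> gap_dist (T' ` L) (T ` L) \<le> sqrt (2 * \<eta>)"
    proof (rule gap_dist_le[where \<eta> = \<eta>])
      show "subspace (T' ` L)" "subspace (T ` L)" using T T' L by (simp_all add: linear_subspace_image)
      show "\<exists>w\<in>T ` L. norm (u - w) \<le> \<eta> * norm u" if u: "u \<in> T' ` L" for u
      proof -
        obtain v where "v \<in> L" "u = T' v" using u by blast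
        have "B * norm v \<le> norm (T v)" by (rule B(2)[OF \<open>v \<in> L\<close>])
        also have "\<dots> \<le> norm (T' v) + \<kappa> * norm v"
          using close[of v] norm_triangle_sub[of "T v" "T' v"] by (simp add: norm_minus_commute)
        also have "\<kappa> * norm v \<le> B / 2 * norm v" using \<kappa> by (intro mult_right_mono) auto
        finally have "B / 2 * norm v \<le> norm u" using \<open>u = T' v\<close> by simp
        from order_trans[OF close near[OF this]] show ?thesis
          using \<open>v \<in> L\<close> \<open>u = T' v\<close> by blast
      qed
      show "\<exists>w\<in>T' ` L. norm (u - w) \<le> \<eta> * norm u" if u: "u \<in> T ` L" for u
      proof -
        obtain v where "v \<in> L" "u = T v" using u by blast
        have "B / 2 * norm v \<le> B * norm v" using B by simp
        then have "B / 2 * norm v \<le> norm u" using B(2)[OF \<open>v \<in> L\<close>] \<open>u = T v\<close> by simp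
        from order_trans[OF close near[OF this]] have "norm (u - T' v) \<le> \<eta> * norm u"
          unfolding \<open>u = T v\<close> by (simp add: norm_minus_commute)
        then show ?thesis using \<open>v \<in> L\<close> by blast
      qed
    qed (rule \<eta>)
    have "sqrt (2 * \<eta>) \<le> \<epsilon>"
      using \<kappa>(3) \<open>0 < \<epsilon>\<close> unfolding \<eta>_def by (intro real_le_lsqrt) auto
    with gap show "0 \<le> gap_dist (T' ` L) (T ` L) \<and> gap_dist (T' ` L) (T ` L) \<le> \<epsilon>" by linarith
  qed
qed

text \<open>Finitely many closed sets are treated one after the other: unless \<open>U\<close> lies in \<open>Q\<close>, remove \<open>Q\<close> from
  it.\<close>

lemma openin_subset_or_disjoint_finite:
  assumes "finite \<Q>" "\<And>Q. Q \<in> \<Q> \<Longrightarrow> closed Q" "openin (top_of_set A) U" "U \<noteq> {}"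
  obtains U' where "openin (top_of_set A) U'" "U' \<noteq> {}" "U' \<subseteq> U" "\<And>Q. Q \<in> \<Q> \<Longrightarrow> U' \<subseteq> Q \<or> U' \<inter> Q = {}"
  using assms(1,2)
proof (induction \<Q> arbitrary: thesis rule: finite_induct)
  case empty
  then show ?case using assms(3,4) by blast
next
  case (insert Q \<Q>)
  obtain U' where U': "openin (top_of_set A) U'" "U' \<noteq> {}" "U' \<subseteq> U"
    "\<And>Q. Q \<in> \<Q> \<Longrightarrow> U' \<subseteq> Q \<or> U' \<inter> Q = {}"
    using insert.IH insert.prems(2) by (metis insertCI)
  show ?case
  proof (cases "U' \<subseteq> Q")
    case True
    then show ?thesis using U' insert.prems(1)[of U'] by blast
  next
    case False
    have "openin (top_of_set A) (U' - Q)"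
    proof -
      have "openin (top_of_set A) (A \<inter> - Q)"
        using insert.prems(2)[of Q] by (intro openin_open_Int) (auto simp: open_Compl)
      then have "openin (top_of_set A) (U' \<inter> (A \<inter> - Q))" by (rule openin_Int[OF U'(1)])
      moreover have "U' \<inter> (A \<inter> - Q) = U' - Q" using openin_imp_subset[OF U'(1)] by blast
      ultimately show ?thesis by simp
    qed
    then show ?thesis using False U' by (intro insert.prems(1)[of "U' - Q"]) blast+
  qed
qed

lemma affine_hull_eq_translate_span:
  fixes P :: "'a::euclidean_space set"
  assumes "q \<in> P" "y \<in> affine hull P"
  shows "affine hull P = (+) y ` span ((\<lambda>x. - q + x) ` P)"
proof -
  define L where "L = span ((\<lambda>x. - q + x) ` P)"
  have sub: "subspace L" unfolding L_def by simp
  have "(\<lambda>x. - q + x) ` P = insert 0 ((\<lambda>x. - q + x) ` (P - {q}))" using assms(1) by force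
  then have q: "affine hull P = (+) q ` L"
    unfolding L_def using affine_hull_span2[OF assms(1)] by (simp only: span_insert_0)
  then obtain l where l: "l \<in> L" "y = q + l" using assms(2) by auto
  have "(+) q ` L = (+) y ` L"
  proof (intro equalityI subsetI)
    fix x assume "x \<in> (+) q ` L"
    then obtain l' where "l' \<in> L" "x = q + l'" by auto
    then have "x = y + (l' - l)" "l' - l \<in> L" using l sub by (auto simp: subspace_diff)
    then show "x \<in> (+) y ` L" by blast
  next
    fix x assume "x \<in> (+) y ` L"
    then obtain l' where "l' \<in> L" "x = y + l'" by auto
    then have "x = q + (l + l')" "l + l' \<in> L" using l sub by (auto simp: subspace_add)
    then show "x \<in> (+) q ` L" by blast
  qed
  then show ?thesis using q unfolding L_def by simp
qed

text \<open>A small relatively open part \<open>U\<close> of the relative interior of \<open>P\<close> can be chosen such that each member of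
  the family contains it or is disjoint from it. A member that contains \<open>U\<close> has, because of the equal
  dimensions, the same affine hull as \<open>P\<close>. So near a point of \<open>U\<close> the union is this affine hull.\<close>

lemma flat_points_dense:
  fixes \<P> :: "'a::euclidean_space set set"
  assumes \<P>: "finite \<P>" "\<And>Q. Q \<in> \<P> \<Longrightarrow> polyhedron Q \<and> aff_dim Q = int m"
    and P: "P \<in> \<P>" "q \<in> P" and "0 < \<epsilon>"
  obtains y e where "dist y q < \<epsilon>" "0 < e"
    "\<Union>\<P> \<inter> ball y e = (+) y ` span ((\<lambda>x. - q + x) ` P) \<inter> ball y e"
proof -
  define A where "A = affine hull P"
  have P': "convex P" "closed P" using \<P>(2)[OF P(1)] by (auto simp: polyhedron_imp_convex polyhedron_imp_closed)
  have "openin (top_of_set A) (rel_interior P)" unfolding A_def by (rule openin_rel_interior)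
  then have "openin (top_of_set A) (rel_interior P \<inter> ball q \<epsilon>)" by (rule openin_Int_open) simp
  moreover have "q \<in> closure (rel_interior P)"
    using P(2) convex_closure_rel_interior[OF P'(1)] closure_subset by blast
  then have "rel_interior P \<inter> ball q \<epsilon> \<noteq> {}"
    using \<open>0 < \<epsilon>\<close> by (metis IntI ball_eq_empty closure_approachable dist_commute empty_iff mem_ball)
  ultimately obtain U where U: "openin (top_of_set A) U" "U \<noteq> {}" "U \<subseteq> rel_interior P \<inter> ball q \<epsilon>"
    and split: "\<And>Q. Q \<in> \<P> \<Longrightarrow> U \<subseteq> Q \<or> U \<inter> Q = {}"
    using openin_subset_or_disjoint_finite[of \<P> A "rel_interior P \<inter> ball q \<epsilon>"] \<P>
    by (metis polyhedron_imp_closed)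
  obtain y where y: "y \<in> U" using U(2) by blast
  have UA: "U \<subseteq> A" by (rule openin_imp_subset[OF U(1)])
  have UP: "U \<subseteq> P" using U(3) rel_interior_subset by blast
  have in_A: "Q \<subseteq> A" if Q: "Q \<in> \<P>" "U \<subseteq> Q" for Q
  proof -
    have "affine hull U = A"
      using U(1,2) unfolding A_def by (rule affine_hull_openin)
    then have "A \<subseteq> affine hull Q" using hull_mono[OF Q(2), of affine] by simp
    moreover have "aff_dim A = aff_dim (affine hull Q)"
      using \<P>(2)[OF Q(1)] \<P>(2)[OF P(1)] unfolding A_def by simp
    moreover have "A \<noteq> {}" using UA y by blast
    ultimately have "A = affine hull Q"
      unfolding A_def by (intro affine_dim_equal affine_affine_hull)
    then show ?thesis using hull_subset[of Q affine] by simp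
  qed
  obtain e1 where e1: "0 < e1" "ball y e1 \<inter> A \<subseteq> U"
    using U(1) y unfolding openin_contains_ball by blast
  define \<Q> where "\<Q> = {Q \<in> \<P>. y \<notin> Q}"
  have "closed (\<Union>\<Q>)" unfolding \<Q>_def using \<P> by (intro closed_Union) (auto simp: polyhedron_imp_closed)
  moreover have "y \<notin> \<Union>\<Q>" unfolding \<Q>_def by blast
  ultimately obtain e2 where e2: "0 < e2" "ball y e2 \<inter> \<Union>\<Q> = {}"
    by (metis Compl_iff disjoint_eq_subset_Compl open_Compl open_contains_ball)
  show thesis
  proof
    show "dist y q < \<epsilon>" using y U(3) by (auto simp: dist_commute)
    show "0 < min e1 e2" using e1 e2 by simp
    have "\<Union>\<P> \<inter> ball y (min e1 e2) = A \<inter> ball y (min e1 e2)"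
    proof (intro equalityI subsetI)
      fix x assume x: "x \<in> \<Union>\<P> \<inter> ball y (min e1 e2)"
      then obtain Q where Q: "Q \<in> \<P>" "x \<in> Q" by blast
      have "Q \<notin> \<Q>" using x e2(2) Q by auto
      then have "y \<in> Q" using Q unfolding \<Q>_def by blast
      then have "U \<subseteq> Q" using split[OF Q(1)] y by blast
      then show "x \<in> A \<inter> ball y (min e1 e2)" using in_A[OF Q(1)] Q x by blast
    next
      fix x assume x: "x \<in> A \<inter> ball y (min e1 e2)"
      then have "x \<in> P" using e1(2) UP by auto
      then show "x \<in> \<Union>\<P> \<inter> ball y (min e1 e2)" using P(1) x by blast
    qed
    then show "\<Union>\<P> \<inter> ball y (min e1 e2) = (+) y ` span ((\<lambda>x. - q + x) ` P) \<inter> ball y (min e1 e2)"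
      using affine_hull_eq_translate_span[OF P(2), of y] UA y unfolding A_def by blast
  qed
qed

text \<open>The chart is restricted to the preimage of the ball around \<open>y\<close> and rescaled.\<close>

lemma regular_point_if_flat:
  fixes K W V :: "'a::euclidean_space set" and \<Psi> :: "'a \<Rightarrow> 'a"
  assumes diffeo: "Ck_diffeomorphism (Suc k) \<Psi> W V" and y: "y \<in> V"
    and L: "subspace L" "dim L = m" and "0 < e" "ball y e \<subseteq> V"
    and flat: "\<Psi> ` (K \<inter> W) \<inter> ball y e = (+) y ` L \<inter> ball y e"
  shows "regular_point (Suc k) m K (inv_into W \<Psi> y)"
proof -
  define \<Phi> where "\<Phi> = inv_into W \<Psi>"
  note facts = diffeo_facts[OF diffeo, folded \<Phi>_def]
  define W' where "W' = W \<inter> \<Psi> -` ball y e"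
  define \<Psi>' where "\<Psi>' z = (1 / e) *\<^sub>R (\<Psi> z - y)" for z
  have "open W'" unfolding W'_def using facts(1,11) by (intro continuous_open_preimage) auto
  have W'_W: "W' \<subseteq> W" unfolding W'_def by blast
  have ball_iff: "z \<in> ball y e \<longleftrightarrow> (1 / e) *\<^sub>R (z - y) \<in> ball 0 1" for z
    using \<open>0 < e\<close> by (simp add: dist_norm norm_minus_commute divide_less_eq)
  have ball_iff': "x \<in> ball 0 1 \<longleftrightarrow> y + e *\<^sub>R x \<in> ball y e" for x
    using \<open>0 < e\<close> by (simp add: dist_norm)
  have inv: "\<Psi>' (\<Phi> (y + e *\<^sub>R x)) = x" "\<Phi> (y + e *\<^sub>R x) \<in> W'" if "x \<in> ball 0 1" for x
  proof -
    have x: "y + e *\<^sub>R x \<in> ball y e" using that ball_iff' by blast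
    then have V: "y + e *\<^sub>R x \<in> V" using assms(6) by blast
    show "\<Psi>' (\<Phi> (y + e *\<^sub>R x)) = x" unfolding \<Psi>'_def using facts(6)[OF V] \<open>0 < e\<close> by simp
    show "\<Phi> (y + e *\<^sub>R x) \<in> W'" unfolding W'_def using facts(5,6)[OF V] x by simp
  qed
  have bij: "bij_betw \<Psi>' W' (ball 0 1)"
  proof (rule bij_betw_byWitness[where f' = "\<lambda>x. \<Phi> (y + e *\<^sub>R x)"])
    show "\<forall>z\<in>W'. \<Phi> (y + e *\<^sub>R \<Psi>' z) = z"
      unfolding \<Psi>'_def using facts(7) W'_W \<open>0 < e\<close> by auto
    show "\<forall>x\<in>ball 0 1. \<Psi>' (\<Phi> (y + e *\<^sub>R x)) = x" using inv by blast
    show "\<Psi>' ` W' \<subseteq> ball 0 1" unfolding \<Psi>'_def W'_def using ball_iff by blast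
    show "(\<lambda>x. \<Phi> (y + e *\<^sub>R x)) ` ball 0 1 \<subseteq> W'" using inv by blast
  qed
  have inv_eq: "inv_into W' \<Psi>' x = \<Phi> (y + e *\<^sub>R x)" if "x \<in> ball 0 1" for x
    using inv[OF that] bij by (metis bij_betw_imp_inj_on inv_into_f_f)
  have "chart_around (Suc k) (\<Phi> y) W' \<Psi>'"
    unfolding chart_around_def Ck_diffeomorphism_def
  proof (intro conjI)
    show "\<Phi> y \<in> W'" using inv(2)[of 0] by simp
    show "Ck_on (Suc k) \<Psi>' W'"
      unfolding \<Psi>'_def[abs_def]
      by (rule Ck_on_affine_post[OF \<open>open W'\<close> Ck_on_subset[OF facts(3) W'_W]])
    have "Ck_on (Suc k) (\<lambda>x. \<Phi> (y + e *\<^sub>R x)) (ball 0 1)"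
      by (rule Ck_on_affine_pre[OF facts(2) open_ball _ facts(4)]) (use ball_iff' assms(6) in blast)
    then show "Ck_on (Suc k) (inv_into W' \<Psi>') (ball 0 1)"
      by (rule Ck_on_cong_open[OF open_ball, rotated]) (simp add: inv_eq)
  qed (use \<open>open W'\<close> bij in auto)
  moreover have "\<Psi>' ` (K \<inter> W') = ball 0 1 \<inter> L"
  proof (intro equalityI subsetI)
    fix x assume "x \<in> \<Psi>' ` (K \<inter> W')"
    then obtain z where z: "z \<in> K" "z \<in> W" "\<Psi> z \<in> ball y e" "x = \<Psi>' z" unfolding W'_def by blast
    then have "\<Psi> z \<in> (+) y ` L \<inter> ball y e" using flat by blast
    then obtain l where "l \<in> L" "\<Psi> z = y + l" by blast
    then show "x \<in> ball 0 1 \<inter> L"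
      using z ball_iff[of "\<Psi> z"] L(1) unfolding \<Psi>'_def by (simp add: subspace_scale)
  next
    fix x assume x: "x \<in> ball 0 1 \<inter> L"
    then have "y + e *\<^sub>R x \<in> (+) y ` L \<inter> ball y e" using ball_iff' L(1) by (simp add: subspace_scale)
    then have "y + e *\<^sub>R x \<in> \<Psi> ` (K \<inter> W)" using flat by blast
    then obtain z where z: "z \<in> K" "z \<in> W" "\<Psi> z = y + e *\<^sub>R x" by auto
    then have "\<Phi> (y + e *\<^sub>R x) = z" using facts(7) by metis
    then show "x \<in> \<Psi>' ` (K \<inter> W')" using inv[of x] x z by (metis IntD1 IntI imageI)
  qed
  moreover have "\<Phi> y \<in> K"
  proof -
    have "y \<in> (+) y ` L \<inter> ball y e" using L(1) \<open>0 < e\<close> by (auto simp: image_iff intro!: bexI[of _ 0] subspace_0)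
    then have "y \<in> \<Psi> ` (K \<inter> W)" using flat by blast
    then show ?thesis using facts(7) by auto
  qed
  ultimately show ?thesis
    unfolding regular_point_def \<Phi>_def[symmetric] using L by blast
qed

text \<open>Choose points \<open>y j\<close> as in the last hypothesis that converge to \<open>q\<close>. They give regular points of \<open>K\<close> whose
  tangent spaces are the images of \<open>L\<close> under the differentials at \<open>y j\<close>, and these converge to the image
  under the differential at \<open>q\<close>. So the latter satisfies the condition in \<^const>\<open>CR_generic\<close>. The point
  over \<open>q\<close> may be singular, and at a regular one \<open>y j = q\<close> can be taken.\<close>

lemma CR_generic_at_limit:
  fixes K W V :: "(complex ^ 'n) set" and \<Psi> :: "complex ^ 'n \<Rightarrow> complex ^ 'n"
  assumes gen: "CR_generic (Suc k) m K" and diffeo: "Ck_diffeomorphism (Suc k) \<Psi> W V" and q: "q \<in> V"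
    and qK: "inv_into W \<Psi> q \<in> K" and L: "subspace L" "dim L = m"
    and flat: "\<And>\<epsilon>. 0 < \<epsilon> \<Longrightarrow> \<exists>y e. dist y q < \<epsilon> \<and> 0 < e \<and> y \<in> V \<and> ball y e \<subseteq> V \<and>
      \<Psi> ` (K \<inter> W) \<inter> ball y e = (+) y ` L \<inter> ball y e"
  shows "{u + \<i> *s w | u w. u \<in> jet1 (inv_into W \<Psi>) q ` L \<and> w \<in> jet1 (inv_into W \<Psi>) q ` L} = UNIV"
proof -
  define \<Phi> where "\<Phi> = inv_into W \<Psi>"
  note facts = diffeo_facts[OF diffeo, folded \<Phi>_def]
  define T where "T y = jet1 \<Phi> y" for y
  have linT: "linear (T y)" for y unfolding T_def by (rule linear_jet1)
  have inj: "inj (T q)"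
    unfolding T_def \<Phi>_def by (rule inj_on_inverseI[where g = "jet1 \<Psi> (inv_into W \<Psi> q)"]) (rule jet1_inverse[OF diffeo q])
  have "\<forall>j::nat. \<exists>y. dist y q < 1 / (Suc j) \<and> y \<in> V \<and>
      regular_point (Suc k) m K (\<Phi> y) \<and> tangent_space_at K (\<Phi> y) = T y ` L"
  proof
    fix j :: nat
    obtain y e where y: "dist y q < 1 / (Suc j)" "0 < e" "y \<in> V" "ball y e \<subseteq> V"
      "\<Psi> ` (K \<inter> W) \<inter> ball y e = (+) y ` L \<inter> ball y e"
      using flat[of "1 / (Suc j)"] by auto
    then show "\<exists>y. dist y q < 1 / (Suc j) \<and> y \<in> V \<and>
      regular_point (Suc k) m K (\<Phi> y) \<and> tangent_space_at K (\<Phi> y) = T y ` L"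
      unfolding \<Phi>_def T_def
      using regular_point_if_flat[OF diffeo y(3) L y(2,4,5)]
        tangent_space_in_chart[OF diffeo y(3) L(1) y(2,4,5)] by blast
  qed
  then obtain y where y: "\<And>j. dist (y j) q < 1 / (Suc j)" "\<And>j. y j \<in> V"
    "\<And>j. regular_point (Suc k) m K (\<Phi> (y j))" "\<And>j. tangent_space_at K (\<Phi> (y j)) = T (y j) ` L"
    by metis
  have y_lim: "y \<longlonglongrightarrow> q"
  proof -
    have le: "dist (y j) q \<le> inverse (real (Suc j))" for j
      using y(1)[of j] by (simp add: inverse_eq_divide)
    have "(\<lambda>j. dist (y j) q) \<longlonglongrightarrow> 0"
      by (rule tendsto_sandwich[OF _ _ tendsto_const LIMSEQ_inverse_real_of_nat])
        (intro always_eventually allI zero_le_dist le)+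
    then show ?thesis by (rule tendsto_dist_iff[THEN iffD2])
  qed
  have "isCont \<Phi> q" using facts(2,12) q by (simp add: continuous_on_eq_continuous_at)
  then have lim: "(\<lambda>j. \<Phi> (y j)) \<longlonglongrightarrow> \<Phi> q" using y_lim by (rule isCont_tendsto_compose)
  have sub: "subspace (T q ` L)" by (rule linear_subspace_image[OF linT L(1)])
  have dim: "dim (T q ` L) = m"
    using dim_image_eq[OF linT] inj L by (metis inj_on_subset subset_UNIV)
  have gap: "(\<lambda>j. gap_dist (tangent_space_at K (\<Phi> (y j))) (T q ` L)) \<longlonglongrightarrow> 0"
  proof (rule metric_LIMSEQ_I)
    fix r :: real assume "0 < r"
    then have "0 < r / 2" by simp
    obtain \<kappa> where \<kappa>: "0 < \<kappa>" "\<And>T'. \<lbrakk>linear T'; \<And>v. norm (T' v - T q v) \<le> \<kappa> * norm v\<rbrakk> \<Longrightarrow>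
      0 \<le> gap_dist (T' ` L) (T q ` L) \<and> gap_dist (T' ` L) (T q ` L) \<le> r / 2"
      by (rule gap_dist_linear_images[OF linT inj_on_subset[OF inj] L(1) \<open>0 < r / 2\<close>]) auto
    obtain \<rho> where \<rho>: "0 < \<rho>" "\<And>y w. dist y q \<le> \<rho> \<Longrightarrow> norm (T y w - T q w) \<le> \<kappa> * norm w"
      unfolding T_def by (rule jet1_close[OF facts(2) q facts(13) \<kappa>(1)]) blast
    obtain N where "\<And>j. j \<ge> N \<Longrightarrow> dist (y j) q < \<rho>" using metric_LIMSEQ_D[OF y_lim \<rho>(1)] by blast
    then have "0 \<le> gap_dist (T (y j) ` L) (T q ` L) \<and> gap_dist (T (y j) ` L) (T q ` L) \<le> r / 2"
      if "j \<ge> N" for j using that by (intro \<kappa>(2) linT \<rho>(2)) (auto simp: less_imp_le)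
    then show "\<exists>N. \<forall>j\<ge>N. dist (gap_dist (tangent_space_at K (\<Phi> (y j))) (T q ` L)) 0 < r"
      unfolding y(4) using \<open>0 < r\<close> by (intro exI[of _ N]) (fastforce simp: dist_real_def)
  qed
  show ?thesis
    using gen[unfolded CR_generic_def, rule_format, of "\<Phi> q" "\<lambda>j. \<Phi> (y j)" "T q ` L",
        OF qK[folded \<Phi>_def] y(3) lim sub dim gap]
    unfolding \<Phi>_def T_def .
qed

section \<open>The gradient estimate\<close>

text \<open>The bound \<open>M > 0\<close> stands in for the supremum norm, so that polynomials vanishing on \<open>K\<close> need no separate
  treatment until the very end.\<close>

definition gradient_bound_at :: "(complex ^ 'n) set \<Rightarrow> nat \<Rightarrow> real \<Rightarrow> complex ^ 'n \<Rightarrow> bool" where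
  "gradient_bound_at K k B p \<longleftrightarrow> (\<forall>f :: 'n cpoly. \<forall>M>0. (\<forall>z\<in>K. cmod (eval_cpoly f z) \<le> M) \<longrightarrow>
     norm (holo_gradient (eval_cpoly f) p) \<le> B * real (total_degree f) ^ k * M)"

lemma gradient_bound_at_mono:
  assumes "gradient_bound_at K k B p" "B \<le> B'" shows "gradient_bound_at K k B' p"
  unfolding gradient_bound_at_def
proof (intro allI impI)
  fix f M assume "0 < (M::real)" "\<forall>z\<in>K. cmod (eval_cpoly f z) \<le> M"
  then have "norm (holo_gradient (eval_cpoly f) p) \<le> B * real (total_degree f) ^ k * M"
    using assms(1) unfolding gradient_bound_at_def by blast
  also have "\<dots> \<le> B' * real (total_degree f) ^ k * M"
    using assms(2) \<open>0 < M\<close> by (intro mult_right_mono) auto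
  finally show "norm (holo_gradient (eval_cpoly f) p) \<le> B' * real (total_degree f) ^ k * M" .
qed

lemma gradient_bound_near:
  fixes f :: "'a::euclidean_space \<Rightarrow> complex ^ 'n" and v0 :: "'b::euclidean_space \<Rightarrow> 'a"
  assumes k: "k = 1 \<or> k = 2" and f: "Ck_on 3 f S" and S: "open S" "q0 \<in> S"
    and span: "{u + \<i> *s w | u w. u \<in> jet1 f q0 ` span (v0 ` Basis) \<and> w \<in> jet1 f q0 ` span (v0 ` Basis)} = UNIV"
  obtains \<rho> B where "0 < \<rho>" "0 < B"
    "\<And>K q v. \<lbrakk>dist q q0 < \<rho>; \<And>b. b \<in> Basis \<Longrightarrow> norm (v b - v0 b) < \<rho>;
      \<And>t. norm t \<le> 1 \<Longrightarrow> power_map k q v t \<in> S \<Longrightarrow> f (power_map k q v t) \<in> K\<rbrakk> \<Longrightarrow>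
      gradient_bound_at K k B (f q)"
proof -
  obtain \<rho> C r where \<rho>: "0 < \<rho>" and C: "1 \<le> C" and r: "0 < r" "r \<le> 1" and
    sys: "\<And>K q v. \<lbrakk>dist q q0 < \<rho>; \<And>b. b \<in> Basis \<Longrightarrow> norm (v b - v0 b) < \<rho>;
      \<And>t. norm t \<le> 1 \<Longrightarrow> power_map k q v t \<in> S \<Longrightarrow> f (power_map k q v t) \<in> K\<rbrakk> \<Longrightarrow>
      disc_system k C r K (f q)
        (\<lambda>t s. quasi_extension f (power_map k q v t) (power_map1 k v t s) (power_map2 k v s))"
    by (rule disc_system_of_power_map[OF k f S span]) blast
  obtain B where "0 < B" and B: "\<And>K p (Q :: 'b \<Rightarrow> 'b \<Rightarrow> complex ^ 'n) f M.
      \<lbrakk>disc_system k C r K p Q; 0 < M; \<And>z. z \<in> K \<Longrightarrow> cmod (eval_cpoly f z) \<le> M\<rbrakk>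
      \<Longrightarrow> norm (holo_gradient (eval_cpoly f) p) \<le> B * real (total_degree f) ^ k * M"
    by (rule disc_system_gradient_bound[OF k C r, where 'b = 'b and 'n = 'n]) blast
  show thesis
  proof
    show "0 < \<rho>" "0 < B" by fact+
    fix K q and v :: "'b \<Rightarrow> 'a"
    assume "dist q q0 < \<rho>" "\<And>b. b \<in> Basis \<Longrightarrow> norm (v b - v0 b) < \<rho>"
      "\<And>t. norm t \<le> 1 \<Longrightarrow> power_map k q v t \<in> S \<Longrightarrow> f (power_map k q v t) \<in> K"
    from B[OF sys[OF this]] show "gradient_bound_at K k B (f q)"
      unfolding gradient_bound_at_def by blast
  qed
qed

text \<open>A basis of \<open>span X\<close> within \<open>X\<close>, padded with zeros so that it can be indexed by the standard basis.\<close>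

lemma spanning_family:
  fixes X :: "'a::euclidean_space set"
  assumes "0 \<in> X"
  obtains v :: "'a \<Rightarrow> 'a" where "\<And>b. b \<in> Basis \<Longrightarrow> v b \<in> X" "span (v ` Basis) = span X"
proof -
  obtain B where B: "B \<subseteq> X" "independent B" "X \<subseteq> span B" "card B = dim X"
    using basis_exists[of X] by blast
  have "finite B" using B(2) by (rule independent_imp_finite)
  moreover have "card B \<le> card (Basis :: 'a set)" using B(4) dim_subset_UNIV[of X] by simp
  ultimately obtain g where g: "g ` B \<subseteq> (Basis :: 'a set)" "inj_on g B"
    using card_le_inj[of B "Basis :: 'a set"] by auto
  define v where "v b = (if b \<in> g ` B then inv_into B g b else 0)" for b
  have v_in: "v b \<in> insert 0 B" for b unfolding v_def by (auto simp: inv_into_into)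
  have "B \<subseteq> v ` Basis"
  proof
    fix x assume "x \<in> B"
    then have "v (g x) = x" unfolding v_def using g by simp
    then show "x \<in> v ` Basis" using \<open>x \<in> B\<close> g(1) by (metis imageI image_subset_iff)
  qed
  then have "span B \<subseteq> span (v ` Basis)" by (rule span_mono)
  moreover have "span (v ` Basis) \<subseteq> span (insert 0 B)" using v_in by (intro span_mono) blast
  moreover have "span B = span X" using B by (metis span_mono span_span subset_antisym)
  ultimately have "span (v ` Basis) = span X" by (simp add: span_insert_0)
  moreover have "v b \<in> X" for b using v_in[of b] B(1) assms by (metis insertE subsetD)
  ultimately show thesis using that by blast
qed

text \<open>Each polyhedron \<open>P\<close> containing \<open>q0\<close> is treated separately. Points \<open>v0 b + q0\<close> of \<open>P\<close> are fixed such that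
  the \<open>v0 b\<close> span the direction space of \<open>P\<close>, and at a nearby \<open>q \<in> P\<close> the directions \<open>v0 b + q0 - q\<close> towards
  the same points are used. The map with \<open>k = 2\<close> then stays in \<open>P\<close> by convexity, wherever \<open>q\<close> lies in \<open>P\<close>.\<close>

lemma gradient_bound_near_piecewise_smooth_point:
  fixes K :: "(complex ^ 'n) set"
  assumes K: "piecewise_smooth_submanifold 5 m K" "CR_generic 5 m K" and "p \<in> K"
  shows "\<exists>N B. open N \<and> p \<in> N \<and> 0 < B \<and> (\<forall>q\<in>K \<inter> N. gradient_bound_at K 2 B q)"
proof -
  obtain W \<Psi> \<P> where chart: "chart_around 5 p W \<Psi>" and fin: "finite \<P>"
    and \<P>: "\<And>P. P \<in> \<P> \<Longrightarrow> polyhedron P \<and> aff_dim P = int m"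
    and img: "\<Psi> ` (K \<inter> W) = ball 0 1 \<inter> \<Union>\<P>"
    using K(1) \<open>p \<in> K\<close> unfolding piecewise_smooth_submanifold_def by metis
  define \<Phi> where "\<Phi> = inv_into W \<Psi>"
  define q0 where "q0 = \<Psi> p"
  have "p \<in> W" and diffeo: "Ck_diffeomorphism (Suc 4) \<Psi> W (ball 0 1)"
    using chart unfolding chart_around_def by simp_all
  note facts = diffeo_facts[OF diffeo, folded \<Phi>_def]
  have q0: "q0 \<in> ball 0 1" unfolding q0_def using facts(8) \<open>p \<in> W\<close> .
  have C3: "Ck_on 3 \<Phi> (ball 0 1)" by (rule Ck_on_le[OF facts(4)]) simp
  have in_K: "\<Phi> y \<in> K" if "y \<in> ball 0 1" "P \<in> \<P>" "y \<in> P" for y P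
  proof -
    have "y \<in> \<Psi> ` (K \<inter> W)" using that unfolding img by blast
    then show ?thesis using facts(7) by auto
  qed
  have "\<exists>\<rho> B. 0 < \<rho> \<and> 0 < B \<and> (\<forall>q\<in>P \<inter> ball 0 1. dist q q0 < \<rho> \<longrightarrow> gradient_bound_at K 2 B (\<Phi> q))"
    if P: "P \<in> \<P>" for P
  proof (cases "q0 \<in> P")
    case False
    have "closed P" using \<P>[OF P] polyhedron_imp_closed by blast
    then obtain \<rho> where "0 < \<rho>" "ball q0 \<rho> \<subseteq> - P"
      using False by (metis Compl_iff open_Compl open_contains_ball)
    then have "\<forall>q\<in>P \<inter> ball 0 1. dist q q0 < \<rho> \<longrightarrow> gradient_bound_at K 2 1 (\<Phi> q)"
    proof (intro ballI impI)
      fix q assume "q \<in> P \<inter> ball 0 1" "dist q q0 < \<rho>"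
      moreover from this have "q \<in> ball q0 \<rho>" by (simp add: dist_commute)
      ultimately show "gradient_bound_at K 2 1 (\<Phi> q)" using \<open>ball q0 \<rho> \<subseteq> - P\<close> by blast
    qed
    then show ?thesis using \<open>0 < \<rho>\<close> zero_less_one by blast
  next
    case True
    have "convex P" using \<P>[OF P] polyhedron_imp_convex by blast
    define X where "X = (\<lambda>x. - q0 + x) ` P"
    have "0 \<in> X" unfolding X_def using True by (auto intro!: image_eqI[of _ _ q0])
    then obtain v0 :: "complex ^ 'n \<Rightarrow> complex ^ 'n" where v0: "\<And>b. b \<in> Basis \<Longrightarrow> v0 b \<in> X" "span (v0 ` Basis) = span X"
      using spanning_family by blast
    have "dim (span X) = m"
      using \<P>[OF P] aff_dim_eq_dim[of q0 P] hull_inc[OF True, of affine] unfolding X_def by (simp add: dim_span)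
    have "\<exists>y e. dist y q0 < \<epsilon> \<and> 0 < e \<and> y \<in> ball 0 1 \<and> ball y e \<subseteq> ball 0 1 \<and>
      \<Psi> ` (K \<inter> W) \<inter> ball y e = (+) y ` span X \<inter> ball y e" if "0 < \<epsilon>" for \<epsilon>
    proof -
      obtain \<epsilon>' where \<epsilon>': "0 < \<epsilon>'" "ball q0 \<epsilon>' \<subseteq> ball 0 1" using q0 open_contains_ball[of "ball 0 1"] by blast
      have "0 < min \<epsilon> \<epsilon>'" using that \<epsilon>' by simp
      then obtain y e where y: "dist y q0 < min \<epsilon> \<epsilon>'" "0 < e" and
        flat: "\<Union>\<P> \<inter> ball y e = (+) y ` span X \<inter> ball y e"
        using flat_points_dense[OF fin \<P> P True] unfolding X_def by metis
      have "y \<in> ball 0 1" using y(1) \<epsilon>'(2) by (auto simp: dist_commute)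
      then obtain e' where e': "0 < e'" "ball y e' \<subseteq> ball 0 1" using open_contains_ball[of "ball 0 1"] by blast
      have "\<Psi> ` (K \<inter> W) \<inter> ball y (min e e') = (+) y ` span X \<inter> ball y (min e e')"
        unfolding img using flat e'(2) by auto
      then show ?thesis
        using y \<open>y \<in> ball 0 1\<close> e' by (intro exI[of _ y] exI[of _ "min e e'"]) auto
    qed
    moreover have "\<Phi> q0 \<in> K" unfolding \<Phi>_def q0_def using facts(7) \<open>p \<in> W\<close> \<open>p \<in> K\<close> \<Phi>_def by simp
    ultimately have span: "{u + \<i> *s w | u w. u \<in> jet1 \<Phi> q0 ` span (v0 ` Basis) \<and>
        w \<in> jet1 \<Phi> q0 ` span (v0 ` Basis)} = UNIV"
      unfolding v0(2) \<Phi>_def using \<open>dim (span X) = m\<close> K(2)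
      by (intro CR_generic_at_limit[OF _ diffeo q0]) auto
    obtain \<rho> B where \<rho>: "0 < \<rho>" "0 < B" and bound:
      "\<And>K q v. \<lbrakk>dist q q0 < \<rho>; \<And>b. b \<in> Basis \<Longrightarrow> norm (v b - v0 b) < \<rho>;
        \<And>t. norm t \<le> 1 \<Longrightarrow> power_map 2 q v t \<in> ball 0 1 \<Longrightarrow> \<Phi> (power_map 2 q v t) \<in> K\<rbrakk> \<Longrightarrow>
        gradient_bound_at K 2 B (\<Phi> q)"
      by (rule gradient_bound_near[OF _ C3 open_ball q0 span, of 2]) auto
    have "gradient_bound_at K 2 B (\<Phi> q)" if q: "q \<in> P" "dist q q0 < \<rho>" for q
    proof (rule bound[where v = "\<lambda>b. (v0 b + q0) - q"])
      show "dist q q0 < \<rho>" by fact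
      show "norm (v0 b + q0 - q - v0 b) < \<rho>" for b using q(2) by (simp add: dist_norm norm_minus_commute)
      \<comment> \<open>The point is a convex combination of \<open>q\<close> and the \<open>v0 b + q0\<close>.\<close>
      fix t :: "complex ^ 'n" assume t: "norm t \<le> 1" "power_map 2 q (\<lambda>b. v0 b + q0 - q) t \<in> ball 0 1"
      have sum1: "(\<Sum>b\<in>Basis. (t \<bullet> b)\<^sup>2) \<le> 1"
      proof -
        have "(\<Sum>b\<in>Basis. (t \<bullet> b)\<^sup>2) = (norm t)\<^sup>2"
          unfolding power2_norm_eq_inner euclidean_inner[of t t] by (simp add: power2_eq_square)
        then show ?thesis using t(1) by (simp add: power_le_one)
      qed
      have "power_map 2 q (\<lambda>b. v0 b + q0 - q) t
          = (1 - (\<Sum>b\<in>Basis. (t \<bullet> b)\<^sup>2)) *\<^sub>R q + (\<Sum>b\<in>Basis. (t \<bullet> b)\<^sup>2 *\<^sub>R (v0 b + q0))"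
        unfolding power_map_def
        by (simp add: scaleR_left_diff_distrib scaleR_right_diff_distrib sum_subtractf scaleR_sum_left)
      also have "\<dots> \<in> P"
      proof -
        define x where "x c = (case c of None \<Rightarrow> q | Some b \<Rightarrow> v0 b + q0)" for c
        define a where "a c = (case c of None \<Rightarrow> 1 - (\<Sum>b\<in>Basis. (t \<bullet> b)\<^sup>2) | Some b \<Rightarrow> (t \<bullet> b)\<^sup>2)" for c
        define I where "I = insert None (Some ` (Basis :: (complex ^ 'n) set))"
        have "(\<Sum>c\<in>I. a c *\<^sub>R x c) \<in> P"
        proof (rule convex_sum[OF _ \<open>convex P\<close>])
          show "finite I" unfolding I_def by simp
          show "(\<Sum>c\<in>I. a c) = 1" unfolding I_def a_def by (simp add: sum.reindex)
          show "0 \<le> a c" for c unfolding a_def using sum1 by (simp split: option.split)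
          show "x c \<in> P" if "c \<in> I" for c
          proof -
            have "v0 b + q0 \<in> P" if "b \<in> Basis" for b using v0(1)[OF that] unfolding X_def by auto
            then show ?thesis using that q(1) unfolding x_def I_def by auto
          qed
        qed
        then show ?thesis unfolding I_def a_def x_def by (simp add: sum.reindex)
      qed
      finally show "\<Phi> (power_map 2 q (\<lambda>b. v0 b + q0 - q) t) \<in> K" using in_K[OF t(2) P] by blast
    qed
    then show ?thesis using \<rho> by blast
  qed
  then obtain \<rho> B where \<rho>: "\<And>P. P \<in> \<P> \<Longrightarrow> 0 < \<rho> P" and B: "\<And>P. P \<in> \<P> \<Longrightarrow> 0 < B P"
    and bound: "\<And>P q. \<lbrakk>P \<in> \<P>; q \<in> P; q \<in> ball 0 1; dist q q0 < \<rho> P\<rbrakk> \<Longrightarrow> gradient_bound_at K 2 (B P) (\<Phi> q)"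
    by (metis IntI)
  define \<rho>' where "\<rho>' = Min (insert 1 (\<rho> ` \<P>))"
  have \<rho>': "0 < \<rho>'" "\<And>P. P \<in> \<P> \<Longrightarrow> \<rho>' \<le> \<rho> P" unfolding \<rho>'_def using fin \<rho> by auto
  define B' where "B' = 1 + (\<Sum>P\<in>\<P>. B P)"
  have B': "0 < B'" "\<And>P. P \<in> \<P> \<Longrightarrow> B P \<le> B'"
  proof -
    show "0 < B'" unfolding B'_def using B by (simp add: add_pos_nonneg sum_nonneg less_imp_le)
    show "B P \<le> B'" if "P \<in> \<P>" for P
      unfolding B'_def using member_le_sum[OF that, of B] B fin by (simp add: less_imp_le)
  qed
  define N where "N = W \<inter> \<Psi> -` ball q0 \<rho>'"
  have "open N" unfolding N_def using facts(1,11) by (intro continuous_open_preimage) auto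
  moreover have "p \<in> N" unfolding N_def using \<open>p \<in> W\<close> \<rho>'(1) by (simp add: q0_def)
  moreover have "gradient_bound_at K 2 B' z" if z: "z \<in> K \<inter> N" for z
  proof -
    have zW: "z \<in> W" "z \<in> K" "dist (\<Psi> z) q0 < \<rho>'" using z unfolding N_def by (auto simp: dist_commute)
    then have "\<Psi> z \<in> ball 0 1 \<inter> \<Union>\<P>" using img by blast
    then obtain P where P: "P \<in> \<P>" "\<Psi> z \<in> P" "\<Psi> z \<in> ball 0 1" by blast
    have "gradient_bound_at K 2 (B P) (\<Phi> (\<Psi> z))"
      using zW(3) \<rho>'(2)[OF P(1)] by (intro bound P) simp
    then show ?thesis using facts(7)[OF zW(1)] gradient_bound_at_mono[OF _ B'(2)[OF P(1)]] by simp
  qed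
  ultimately show ?thesis using B'(1) by blast
qed

text \<open>Here \<open>K\<close> is a full subspace \<open>L\<close> in the chart, so the parameters may enter linearly and the better
  exponent \<open>k = 1\<close> is available. The same directions serve all nearby points.\<close>

lemma gradient_bound_near_regular_point:
  fixes K :: "(complex ^ 'n) set"
  assumes gen: "CR_generic 5 m K" and p: "regular_point 5 m K p"
  shows "\<exists>N B. open N \<and> p \<in> N \<and> 0 < B \<and> (\<forall>q\<in>K \<inter> N. gradient_bound_at K 1 B q)"
proof -
  have "p \<in> K" using p unfolding regular_point_def by blast
  obtain W \<Psi> L where chart: "chart_around 5 p W \<Psi>" and L: "subspace L" "dim L = m"
    and img: "\<Psi> ` (K \<inter> W) = ball 0 1 \<inter> L"
    using p unfolding regular_point_def by blast
  define \<Phi> where "\<Phi> = inv_into W \<Psi>"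
  define q0 where "q0 = \<Psi> p"
  have "p \<in> W" and diffeo: "Ck_diffeomorphism (Suc 4) \<Psi> W (ball 0 1)"
    using chart unfolding chart_around_def by simp_all
  note facts = diffeo_facts[OF diffeo, folded \<Phi>_def]
  have q0: "q0 \<in> ball 0 1" unfolding q0_def using facts(8) \<open>p \<in> W\<close> .
  have q0L: "q0 \<in> L" using img \<open>p \<in> W\<close> \<open>p \<in> K\<close> unfolding q0_def by blast
  have C3: "Ck_on 3 \<Phi> (ball 0 1)" by (rule Ck_on_le[OF facts(4)]) simp
  have in_K: "\<Phi> y \<in> K" if "y \<in> ball 0 1" "y \<in> L" for y
  proof -
    have "y \<in> \<Psi> ` (K \<inter> W)" using that unfolding img by blast
    then show ?thesis using facts(7) by auto
  qed
  obtain v0 :: "complex ^ 'n \<Rightarrow> complex ^ 'n" where v0: "\<And>b. b \<in> Basis \<Longrightarrow> v0 b \<in> L" "span (v0 ` Basis) = span L"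
    using spanning_family[OF subspace_0[OF L(1)]] by blast
  have span_L: "span L = L" using L(1) by (simp add: span_eq_iff)
  have translate: "(+) q0 ` L = L"
  proof (intro equalityI subsetI)
    show "x \<in> L" if "x \<in> (+) q0 ` L" for x using that q0L L(1) by (auto simp: subspace_add)
    show "x \<in> (+) q0 ` L" if "x \<in> L" for x
      using subspace_diff[OF L(1) that q0L] by (intro image_eqI[of _ _ "x - q0"]) auto
  qed
  obtain e where e: "0 < e" "ball q0 e \<subseteq> ball 0 1" using q0 open_contains_ball[of "ball 0 1"] by blast
  have "\<Psi> ` (K \<inter> W) \<inter> ball q0 e = (+) q0 ` L \<inter> ball q0 e" unfolding img translate using e(2) by blast
  then have "\<exists>y e. dist y q0 < \<epsilon> \<and> 0 < e \<and> y \<in> ball 0 1 \<and> ball y e \<subseteq> ball 0 1 \<and>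
      \<Psi> ` (K \<inter> W) \<inter> ball y e = (+) y ` L \<inter> ball y e" if "0 < \<epsilon>" for \<epsilon>
    using that e q0 by (intro exI[of _ q0] exI[of _ e]) auto
  moreover have "\<Phi> q0 \<in> K" using in_K[OF q0 q0L] .
  ultimately have span: "{u + \<i> *s w | u w. u \<in> jet1 \<Phi> q0 ` span (v0 ` Basis) \<and>
        w \<in> jet1 \<Phi> q0 ` span (v0 ` Basis)} = UNIV"
    unfolding v0(2) span_L \<Phi>_def using L gen
    by (intro CR_generic_at_limit[OF _ diffeo q0]) auto
  obtain \<rho> B where \<rho>: "0 < \<rho>" "0 < B" and bound:
      "\<And>K q v. \<lbrakk>dist q q0 < \<rho>; \<And>b. b \<in> Basis \<Longrightarrow> norm (v b - v0 b) < \<rho>;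
        \<And>t. norm t \<le> 1 \<Longrightarrow> power_map 1 q v t \<in> ball 0 1 \<Longrightarrow> \<Phi> (power_map 1 q v t) \<in> K\<rbrakk> \<Longrightarrow>
        gradient_bound_at K 1 B (\<Phi> q)"
    by (rule gradient_bound_near[OF _ C3 open_ball q0 span, of 1]) auto
  define N where "N = W \<inter> \<Psi> -` ball q0 \<rho>"
  have "open N" unfolding N_def using facts(1,11) by (intro continuous_open_preimage) auto
  moreover have "p \<in> N" unfolding N_def using \<open>p \<in> W\<close> \<rho>(1) by (simp add: q0_def)
  moreover have "gradient_bound_at K 1 B z" if z: "z \<in> K \<inter> N" for z
  proof -
    have zW: "z \<in> W" "z \<in> K" "dist (\<Psi> z) q0 < \<rho>" using z unfolding N_def by (auto simp: dist_commute)
    then have zL: "\<Psi> z \<in> ball 0 1 \<inter> L" using img by blast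
    have "gradient_bound_at K 1 B (\<Phi> (\<Psi> z))"
    proof (rule bound[where v = v0])
      fix t :: "complex ^ 'n" assume t: "power_map 1 (\<Psi> z) v0 t \<in> ball 0 1"
      have "power_map 1 (\<Psi> z) v0 t \<in> L"
        unfolding power_map_def using zL v0(1) L(1)
        by (intro subspace_add subspace_sum subspace_scale) auto
      then show "\<Phi> (power_map 1 (\<Psi> z) v0 t) \<in> K" by (rule in_K[OF t])
    qed (use zW \<rho> in auto)
    then show ?thesis using facts(7)[OF zW(1)] by simp
  qed
  ultimately show ?thesis using \<rho>(2) by blast
qed

lemma gradient_bound_on_compact:
  fixes K :: "(complex ^ 'n) set"
  assumes "compact K" and "0 < k"
    and near: "\<And>p. p \<in> K \<Longrightarrow> \<exists>N B. open N \<and> p \<in> N \<and> 0 < B \<and> (\<forall>q\<in>K \<inter> N. gradient_bound_at K k B q)"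
  shows "\<exists>C>0. \<forall>p :: 'n cpoly. sup_norm_on K (holo_gradient (eval_cpoly p))
      \<le> C * real (total_degree p) ^ k * sup_norm_on K (eval_cpoly p)"
proof (cases "K = {}")
  case True
  then show ?thesis by (intro exI[of _ 1]) (simp add: sup_norm_on_def)
next
  case False
  obtain N B where N: "\<And>p. p \<in> K \<Longrightarrow> open (N p)" "\<And>p. p \<in> K \<Longrightarrow> p \<in> N p"
    and B: "\<And>p. p \<in> K \<Longrightarrow> 0 < (B p :: real)"
    and bound: "\<And>p q. p \<in> K \<Longrightarrow> q \<in> K \<Longrightarrow> q \<in> N p \<Longrightarrow> gradient_bound_at K k (B p) q"
    using near by (metis IntI)
  obtain F where F: "F \<subseteq> K" "finite F" "K \<subseteq> (\<Union>p\<in>F. N p)"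
    using compactE_image[OF \<open>compact K\<close>, of K N] N by blast
  define C where "C = 1 + (\<Sum>p\<in>F. B p)"
  have "0 \<le> B p" if "p \<in> F" for p using B F that by (metis less_imp_le subsetD)
  note B_nonneg = this
  have "0 < C" unfolding C_def by (intro add_pos_nonneg sum_nonneg B_nonneg) auto
  have all: "gradient_bound_at K k C q" if q: "q \<in> K" for q
  proof -
    obtain p where p: "p \<in> F" "q \<in> N p" using F(3) q by blast
    have "B p \<le> C" unfolding C_def using member_le_sum[OF p(1), of B] B_nonneg F(2) by simp
    then show ?thesis using bound[OF _ q p(2)] p(1) F(1) gradient_bound_at_mono by blast
  qed
  show ?thesis
  proof (intro exI[of _ C] conjI allI)
    show "0 < C" by fact
    fix f :: "'n cpoly"
    define s where "s = sup_norm_on K (eval_cpoly f)"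
    have "bdd_above ((\<lambda>z. cmod (eval_cpoly f z)) ` K)"
      by (intro bounded_imp_bdd_above compact_imp_bounded compact_continuous_image \<open>compact K\<close>
          continuous_intros continuous_on_eval_cpoly)
    then have le_s: "cmod (eval_cpoly f z) \<le> s" if "z \<in> K" for z
      unfolding s_def sup_norm_on_def using False that by (auto intro: cSUP_upper)
    then have "0 \<le> s" using False norm_ge_zero order_trans by blast
    have "norm (holo_gradient (eval_cpoly f) q) \<le> C * real (total_degree f) ^ k * s" if q: "q \<in> K" for q
    proof (rule field_le_epsilon)
      fix e :: real assume "0 < e"
      define c where "c = C * real (total_degree f) ^ k"
      have "0 \<le> c" unfolding c_def using \<open>0 < C\<close> by simp
      have "0 < s + e / (c + 1)" using \<open>0 \<le> s\<close> \<open>0 < e\<close> \<open>0 \<le> c\<close> by (simp add: add_nonneg_pos)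
      moreover have "\<forall>z\<in>K. cmod (eval_cpoly f z) \<le> s + e / (c + 1)"
        using le_s \<open>0 < e\<close> \<open>0 \<le> c\<close> by (metis add_increasing2 divide_nonneg_nonneg less_imp_le add_nonneg_nonneg zero_le_one)
      ultimately have "norm (holo_gradient (eval_cpoly f) q) \<le> c * (s + e / (c + 1))"
        using all[OF q] unfolding gradient_bound_at_def c_def by blast
      also have "\<dots> = c * s + e * (c / (c + 1))" by (simp add: algebra_simps)
      also have "\<dots> \<le> c * s + e * 1"
        using \<open>0 < e\<close> \<open>0 \<le> c\<close> by (intro add_left_mono mult_left_mono) (auto simp: divide_le_eq)
      finally show "norm (holo_gradient (eval_cpoly f) q) \<le> C * real (total_degree f) ^ k * s + e"
        unfolding c_def by simp
    qed
    then show "sup_norm_on K (holo_gradient (eval_cpoly f))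
      \<le> C * real (total_degree f) ^ k * sup_norm_on K (eval_cpoly f)"
      unfolding s_def[symmetric] unfolding sup_norm_on_def using False by (auto intro: cSUP_least)
  qed
qed

theorem theorem3p13:
  fixes K :: "(complex ^ 'n) set" and m :: nat
  assumes "compact K"
    and "piecewise_smooth_submanifold 5 m K"
    and "CR_generic 5 m K"
  shows "(\<exists>C>0. \<forall>p :: 'n cpoly.
            sup_norm_on K (holo_gradient (eval_cpoly p))
              \<le> C * (real (total_degree p))\<^sup>2 * sup_norm_on K (eval_cpoly p)) \<and>
         (singular_part 5 m K = {} \<longrightarrow>
           (\<exists>C>0. \<forall>p :: 'n cpoly.
              sup_norm_on K (holo_gradient (eval_cpoly p))
                \<le> C * real (total_degree p) * sup_norm_on K (eval_cpoly p)))"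
proof (intro conjI impI)
  show "\<exists>C>0. \<forall>p :: 'n cpoly. sup_norm_on K (holo_gradient (eval_cpoly p))
      \<le> C * (real (total_degree p))\<^sup>2 * sup_norm_on K (eval_cpoly p)"
    using gradient_bound_near_piecewise_smooth_point[OF assms(2,3)]
    by (intro gradient_bound_on_compact[OF assms(1)]) auto
  assume "singular_part 5 m K = {}"
  then have "regular_point 5 m K p" if "p \<in> K" for p
    using that unfolding singular_part_def by blast
  then have "\<exists>C>0. \<forall>p :: 'n cpoly. sup_norm_on K (holo_gradient (eval_cpoly p))
      \<le> C * real (total_degree p) ^ 1 * sup_norm_on K (eval_cpoly p)"
    using gradient_bound_near_regular_point[OF assms(3)]
    by (intro gradient_bound_on_compact[OF assms(1)]) auto
  then show "\<exists>C>0. \<forall>p :: 'n cpoly. sup_norm_on K (holo_gradient (eval_cpoly p))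
      \<le> C * real (total_degree p) * sup_norm_on K (eval_cpoly p)"
    by simp
qed

end
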